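(* Consider a deterministic walk in random environment on $\mathbb{Z}^d$ with piecewise $C^2$ expanding local maps on $[0,1]$, as in the context. There is an integer $n_2\ge1$, depending only on the classes $\mathcal{T}$ and $\mathcal{H}$ and given explicitly in the context, such that if (C1), (C2) and (C3($n_2,n_3$)) hold for some $n_3\ge n_2$, then the following condition (Exp) holds: there exist $C_*>0$ and $\nu\in(0,1)$ such that for $\mathbb{P}$-a.e. $\bar\omega\in\Omega$, all $n>m\ge0$ and all $\bar w\in\mathcal{W}^{\mathbb{N}}$, $$\left|\mathbb{P}_{\bar\omega}(\bar w_n\mid\bar w_0\ldots\bar w_{n-1})-\mathbb{P}_{\tau_{z_m}\bar\omega}(\bar w_n\mid\bar w_m\ldots\bar w_{n-1})\right|\le C_*\nu^{n-m},\qquad z_m=\sum_{k=0}^{m-1}\bar w_k.$$ In particular there is a constant $C'>0$ such that for $\mathbb{P}$-a.e. $\bar\omega$, all $1\le m\le n$ and all admissible paths ($z_0=0$, $z_{k+1}-z_k\in\mathcal{W}$), $$\left|\mathbb{P}_\star(z_{n+1}\mid z_{n-m+1},\dots,z_n,\bar\omega)-\mathbb{P}_\star(z_{n+1}\mid z_1,\dots,z_n,\bar\omega)\right|\le C'\nu^m.$$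
   Context: Walk. $d\ge1$, $\mathcal{W}\subset\mathbb{Z}^d$ is finite, $A$ is a finite set, $\Omega=A^{\mathbb{Z}^d}$, $(\tau_z\bar\omega)_w=\bar\omega_{w+z}$, $\mathbb{P}$ is a translation invariant probability on $\Omega$, $m$ is Lebesgue measure on $[0,1]$. For $\alpha\in A$, $f_\alpha:[0,1]\to[0,1]$ is piecewise $C^2$ and uniformly expanding ($|f_\alpha'|\ge\lambda>1$), and $\{G_{\alpha,w}\}_{w\in\mathcal{W}}$ is a partition of $[0,1]$ into subintervals. With $e(\alpha,x)=\sum_{w}\mathbf{1}_{G_{\alpha,w}}(x)w$, the dynamics on $[0,1]\times\mathbb{Z}^d$ is $\mathbb{F}_{\bar\omega}(x,z)=(f_{\bar\omega_{z+e(\bar\omega_z,x)}}(x),z+e(\bar\omega_z,x))$; $(x_n,z_n)=\mathbb{F}^n_{\bar\omega}(x_0,0)$, with $x_0$ distributed with probability density $h_0\in BV$, $\inf h_0>0$. Let $\mathcal{L}_{f}$ be the transfer operator of $f$ with respect to $m$ and $\mathcal{L}_{\bar\omega,z,w}\phi=\mathcal{L}_{f_{\bar\omega_{z+w}}}(\mathbf{1}_{G_{\bar\omega_z,w}}\phi)$. For $w_0,\dots,w_{n-1}\in\mathcal{W}$ and $z_k=\sum_{j<k}w_j$, let $p(\bar\omega,n,w_0\ldots w_{n-1})=\int\mathcal{L}_{\bar\omega,z_{n-1},w_{n-1}}\cdots\mathcal{L}_{\bar\omega,z_0,w_0}h_0\,dm$ (the probability, given $\bar\omega$, that the first $n$ jumps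 are $w_0,\dots,w_{n-1}$), and $\mathbb{P}_{\bar\omega}(\bar w_n\mid\bar w_0\ldots\bar w_{n-1})=p(\bar\omega,n+1,\bar w_0\ldots\bar w_n)/p(\bar\omega,n,\bar w_0\ldots\bar w_{n-1})$. $\mathbb{P}_\star$ is the joint law of the environment ($\bar\omega\sim\mathbb{P}$) and the path $(z_n)$. Open products. $\mathcal{T}=\{f_\alpha\}_{\alpha\in A}$, $\mathcal{H}=\{G_{\alpha,w}\}_{\alpha\in A,w\in\mathcal{W}}$, $\Sigma=\mathcal{T}\times\mathcal{H}$; for $\sigma=(\sigma_1,\sigma_2,\dots)\in\Sigma^{\mathbb{N}}$ write $\sigma_k=(T_{\sigma_k},H_{\sigma_k})$; $\tau$ is the unilateral shift. Put $T^n_\sigma=T_{\sigma_n}\circ\cdots\circ T_{\sigma_1}$, $H^n_\sigma=\bigcap_{j=0}^{n-1}(T^j_\sigma)^{-1}(H_{\sigma_{j+1}})$, $\widehat{\mathcal{L}}_{\sigma_k}f=\mathcal{L}_{T_{\sigma_k}}(f\mathbf{1}_{H_{\sigma_k}})$, $\widehat{\mathcal{L}}^n_\sigma=\widehat{\mathcal{L}}_{\sigma_n}\cdots\widehat{\mathcal{L}}_{\sigma_1}$. Let $g_{\sigma_k}=\mathbf{1}_{H_{\sigma_k}}/|T_{\sigma_k}'|$, $g^n_\sigma=g_{\sigma_1}\cdot g_{\sigma_2}\circ T^1_\sigma\cdots g_{\sigma_n}\circ T_\sigma^{n-1}$ and $\Theta^{-1}=\inf_{T\in\mathcal{T}}\inf|T'|$.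 Functions are taken modulo null sets (inf/sup are essential) and interval partitions modulo endpoints. (C1) There is $\delta_\star>0$ with $\inf\widehat{\mathcal{L}}_{\sigma_1}\mathbf{1}\ge\delta_\star$ for all $\sigma_1\in\Sigma$. Under (C1) define $\Lambda_\sigma(f)=\lim_{n\to\infty}\inf\frac{\widehat{\mathcal{L}}^n_\sigma f}{\widehat{\mathcal{L}}^n_\sigma\mathbf{1}}$ (a bounded increasing limit), $\rho_\sigma=\Lambda_{\tau\sigma}(\widehat{\mathcal{L}}_{\sigma_1}\mathbf{1})$, $\rho=\inf_{\sigma}\rho_\sigma$. Let $\mathcal{Z}^n_\sigma$ be the partition into smoothness intervals of $T^n_\sigma$, and $\widehat{\mathcal{Z}}^n_\sigma$ the coarsest partition finer than $\mathcal{Z}^n_\sigma$ whose elements are either disjoint from $\overline{H^n_\sigma}$ or contained in $H^n_\sigma$. Let $\mathcal{Z}^n_{\sigma,\star}=\{Z\in\widehat{\mathcal{Z}}^n_\sigma: Z\subset H^n_\sigma\}$, $\mathcal{Z}^n_{\sigma,b}=\{Z\in\mathcal{Z}^n_{\sigma,\star}:\Lambda_\sigma(\mathbf{1}_Z)=0\}$, $\mathcal{Z}^n_{\sigma,g}=\{Z\in\mathcal{Z}^n_{\sigma,\star}:\Lambda_\sigma(\mathbf{1}_Z)>0\}$. Two elements of $\mathcal{Z}^n_{\sigma,\star}$ are called contiguous if they are contiguous in the usual sense or are separated by a connected component of $(H^n_\sigma)^c$. (C2) There exist $K\ge0$, $\xi\ge1$ such that for all $n$ and $\sigma$ at most $K\xi^n$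 elements of $\mathcal{Z}^n_{\sigma,b}$ are contiguous (successively), and $\theta:=\xi\Theta<\min\{\rho,1\}$. (C3($N,N'$)) $\hat\epsilon(N,N'):=\min_{1\le k\le N}\inf_{\sigma}\min_{Z\in\mathcal{Z}^k_{\sigma,g}}\inf_{x}\frac{(\widehat{\mathcal{L}}^{N'}_\sigma\mathbf{1}_Z)(x)}{(\widehat{\mathcal{L}}^{N'}_\sigma\mathbf{1})(x)}>0$. The integer $n_2$. Let $\epsilon_\star(n)=\min\{\hat\epsilon(n,m):m\ge n,\ \hat\epsilon(n,m)>0\}$ ($=0$ if there is no such $m$). Let $C$ be a constant with $\bigvee_Zg^n_\sigma\le C\|g^n_\sigma\|_\infty$ for all $n,\sigma$, $Z\in\mathcal{Z}^n_{\sigma,\star}$ ($\bigvee$ is total variation). Put $C_\star=3(C+1)+2K(3C+2)$, $C_n=(3C+2)(2K\xi+1)\Theta/\epsilon_\star(n)$ ($=\infty$ if $\epsilon_\star(n)=0$), $n_0=\lceil\ln(4C_\star^2)/\ln(\rho\theta^{-1})\rceil$. If $\epsilon_\star(n_0)=0$, $n_2=n_0$. If $\epsilon_\star(n_0)>0$, let $a=\max\{1,\frac{15}{11}\max_{1\le i\le n_0}\frac{C_i}{C_\star\theta^i}\}$, $B=1+2aC_\star$ and $n_2=\left\lceil\frac{\ln(4aB(1+2C_{n_0}\rho^{-n_0}))}{\ln(\theta^{-1}\rho)}\right\rceil$. *)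

theory Defs
  imports "HOL-Probability.Probability"
begin

text \<open>
  Functions on the unit interval are total functions on the reals of which only the values on
  \<open>[0,1]\<close> matter, up to null sets.
\<close>

abbreviation unit_leb :: "real measure"
  where "unit_leb \<equiv> lebesgue_on {0..1}"

definition ess_inf :: "(real \<Rightarrow> real) \<Rightarrow> real"
  where "ess_inf \<phi> = real_of_ereal (- esssup unit_leb (\<lambda>x. - ereal (\<phi> x)))"

definition ess_norm :: "(real \<Rightarrow> real) \<Rightarrow> real"
  where "ess_norm \<phi> = real_of_ereal (esssup unit_leb (\<lambda>x. ereal \<bar>\<phi> x\<bar>))"

definition total_variation :: "(real \<Rightarrow> real) \<Rightarrow> real set \<Rightarrow> ereal"
  where "total_variation \<phi> S =
    (SUP xs \<in> {xs. sorted xs \<and> set xs \<subseteq> S}.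
       ereal (\<Sum>i<length xs - 1. \<bar>\<phi> (xs ! Suc i) - \<phi> (xs ! i)\<bar>))"


section \<open>Piecewise smooth maps and transfer operators\<close>

definition C2_on :: "(real \<Rightarrow> real) \<Rightarrow> real set \<Rightarrow> bool"
  where "C2_on g S \<longleftrightarrow> (\<exists>g' g''.
    (\<forall>x\<in>S. (g has_real_derivative g' x) (at x within S)) \<and>
    (\<forall>x\<in>S. (g' has_real_derivative g'' x) (at x within S)) \<and>
    continuous_on S g'')"

definition smooth_set :: "(real \<Rightarrow> real) \<Rightarrow> real set"
  where "smooth_set T = {x \<in> {0<..<1}. \<exists>e>0. C2_on T (ball x e)}"

text \<open>
  As usual for piecewise expanding maps, each branch is required to be of class \<open>C\<^sup>2\<close> up to the
  closure of its interval of smoothness; the values at the finitely many break points are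
  arbitrary.
\<close>

definition piecewise_C2 :: "(real \<Rightarrow> real) \<Rightarrow> bool"
  where "piecewise_C2 T \<longleftrightarrow>
    finite ({0<..<1} - smooth_set T) \<and>
    (\<forall>J \<in> components (smooth_set T). \<exists>g. C2_on g (closure J) \<and> (\<forall>x\<in>J. g x = T x))"

text \<open>
  The transfer operator with respect to Lebesgue measure. For a piecewise \<open>C\<^sup>2\<close> expanding map the
  sum has finitely many terms; leaving out the break points changes it at finitely many points only.
\<close>

definition transfer :: "(real \<Rightarrow> real) \<Rightarrow> (real \<Rightarrow> real) \<Rightarrow> real \<Rightarrow> real"
  where "transfer T \<phi> y = (\<Sum>x | x \<in> smooth_set T \<and> T x = y. \<phi> x / \<bar>deriv T x\<bar>)"


section \<open>Open products\<close>

text \<open>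
  A symbol is a pair \<open>(T, H)\<close>. Sequences are indexed from 0, so that \<open>\<sigma> k\<close> stands for
  \<open>\<sigma>\<^sub>k\<^sub>+\<^sub>1\<close> in the usual numbering \<open>\<sigma>\<^sub>1, \<sigma>\<^sub>2, \<dots>\<close>.
\<close>

type_synonym symb = "(real \<Rightarrow> real) \<times> real set"

definition symbol_seqs :: "(real \<Rightarrow> real) set \<Rightarrow> real set set \<Rightarrow> (nat \<Rightarrow> symb) set"
  where "symbol_seqs TT HH = (UNIV \<rightarrow> TT \<times> HH)"

definition holes :: "('a \<Rightarrow> 'w \<Rightarrow> real set) \<Rightarrow> 'w set \<Rightarrow> real set set"
  where "holes G W = {G \<alpha> w | \<alpha> w. w \<in> W}"

definition shift :: "(nat \<Rightarrow> symb) \<Rightarrow> nat \<Rightarrow> symb"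
  where "shift \<sigma> = (\<lambda>k. \<sigma> (Suc k))"

primrec T_iter :: "(nat \<Rightarrow> symb) \<Rightarrow> nat \<Rightarrow> real \<Rightarrow> real" where
  "T_iter \<sigma> 0 = (\<lambda>x. x)"
| "T_iter \<sigma> (Suc n) = fst (\<sigma> n) \<circ> T_iter \<sigma> n"

definition H_iter :: "(nat \<Rightarrow> symb) \<Rightarrow> nat \<Rightarrow> real set"
  where "H_iter \<sigma> n = {x \<in> {0..1}. \<forall>j<n. T_iter \<sigma> j x \<in> snd (\<sigma> j)}"

definition open_transfer :: "symb \<Rightarrow> (real \<Rightarrow> real) \<Rightarrow> real \<Rightarrow> real"
  where "open_transfer s \<phi> = transfer (fst s) (\<lambda>x. \<phi> x * indicator (snd s) x)"

primrec L_iter :: "(nat \<Rightarrow> symb) \<Rightarrow> nat \<Rightarrow> (real \<Rightarrow> real) \<Rightarrow> real \<Rightarrow> real" where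
  "L_iter \<sigma> 0 \<phi> = \<phi>"
| "L_iter \<sigma> (Suc n) \<phi> = open_transfer (\<sigma> n) (L_iter \<sigma> n \<phi>)"

definition weight :: "symb \<Rightarrow> real \<Rightarrow> real"
  where "weight s x = indicator (snd s) x / \<bar>deriv (fst s) x\<bar>"

definition g_iter :: "(nat \<Rightarrow> symb) \<Rightarrow> nat \<Rightarrow> real \<Rightarrow> real"
  where "g_iter \<sigma> n x = (\<Prod>k<n. weight (\<sigma> k) (T_iter \<sigma> k x))"

definition Theta :: "(real \<Rightarrow> real) set \<Rightarrow> real"
  where "Theta TT = inverse (INF T\<in>TT. ess_inf (\<lambda>x. \<bar>deriv T x\<bar>))"

definition Lambda :: "(nat \<Rightarrow> symb) \<Rightarrow> (real \<Rightarrow> real) \<Rightarrow> real"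
  where "Lambda \<sigma> \<phi> = lim (\<lambda>n. ess_inf (\<lambda>x. L_iter \<sigma> n \<phi> x / L_iter \<sigma> n (\<lambda>_. 1) x))"

definition rho_at :: "(nat \<Rightarrow> symb) \<Rightarrow> real"
  where "rho_at \<sigma> = Lambda (shift \<sigma>) (open_transfer (\<sigma> 0) (\<lambda>_. 1))"

definition rho :: "(real \<Rightarrow> real) set \<Rightarrow> real set set \<Rightarrow> real"
  where "rho TT HH = (INF \<sigma> \<in> symbol_seqs TT HH. rho_at \<sigma>)"

text \<open>
  Interval partitions are families of disjoint open intervals covering \<open>[0,1]\<close> up to finitely many
  points. The partition of \<open>T_iter \<sigma> n\<close> is the join of the preimages under \<open>T_iter \<sigma> j\<close>, for
  \<open>j < n\<close>, of the smoothness partitions of the factors.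
\<close>

definition smooth_partition :: "(nat \<Rightarrow> symb) \<Rightarrow> nat \<Rightarrow> real set set"
  where "smooth_partition \<sigma> n =
    components {x \<in> {0<..<1}. \<forall>j<n. T_iter \<sigma> j x \<in> smooth_set (fst (\<sigma> j))}"

text \<open>
  An open interval is disjoint from \<open>closure H\<close> or contained in \<open>H\<close> if and only if it does not meet
  \<open>frontier H\<close>. Cutting at the frontier points thus gives the coarsest partition into intervals
  that refines the smoothness partition and has this property.
\<close>

definition hat_partition :: "(nat \<Rightarrow> symb) \<Rightarrow> nat \<Rightarrow> real set set"
  where "hat_partition \<sigma> n =
    components (\<Union>(smooth_partition \<sigma> n) - frontier (H_iter \<sigma> n))"

definition Z_star :: "(nat \<Rightarrow> symb) \<Rightarrow> nat \<Rightarrow> real set set"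
  where "Z_star \<sigma> n = {Z \<in> hat_partition \<sigma> n. Z \<subseteq> H_iter \<sigma> n}"

definition Z_bad :: "(nat \<Rightarrow> symb) \<Rightarrow> nat \<Rightarrow> real set set"
  where "Z_bad \<sigma> n = {Z \<in> Z_star \<sigma> n. Lambda \<sigma> (indicator Z) = 0}"

definition Z_good :: "(nat \<Rightarrow> symb) \<Rightarrow> nat \<Rightarrow> real set set"
  where "Z_good \<sigma> n = {Z \<in> Z_star \<sigma> n. Lambda \<sigma> (indicator Z) > 0}"

text \<open>
  \<open>Z\<close> and \<open>Z'\<close> are contiguous, with \<open>Z\<close> on the left. \<open>H_iter \<sigma> n\<close> is a finite union of intervals;
  the closure of its interior is the same set up to endpoints, without isolated points.
\<close>

definition contiguous :: "(nat \<Rightarrow> symb) \<Rightarrow> nat \<Rightarrow> real set \<Rightarrow> real set \<Rightarrow> bool"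
  where "contiguous \<sigma> n Z Z' \<longleftrightarrow>
    Sup Z = Inf Z' \<or>
    (\<exists>D \<in> components ({0..1} - closure (interior (H_iter \<sigma> n))). Sup Z = Inf D \<and> Sup D = Inf Z')"


section \<open>The conditions on the open products\<close>

definition cond_C1 :: "(real \<Rightarrow> real) set \<Rightarrow> real set set \<Rightarrow> bool"
  where "cond_C1 TT HH \<longleftrightarrow>
    (\<exists>\<delta>>0. \<forall>s \<in> TT \<times> HH. ess_inf (open_transfer s (\<lambda>_. 1)) \<ge> \<delta>)"

definition cond_C2 :: "(real \<Rightarrow> real) set \<Rightarrow> real set set \<Rightarrow> real \<Rightarrow> real \<Rightarrow> bool"
  where "cond_C2 TT HH K \<xi> \<longleftrightarrow>
    K \<ge> 0 \<and> \<xi> \<ge> 1 \<and>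
    (\<forall>n. \<forall>\<sigma> \<in> symbol_seqs TT HH. \<forall>Zs.
       set Zs \<subseteq> Z_bad \<sigma> n \<and> successively (contiguous \<sigma> n) Zs \<longrightarrow> real (length Zs) \<le> K * \<xi> ^ n) \<and>
    \<xi> * Theta TT < min (rho TT HH) 1"

text \<open>The quantity \<open>\<epsilon>(N, N')\<close>; extended real, so that a minimum over nothing is \<open>\<infinity>\<close>.\<close>

definition eps_hat :: "(real \<Rightarrow> real) set \<Rightarrow> real set set \<Rightarrow> nat \<Rightarrow> nat \<Rightarrow> ereal"
  where "eps_hat TT HH N N' =
    (INF k \<in> {1..N}. INF \<sigma> \<in> symbol_seqs TT HH. INF Z \<in> Z_good \<sigma> k.
       ereal (ess_inf (\<lambda>x. L_iter \<sigma> N' (indicator Z) x / L_iter \<sigma> N' (\<lambda>_. 1) x)))"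

definition cond_C3 :: "(real \<Rightarrow> real) set \<Rightarrow> real set set \<Rightarrow> nat \<Rightarrow> nat \<Rightarrow> bool"
  where "cond_C3 TT HH N N' \<longleftrightarrow> eps_hat TT HH N N' > 0"

text \<open>
  \<open>eps_hat TT HH n m\<close> is nondecreasing in \<open>m\<close>, so the infimum below is attained when the set is
  nonempty.
\<close>

definition eps_star :: "(real \<Rightarrow> real) set \<Rightarrow> real set set \<Rightarrow> nat \<Rightarrow> ereal"
  where "eps_star TT HH n =
    (let E = {eps_hat TT HH n m | m. m \<ge> n \<and> eps_hat TT HH n m > 0}
     in if E = {} then 0 else Inf E)"

definition distortion_bound :: "(real \<Rightarrow> real) set \<Rightarrow> real set set \<Rightarrow> real \<Rightarrow> bool"
  where "distortion_bound TT HH C \<longleftrightarrow>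
    (\<forall>n. \<forall>\<sigma> \<in> symbol_seqs TT HH. \<forall>Z \<in> Z_star \<sigma> n.
       total_variation (g_iter \<sigma> n) Z \<le> ereal (C * ess_norm (g_iter \<sigma> n)))"

definition C_star :: "real \<Rightarrow> real \<Rightarrow> real"
  where "C_star C K = 3 * (C + 1) + 2 * K * (3 * C + 2)"

text \<open>In the extended reals, a positive number divided by 0 is \<open>\<infinity>\<close>.\<close>

definition C_n :: "(real \<Rightarrow> real) set \<Rightarrow> real set set \<Rightarrow> real \<Rightarrow> real \<Rightarrow> real \<Rightarrow> nat \<Rightarrow> ereal"
  where "C_n TT HH C K \<xi> n =
    ereal ((3 * C + 2) * (2 * K * \<xi> + 1) * Theta TT) / eps_star TT HH n"

definition n_zero :: "(real \<Rightarrow> real) set \<Rightarrow> real set set \<Rightarrow> real \<Rightarrow> real \<Rightarrow> real \<Rightarrow> nat"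
  where "n_zero TT HH C K \<xi> =
    nat \<lceil>ln (4 * (C_star C K)\<^sup>2) / ln (rho TT HH / (\<xi> * Theta TT))\<rceil>"

text \<open>
  If \<open>eps_star\<close> is positive at \<open>n\<^sub>0\<close>, it is positive at every \<open>i \<le> n\<^sub>0\<close>, so all \<open>C_n\<close> converted to
  real numbers below are finite.
\<close>

definition n_two :: "(real \<Rightarrow> real) set \<Rightarrow> real set set \<Rightarrow> real \<Rightarrow> real \<Rightarrow> real \<Rightarrow> nat"
  where "n_two TT HH C K \<xi> =
    (let \<theta> = \<xi> * Theta TT;
         r = rho TT HH;
         n\<^sub>0 = n_zero TT HH C K \<xi>;
         c = (\<lambda>i. real_of_ereal (C_n TT HH C K \<xi> i));
         a = max 1 (15 / 11 * Max ((\<lambda>i. c i / (C_star C K * \<theta> ^ i)) ` {1..n\<^sub>0}));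
         B = 1 + 2 * a * C_star C K
     in if eps_star TT HH n\<^sub>0 = 0 then n\<^sub>0
        else nat \<lceil>ln (4 * a * B * (1 + 2 * c n\<^sub>0 * inverse r ^ n\<^sub>0)) / ln (r / \<theta>)\<rceil>)"


section \<open>The walk\<close>

type_synonym ('a, 'd) env = "int ^ 'd \<Rightarrow> 'a"

abbreviation env_space :: "('a, 'd) env measure"
  where "env_space \<equiv> Pi\<^sub>M UNIV (\<lambda>_. count_space UNIV)"

abbreviation path_space :: "(nat \<Rightarrow> int ^ 'd) measure"
  where "path_space \<equiv> Pi\<^sub>M UNIV (\<lambda>_. count_space UNIV)"

definition translate :: "int ^ 'd \<Rightarrow> ('a, 'd) env \<Rightarrow> ('a, 'd) env"
  where "translate z \<omega> = (\<lambda>w. \<omega> (w + z))"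

definition jump :: "(int ^ 'd) set \<Rightarrow> ('a \<Rightarrow> int ^ 'd \<Rightarrow> real set) \<Rightarrow> 'a \<Rightarrow> real \<Rightarrow> int ^ 'd"
  where "jump W G \<alpha> x = (\<Sum>w\<in>W. if x \<in> G \<alpha> w then w else 0)"

definition walk_step :: "('a \<Rightarrow> real \<Rightarrow> real) \<Rightarrow> ('a \<Rightarrow> int ^ 'd \<Rightarrow> real set) \<Rightarrow> (int ^ 'd) set \<Rightarrow>
    ('a, 'd) env \<Rightarrow> real \<times> (int ^ 'd) \<Rightarrow> real \<times> (int ^ 'd)"
  where "walk_step f G W \<omega> = (\<lambda>(x, z).
    (f (\<omega> (z + jump W G (\<omega> z) x)) x, z + jump W G (\<omega> z) x))"

definition walk :: "('a \<Rightarrow> real \<Rightarrow> real) \<Rightarrow> ('a \<Rightarrow> int ^ 'd \<Rightarrow> real set) \<Rightarrow> (int ^ 'd) set \<Rightarrow>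
    ('a, 'd) env \<Rightarrow> real \<Rightarrow> nat \<Rightarrow> int ^ 'd"
  where "walk f G W \<omega> x n = snd ((walk_step f G W \<omega> ^^ n) (x, 0))"

definition position :: "(nat \<Rightarrow> int ^ 'd) \<Rightarrow> nat \<Rightarrow> int ^ 'd"
  where "position w k = (\<Sum>j<k. w j)"

definition walk_transfer :: "('a \<Rightarrow> real \<Rightarrow> real) \<Rightarrow> ('a \<Rightarrow> int ^ 'd \<Rightarrow> real set) \<Rightarrow>
    ('a, 'd) env \<Rightarrow> int ^ 'd \<Rightarrow> int ^ 'd \<Rightarrow> (real \<Rightarrow> real) \<Rightarrow> real \<Rightarrow> real"
  where "walk_transfer f G \<omega> z w \<phi> =
    transfer (f (\<omega> (z + w))) (\<lambda>x. indicator (G (\<omega> z) w) x * \<phi> x)"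

primrec word_transfer :: "('a \<Rightarrow> real \<Rightarrow> real) \<Rightarrow> ('a \<Rightarrow> int ^ 'd \<Rightarrow> real set) \<Rightarrow>
    ('a, 'd) env \<Rightarrow> (nat \<Rightarrow> int ^ 'd) \<Rightarrow> nat \<Rightarrow> (real \<Rightarrow> real) \<Rightarrow> real \<Rightarrow> real" where
  "word_transfer f G \<omega> w 0 \<phi> = \<phi>"
| "word_transfer f G \<omega> w (Suc n) \<phi> =
    walk_transfer f G \<omega> (position w n) (w n) (word_transfer f G \<omega> w n \<phi>)"

definition word_prob :: "('a \<Rightarrow> real \<Rightarrow> real) \<Rightarrow> ('a \<Rightarrow> int ^ 'd \<Rightarrow> real set) \<Rightarrow> (real \<Rightarrow> real) \<Rightarrow>
    ('a, 'd) env \<Rightarrow> nat \<Rightarrow> (nat \<Rightarrow> int ^ 'd) \<Rightarrow> real"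
  where "word_prob f G h \<omega> n w = (\<integral>x. word_transfer f G \<omega> w n h x \<partial>unit_leb)"

text \<open>The probability, in the environment \<open>\<omega>\<close>, of the jump \<open>w n\<close> after the jumps \<open>w 0, \<dots>, w (n - 1)\<close>.\<close>

definition next_prob :: "('a \<Rightarrow> real \<Rightarrow> real) \<Rightarrow> ('a \<Rightarrow> int ^ 'd \<Rightarrow> real set) \<Rightarrow> (real \<Rightarrow> real) \<Rightarrow>
    ('a, 'd) env \<Rightarrow> nat \<Rightarrow> (nat \<Rightarrow> int ^ 'd) \<Rightarrow> real"
  where "next_prob f G h \<omega> n w = word_prob f G h \<omega> (Suc n) w / word_prob f G h \<omega> n w"

text \<open>The joint law of the environment and the path, when the initial point has density \<open>h\<close>.\<close>

definition joint_law :: "('a \<Rightarrow> real \<Rightarrow> real) \<Rightarrow> ('a \<Rightarrow> int ^ 'd \<Rightarrow> real set) \<Rightarrow> (int ^ 'd) set \<Rightarrow>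
    (real \<Rightarrow> real) \<Rightarrow> ('a, 'd) env measure \<Rightarrow> (('a, 'd) env \<times> (nat \<Rightarrow> int ^ 'd)) measure"
  where "joint_law f G W h P =
    distr (P \<Otimes>\<^sub>M density unit_leb (\<lambda>x. ennreal (h x))) (P \<Otimes>\<^sub>M path_space)
      (\<lambda>(\<omega>, x). (\<omega>, walk f G W \<omega> x))"

text \<open>
  \<open>\<kappa>\<close> is a regular conditional law of the second component given the first under \<open>Q\<close>, where \<open>P\<close>
  is the law of the first component. It is determined by \<open>Q\<close> up to \<open>P\<close>-null sets.
\<close>

definition cond_law :: "('b \<times> (nat \<Rightarrow> int ^ 'd)) measure \<Rightarrow> 'b measure \<Rightarrow>
    ('b \<Rightarrow> (nat \<Rightarrow> int ^ 'd) measure) \<Rightarrow> bool"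
  where "cond_law Q P \<kappa> \<longleftrightarrow>
    \<kappa> \<in> P \<rightarrow>\<^sub>M prob_algebra path_space \<and>
    (\<forall>A \<in> sets P. \<forall>B \<in> sets path_space.
       emeasure Q (A \<times> B) = (\<integral>\<^sup>+\<omega>\<in>A. emeasure (\<kappa> \<omega>) B \<partial>P))"

definition admissible_path :: "(int ^ 'd) set \<Rightarrow> (nat \<Rightarrow> int ^ 'd) \<Rightarrow> bool"
  where "admissible_path W z \<longleftrightarrow> z 0 = 0 \<and> (\<forall>k. z (Suc k) - z k \<in> W)"


section \<open>Exponential loss of memory\<close>

definition cond_Exp :: "('a \<Rightarrow> real \<Rightarrow> real) \<Rightarrow> ('a \<Rightarrow> int ^ 'd \<Rightarrow> real set) \<Rightarrow> (int ^ 'd) set \<Rightarrow>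
    (real \<Rightarrow> real) \<Rightarrow> ('a, 'd) env measure \<Rightarrow> real \<Rightarrow> real \<Rightarrow> bool"
  where "cond_Exp f G W h P c \<nu> \<longleftrightarrow>
    (AE \<omega> in P. \<forall>n m. \<forall>w \<in> UNIV \<rightarrow> W. m < n \<longrightarrow>
       \<bar>next_prob f G h \<omega> n w
         - next_prob f G h (translate (position w m) \<omega>) (n - m) (\<lambda>k. w (m + k))\<bar> \<le> c * \<nu> ^ (n - m))"

end

theory Submission
  imports Defs
begin

text \<open>
  After \<open>n\<^sub>0\<close> steps the Lasota-Yorke inequality, with the bad intervals absorbed by the nearest good
  ones, maps the cone of nonnegative densities whose variation is at most \<open>b \<Lambda>\<^sub>\<sigma>\<close> strictly into
  itself. A function in the cone is at least half of \<open>\<Lambda>\<^sub>\<sigma>\<close> on some good interval of level \<open>n\<^sub>2\<close>, for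
  otherwise \<open>n\<^sub>2\<close> iterations would make \<open>\<Lambda>\<^sub>\<sigma>\<close> too small; hence (C3) bounds its image after \<open>n\<^sub>3\<close>
  steps from below by a multiple of the image of \<open>1\<close>. So two densities become proportional
  exponentially fast, and with them the probabilities of the next jump. The conditional
  probabilities of the path given its last positions are averages of those given its whole past.
\<close>

section \<open>Essential infima\<close>

text \<open>\<open>Lambda\<close> is a limit of essential infima: monotone and superadditive, but
  not known to be linear. Lower bounds on it are immediate. Upper bounds finer than the supremum
  come from one device, \<open>Lambda_leI\<close>: if the image of a function after n steps is at
  most q times the image of 1 plus t, then \<open>Lambda\<close> is at most q + t / \<rho>^n. This
  is where \<theta> < \<rho> enters, since the errors are of order \<theta>^n. In place of
  linearity, functions in the cone are bounded by (1 + b) times \<open>Lambda\<close>, which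
  explains the factors 1 + b and 2 + b below. The constants fit as follows. \<open>n_zero\<close>
  makes \<open>C_star\<close> (\<theta>/\<rho>)^n at most 1/12. Then \<open>b\<^sub>0\<close> is
  chosen so that the Lasota-Yorke remainder contributes (b - 1)/2 to the aperture, so aperture b
  becomes at most 7b/12. The same \<open>b\<^sub>0\<close> stands in the logarithm of
  \<open>n_two\<close>, so that intervals of that level resolve every function of the cone. All
  estimates are uniform over symbol sequences; a null set of environments arises only through the
  choice of the conditional law.\<close>

lemma AE_unit_leb_iff: "(AE x in unit_leb. P x) \<longleftrightarrow> negligible {x\<in>{0..1}. \<not> P x}"
proof -
  have "(AE x in unit_leb. P x) \<longleftrightarrow> (AE x in lebesgue. x \<in> {0..1} \<longrightarrow> P x)"
    by (subst AE_restrict_space_iff) auto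
  also have "\<dots> \<longleftrightarrow> negligible {x\<in>{0..1}. \<not> P x}"
  proof
    assume "AE x in lebesgue. x \<in> {0..1} \<longrightarrow> P x"
    then obtain N where N: "N \<in> null_sets lebesgue" "{x \<in> space lebesgue. \<not> (x \<in> {0..1} \<longrightarrow> P x)} \<subseteq> N"
      unfolding eventually_ae_filter by auto
    then have "negligible N" by (simp add: negligible_iff_null_sets)
    then show "negligible {x\<in>{0..1}. \<not> P x}"
      by (rule negligible_subset) (use N(2) in auto)
  next
    assume "negligible {x\<in>{0..1}. \<not> P x}"
    then have "{x\<in>{0..1}. \<not> P x} \<in> null_sets lebesgue" by (simp add: negligible_iff_null_sets)
    then show "AE x in lebesgue. x \<in> {0..1} \<longrightarrow> P x"
      by (rule AE_I') auto
  qed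
  finally show ?thesis .
qed

lemma AE_unit_leb_finiteI:
  assumes "finite F" "\<And>x. x \<in> {0..1} \<Longrightarrow> x \<notin> F \<Longrightarrow> P x"
  shows "AE x in unit_leb. P x"
  unfolding AE_unit_leb_iff by (rule negligible_subset[of F]) (use assms in auto)

lemma emeasure_unit_leb: "emeasure unit_leb (space unit_leb) = 1"
  by (simp add: emeasure_restrict_space space_restrict_space)

interpretation unit_leb: prob_space unit_leb
  by standard (rule emeasure_unit_leb)

text \<open>\<open>ess_inf\<close> is converted from the extended reals, where an infinite value
  becomes 0. The bound \<open>b\<close> excludes minus infinity and the total mass 1 excludes plus
  infinity.\<close>

lemma le_ess_inf_iff:
  assumes m: "\<phi> \<in> borel_measurable unit_leb" and lb: "AE x in unit_leb. b \<le> \<phi> x"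
  shows "c \<le> ess_inf \<phi> \<longleftrightarrow> (AE x in unit_leb. c \<le> \<phi> x)"
proof -
  let ?s = "esssup unit_leb (\<lambda>x. - ereal (\<phi> x))"
  have m': "(\<lambda>x. - ereal (\<phi> x)) \<in> borel_measurable unit_leb" using m by simp
  have le: "?s \<le> - ereal c" if "AE x in unit_leb. c \<le> \<phi> x" for c
    by (rule esssup_I[OF m']) (use that in auto)
  have ae: "AE x in unit_leb. - ereal (\<phi> x) \<le> ?s" by (rule esssup_AE)
  have "?s \<noteq> - \<infinity>"
  proof
    assume "?s = - \<infinity>"
    then have "AE x in unit_leb. False" using ae by simp
    then show False using emeasure_unit_leb by (simp add: unit_leb.AE_False)
  qed
  moreover have "?s \<noteq> \<infinity>" using le[OF lb] by auto
  ultimately obtain r where r: "?s = ereal r" by (cases ?s) auto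
  have e: "ess_inf \<phi> = - r" using r by (simp add: ess_inf_def del: uminus_ereal.simps)
  show ?thesis
  proof
    assume "c \<le> ess_inf \<phi>"
    then have "c \<le> - r" using e by simp
    show "AE x in unit_leb. c \<le> \<phi> x"
      using ae unfolding r by (rule eventually_mono) (use \<open>c \<le> - r\<close> in auto)
  next
    assume "AE x in unit_leb. c \<le> \<phi> x"
    from le[OF this] show "c \<le> ess_inf \<phi>" using e r by auto
  qed
qed

text \<open>For a function that is not measurable \<open>esssup\<close> is the top element, which
  the conversion turns into 0. A positive \<open>ess_inf\<close> therefore certifies measurability,
  in particular for the initial density.\<close>

lemma ess_inf_pos_imp:
  assumes "ess_inf \<phi> > 0"
  shows "\<phi> \<in> borel_measurable unit_leb" "AE x in unit_leb. ess_inf \<phi> \<le> \<phi> x"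
proof -
  let ?s = "esssup unit_leb (\<lambda>x. - ereal (\<phi> x))"
  have nt: "?s \<noteq> \<infinity>" using assms by (auto simp: ess_inf_def)
  then have m: "(\<lambda>x. - ereal (\<phi> x)) \<in> borel_measurable unit_leb"
    using esssup_non_measurable[of "\<lambda>x. - ereal (\<phi> x)" unit_leb] by (auto simp: top_ereal_def)
  have "(\<lambda>x. - real_of_ereal (- ereal (\<phi> x))) \<in> borel_measurable unit_leb"
    using m by measurable
  then show *: "\<phi> \<in> borel_measurable unit_leb" by simp
  have "AE x in unit_leb. - ereal (\<phi> x) \<le> ?s" by (rule esssup_AE)
  moreover obtain r where r: "?s = ereal r" 
    using nt assms by (cases ?s) (auto simp: ess_inf_def)
  moreover have "ess_inf \<phi> = - r" using r by (simp add: ess_inf_def del: uminus_ereal.simps)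
  ultimately show "AE x in unit_leb. ess_inf \<phi> \<le> \<phi> x" by (auto elim!: eventually_mono)
qed

lemma ess_norm_le:
  assumes "AE x in unit_leb. \<bar>\<phi> x\<bar> \<le> c" "0 \<le> c"
  shows "ess_norm \<phi> \<le> c"
proof (cases "(\<lambda>x. ereal \<bar>\<phi> x\<bar>) \<in> borel_measurable unit_leb")
  case True
  have "esssup unit_leb (\<lambda>x. ereal \<bar>\<phi> x\<bar>) \<le> ereal c"
    by (rule esssup_I[OF True]) (use assms in auto)
  then show ?thesis unfolding ess_norm_def using assms(2)
    by (cases "esssup unit_leb (\<lambda>x. ereal \<bar>\<phi> x\<bar>)") auto
next
  \<comment> \<open>Here the default value makes the norm 0. Thus measurability of
    \<open>g_iter\<close> never has to be proved.\<close>
  case False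
  then show ?thesis using assms(2) by (simp add: ess_norm_def esssup_non_measurable top_ereal_def)
qed

text \<open>A class preserved by the transfer operators that makes no reference to variation;
  \<open>Lambda\<close> can thus be applied to indicators and to differences before they are known
  to lie in a cone.\<close>

definition ess_bounded :: "(real \<Rightarrow> real) \<Rightarrow> bool"
  where "ess_bounded \<phi> \<longleftrightarrow> \<phi> \<in> borel_measurable unit_leb \<and> (\<exists>B. AE x in unit_leb. \<bar>\<phi> x\<bar> \<le> B)"

lemma ess_bounded_integrable: "ess_bounded \<phi> \<Longrightarrow> integrable unit_leb \<phi>"
  unfolding ess_bounded_def using unit_leb.integrable_const_bound[of \<phi>] by auto

lemma ess_boundedI: "\<phi> \<in> borel_measurable unit_leb \<Longrightarrow> AE x in unit_leb. \<bar>\<phi> x\<bar> \<le> B \<Longrightarrow> ess_bounded \<phi>"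
  by (auto simp: ess_bounded_def)

lemma ess_bounded_const: "ess_bounded (\<lambda>_. c)"
  by (auto simp: ess_bounded_def)

lemma ess_bounded_add:
  assumes "ess_bounded \<phi>" "ess_bounded \<psi>"
  shows "ess_bounded (\<lambda>x. \<phi> x + \<psi> x)"
proof -
  obtain A B where "AE x in unit_leb. \<bar>\<phi> x\<bar> \<le> A" "AE x in unit_leb. \<bar>\<psi> x\<bar> \<le> B"
    using assms unfolding ess_bounded_def by auto
  then have "AE x in unit_leb. \<bar>\<phi> x + \<psi> x\<bar> \<le> A + B" by eventually_elim auto
  then show ?thesis using assms by (intro ess_boundedI) (auto simp: ess_bounded_def)
qed

lemma ess_bounded_mult:
  assumes "ess_bounded \<phi>" "ess_bounded \<psi>"
  shows "ess_bounded (\<lambda>x. \<phi> x * \<psi> x)"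
proof -
  obtain A B where "AE x in unit_leb. \<bar>\<phi> x\<bar> \<le> A" "AE x in unit_leb. \<bar>\<psi> x\<bar> \<le> B"
    using assms unfolding ess_bounded_def by auto
  then have "AE x in unit_leb. \<bar>\<phi> x * \<psi> x\<bar> \<le> A * B"
    by eventually_elim (auto simp: abs_mult intro!: mult_mono)
  then show ?thesis using assms by (intro ess_boundedI) (auto simp: ess_bounded_def)
qed

lemma ess_bounded_cmult: "ess_bounded \<phi> \<Longrightarrow> ess_bounded (\<lambda>x. c * \<phi> x)"
  using ess_bounded_mult[OF ess_bounded_const] .

lemma ess_bounded_diff: "ess_bounded \<phi> \<Longrightarrow> ess_bounded \<psi> \<Longrightarrow> ess_bounded (\<lambda>x. \<phi> x - \<psi> x)"
  using ess_bounded_add[of \<phi> "\<lambda>x. (-1) * \<psi> x"] ess_bounded_cmult[of \<psi> "-1"] by simp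

lemma ess_bounded_sum: "(\<And>i. i \<in> I \<Longrightarrow> ess_bounded (\<phi> i)) \<Longrightarrow> ess_bounded (\<lambda>x. \<Sum>i\<in>I. \<phi> i x)"
  by (induction I rule: infinite_finite_induct) (auto intro: ess_bounded_const ess_bounded_add)

lemma ess_bounded_indicator:
  assumes "S \<in> sets lebesgue"
  shows "ess_bounded (indicator S :: real \<Rightarrow> real)"
proof (rule ess_boundedI[where B = 1])
  have "(indicator S :: real \<Rightarrow> real) \<in> borel_measurable lebesgue" using assms by simp
  then show "(indicator S :: real \<Rightarrow> real) \<in> borel_measurable unit_leb"
    by (rule measurable_restrict_space1)
qed (auto simp: indicator_def)

section \<open>Transfer operators\<close>

text \<open>By maximality an endpoint of a component is 0, 1 or a removed point: otherwise adding it
  would give a larger connected set. The endpoints determine the component, whence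
  finiteness.\<close>

lemma finite_components_interval_diff:
  assumes "finite F"
  shows "finite (components ({0<..<1} - F :: real set))"
    and "\<And>J. J \<in> components ({0<..<1} - F) \<Longrightarrow>
      \<exists>a b. a \<in> insert 0 F \<and> b \<in> insert 1 F \<and> a < b \<and> J = {a<..<b}"
proof -
  let ?U = "{0<..<1} - F :: real set"
  have oU: "open ?U" using assms by (intro open_Diff) (auto simp: finite_imp_closed)
  have J: "J = {Inf J<..<Sup J} \<and> Inf J \<in> insert 0 F \<and> Sup J \<in> insert 1 F \<and> Inf J < Sup J"
    if "J \<in> components ?U" for J
  proof -
    have ne: "J \<noteq> {}" and sub: "J \<subseteq> ?U" and con: "connected J" and op: "open J"
      using that oU by (auto simp: in_components_nonempty in_components_subset in_components_connected open_components)
    have bdd: "bdd_above J" "bdd_below J" using sub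
      by (force intro: bdd_aboveI[of _ 1] bdd_belowI[of _ 0])+
    have lo: "Inf J < x" and hi: "x < Sup J" if "x \<in> J" for x
    proof -
      obtain e where e: "e > 0" "ball x e \<subseteq> J" using op \<open>x \<in> J\<close> by (auto simp: open_contains_ball)
      have "x - e/2 \<in> J" "x + e/2 \<in> J" using e by (auto simp: subset_iff dist_real_def)
      then have "Inf J \<le> x - e/2" "x + e/2 \<le> Sup J" using bdd by (auto intro: cInf_lower cSup_upper)
      then show "Inf J < x" "x < Sup J" using e by auto
    qed
    have Jeq: "J = {Inf J<..<Sup J}"
    proof
      show "{Inf J<..<Sup J} \<subseteq> J"
      proof
        fix x assume "x \<in> {Inf J<..<Sup J}"
        then obtain y z where "y \<in> J" "y < x" "z \<in> J" "x < z"
          using cInf_less_iff[OF ne bdd(2), of x] less_cSup_iff[OF ne bdd(1), of x] by auto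
        then show "x \<in> J" using con connected_contains_Icc[of J y z] by auto
      qed
    qed (use lo hi in auto)
    obtain x where "x \<in> J" using ne by auto
    then have lt: "Inf J < Sup J" using lo hi by force
    have bnd: "0 \<le> Inf J" "Sup J \<le> 1" using sub ne by (auto intro!: cInf_greatest cSup_least)
    have max: "K \<subseteq> J" if "connected K" "K \<subseteq> ?U" "J \<inter> K \<noteq> {}" for K
      using that \<open>J \<in> components ?U\<close> by (meson components_maximal)
    have "Sup J \<in> insert 1 F"
    proof (rule ccontr)
      assume *: "Sup J \<notin> insert 1 F"
      have "connected {Inf J<..Sup J}" by simp
      moreover have "{Inf J<..Sup J} \<subseteq> insert (Sup J) J" using Jeq by force
      then have "{Inf J<..Sup J} \<subseteq> ?U" using sub * bnd lt by force
      moreover have "J \<inter> {Inf J<..Sup J} \<noteq> {}" using Jeq ne by force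
      ultimately have "{Inf J<..Sup J} \<subseteq> J" by (rule max)
      then show False using lt hi[of "Sup J"] by auto
    qed
    moreover have "Inf J \<in> insert 0 F"
    proof (rule ccontr)
      assume *: "Inf J \<notin> insert 0 F"
      have "connected {Inf J..<Sup J}" by simp
      moreover have "{Inf J..<Sup J} \<subseteq> insert (Inf J) J" using Jeq by force
      then have "{Inf J..<Sup J} \<subseteq> ?U" using sub * bnd lt by force
      moreover have "J \<inter> {Inf J..<Sup J} \<noteq> {}" using Jeq ne by force
      ultimately have "{Inf J..<Sup J} \<subseteq> J" by (rule max)
      then show False using lt lo[of "Inf J"] by auto
    qed
    ultimately show ?thesis using Jeq lt by blast
  qed
  show "\<exists>a b. a \<in> insert 0 F \<and> b \<in> insert 1 F \<and> a < b \<and> J = {a<..<b}"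
    if "J \<in> components ?U" for J using J[OF that] by blast
  have "(\<lambda>J. (Inf J, Sup J)) ` components ?U \<subseteq> insert 0 F \<times> insert 1 F"
    using J by auto
  moreover have "inj_on (\<lambda>J. (Inf J, Sup J)) (components ?U)"
    by (rule inj_onI) (metis J prod.inject)
  ultimately show "finite (components ?U)"
    using assms by (meson finite.insertI finite_SigmaI finite_imageD finite_subset)
qed

section \<open>A single expanding map and its transfer operator\<close>

locale expanding_map =
  fixes T :: "real \<Rightarrow> real" and lam :: real
  assumes maps: "T \<in> {0..1} \<rightarrow> {0..1}"
    and piecewise_C2: "piecewise_C2 T"
    and lam: "lam > 1"
    and expanding: "x \<in> smooth_set T \<Longrightarrow> \<bar>deriv T x\<bar> \<ge> lam"
begin

lemma smooth_subset: "smooth_set T \<subseteq> {0<..<1}"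
  by (auto simp: smooth_set_def)

lemma finite_nonsmooth: "finite ({0..1} - smooth_set T)"
proof -
  have "{0..1} - smooth_set T \<subseteq> insert 0 (insert 1 ({0<..<1} - smooth_set T))"
    by auto
  then show ?thesis using piecewise_C2 by (meson finite.insertI finite_subset piecewise_C2_def)
qed

lemma smooth_eq: "smooth_set T = {0<..<1} - ({0<..<1} - smooth_set T)"
  using smooth_subset by auto

lemma open_smooth: "open (smooth_set T)"
  by (subst smooth_eq, intro open_Diff finite_imp_closed)
     (use piecewise_C2 in \<open>auto simp: piecewise_C2_def\<close>)

lemma smooth_deriv:
  assumes "x \<in> smooth_set T"
  shows "(T has_real_derivative deriv T x) (at x)" "isCont (deriv T) x"
proof -
  obtain e where e: "e > 0" "C2_on T (ball x e)" using assms by (auto simp: smooth_set_def)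
  then obtain g' g'' where
    d1: "\<And>y. y \<in> ball x e \<Longrightarrow> (T has_real_derivative g' y) (at y within ball x e)" and
    d2: "\<And>y. y \<in> ball x e \<Longrightarrow> (g' has_real_derivative g'' y) (at y within ball x e)"
    unfolding C2_on_def by blast
  have at: "at y within ball x e = at y" if "y \<in> ball x e" for y
    using that by (intro at_within_open) auto
  have d: "deriv T y = g' y" "(T has_real_derivative g' y) (at y)" if "y \<in> ball x e" for y
    using d1[OF that] at[OF that] by (auto intro: DERIV_imp_deriv)
  have x: "x \<in> ball x e" using e by simp
  show "(T has_real_derivative deriv T x) (at x)" using d[OF x] by simp
  have "isCont g' x" using d2[OF x] at[OF x] by (auto intro: DERIV_isCont)
  moreover have "eventually (\<lambda>y. y \<in> ball x e) (nhds x)"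
    using x by (intro eventually_nhds_in_open) auto
  then have "eventually (\<lambda>y. deriv T y = g' y) (nhds x)"
    by (rule eventually_mono) (use d in auto)
  ultimately show "isCont (deriv T) x" by (simp add: isCont_cong)
qed

abbreviation "branches \<equiv> components (smooth_set T)"

lemma in_smooth_iff: "x \<in> smooth_set T \<longleftrightarrow> (\<exists>J\<in>branches. x \<in> J)"
  using Union_components[of "smooth_set T"] by blast

lemma finite_branches: "finite branches"
  using finite_components_interval_diff(1)[of "{0<..<1} - smooth_set T"] piecewise_C2
  by (subst smooth_eq) (auto simp: piecewise_C2_def)

lemma branch_interval: "J \<in> branches \<Longrightarrow> \<exists>a b. a < b \<and> J = {a<..<b}"
  using finite_components_interval_diff(2)[of "{0<..<1} - smooth_set T" J] piecewise_C2 smooth_eq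
  by (auto simp: piecewise_C2_def)

text \<open>By Rolle, two points with the same image would enclose a zero of the derivative,
  contrary to expansion.\<close>

lemma inj_on_smooth_interval:
  assumes "is_interval J" "J \<subseteq> smooth_set T"
  shows "inj_on T J"
proof (rule inj_onI, rule ccontr)
  fix x y assume xy: "x \<in> J" "y \<in> J" "T x = T y" "x \<noteq> y"
  have *: False if "u \<in> J" "v \<in> J" "T u = T v" "u < v" for u v
  proof -
    have uv: "{u..v} \<subseteq> smooth_set T"
      using that assms by (meson interval_subset_is_interval atLeastAtMost_iff mem_is_interval_1_I subset_iff)
    have "\<exists>z. u < z \<and> z < v \<and> (\<lambda>h. deriv T z * h) = (\<lambda>v. 0)"
    proof (rule Rolle_deriv[OF \<open>u < v\<close> \<open>T u = T v\<close>])
      show "continuous_on {u..v} T"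
        using uv smooth_deriv(1) by (meson DERIV_isCont continuous_at_imp_continuous_on subset_iff)
      show "(T has_derivative (\<lambda>h. deriv T x * h)) (at x)" if "u < x" "x < v" for x
        using smooth_deriv(1)[of x] uv that by (auto simp: has_field_derivative_def subset_iff)
    qed
    then obtain z where z: "u < z" "z < v" "(\<lambda>h. deriv T z * h) = (\<lambda>v. 0)" by blast
    have "deriv T z = 0" using fun_cong[OF z(3), of 1] by simp
    moreover have "z \<in> smooth_set T" using uv z by auto
    ultimately show False using expanding[of z] lam by simp
  qed
  show False using *[of x y] *[of y x] xy by (cases x y rule: linorder_cases) auto
qed

lemma inj_on_branch: "J \<in> branches \<Longrightarrow> inj_on T J"
  by (intro inj_on_smooth_interval) (auto dest: branch_interval in_components_subset)

lemma finite_fibre: "finite {x \<in> smooth_set T. T x = y}"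
proof -
  have "{x \<in> smooth_set T. T x = y} = (\<Union>J\<in>branches. {x \<in> J. T x = y})"
    by (auto simp: in_smooth_iff)
  moreover have "finite {x \<in> J. T x = y}" if "J \<in> branches" for J
    using finite_vimage_IntI[of "{y}" T J] inj_on_branch[OF that]
    by (simp add: vimage_def Int_def conj_commute)
  ultimately show ?thesis using finite_branches by auto
qed

text \<open>The share of one monotone branch in \<open>transfer\<close>. The sum over preimages
  becomes a sum over a finite set that does not depend on the point.\<close>

definition branch :: "real set \<Rightarrow> (real \<Rightarrow> real) \<Rightarrow> real \<Rightarrow> real"
  where "branch J \<phi> y = (if y \<in> T ` J then \<phi> (the_inv_into J T y) / \<bar>deriv T (the_inv_into J T y)\<bar> else 0)"

lemma transfer_eq_branches: "transfer T \<phi> y = (\<Sum>J\<in>branches. branch J \<phi> y)"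
proof -
  have eq: "{x \<in> smooth_set T. T x = y} = (\<Union>J\<in>branches. {x \<in> J. T x = y})"
    by (auto simp: in_smooth_iff)
  have "transfer T \<phi> y = (\<Sum>J\<in>branches. \<Sum>x | x \<in> J \<and> T x = y. \<phi> x / \<bar>deriv T x\<bar>)"
    unfolding transfer_def eq
  proof (rule sum.UNION_disjoint[OF finite_branches])
    show "\<forall>J\<in>branches. finite {x \<in> J. T x = y}"
      by (intro ballI finite_subset[OF _ finite_fibre[of y]]) (auto simp: in_smooth_iff)
    show "\<forall>i\<in>branches. \<forall>j\<in>branches. i \<noteq> j \<longrightarrow> {x \<in> i. T x = y} \<inter> {x \<in> j. T x = y} = {}"
      using components_nonoverlap by blast
  qed
  also have "\<dots> = (\<Sum>J\<in>branches. branch J \<phi> y)"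
  proof (rule sum.cong[OF refl])
    fix J assume J: "J \<in> branches"
    show "(\<Sum>x | x \<in> J \<and> T x = y. \<phi> x / \<bar>deriv T x\<bar>) = branch J \<phi> y"
    proof (cases "y \<in> T ` J")
      case True
      then obtain x where x: "x \<in> J" "y = T x" by blast
      have inv: "the_inv_into J T (T x) = x" using inj_on_branch[OF J] x(1) by (rule the_inv_into_f_f)
      have "{z. z \<in> J \<and> T z = y} = {x}" using x inj_on_branch[OF J] by (auto dest: inj_onD)
      then have "(\<Sum>x | x \<in> J \<and> T x = y. \<phi> x / \<bar>deriv T x\<bar>) = \<phi> x / \<bar>deriv T x\<bar>"
        by (simp only: sum.insert sum.empty) simp
      then show ?thesis using True unfolding x(2) branch_def inv by simp
    next
      case False
      then have "{x. x \<in> J \<and> T x = y} = {}" by auto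
      then show ?thesis using False unfolding branch_def by (simp only: sum.empty if_False)
    qed
  qed
  finally show ?thesis .
qed

text \<open>\<open>transfer\<close> is a pointwise sum over preimages, so respecting null sets is
  not automatic. It does so because T is differentiable on the smooth set and hence maps null sets
  to null sets.\<close>

lemma AE_transfer_mono:
  assumes "AE x in unit_leb. \<phi> x \<le> \<psi> x"
  shows "AE y in unit_leb. transfer T \<phi> y \<le> transfer T \<psi> y"
proof -
  let ?N = "{x\<in>{0..1}. \<not> \<phi> x \<le> \<psi> x}"
  have "negligible (?N \<inter> smooth_set T)"
    using assms unfolding AE_unit_leb_iff by (rule negligible_subset) auto
  then have "negligible (T ` (?N \<inter> smooth_set T))"
  proof (rule negligible_differentiable_image_negligible[rotated])
    show "T differentiable_on ?N \<inter> smooth_set T"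
      unfolding differentiable_on_def
      by (metis IntD2 differentiable_at_withinI real_differentiable_def smooth_deriv(1))
  qed simp
  moreover have "{y\<in>{0..1}. \<not> transfer T \<phi> y \<le> transfer T \<psi> y} \<subseteq> T ` (?N \<inter> smooth_set T)"
  proof
    fix y assume y: "y \<in> {y\<in>{0..1}. \<not> transfer T \<phi> y \<le> transfer T \<psi> y}"
    show "y \<in> T ` (?N \<inter> smooth_set T)"
    proof (rule ccontr)
      assume n: "y \<notin> T ` (?N \<inter> smooth_set T)"
      have "transfer T \<phi> y \<le> transfer T \<psi> y"
        unfolding transfer_def
      proof (rule sum_mono)
        fix x assume x: "x \<in> {x \<in> smooth_set T. T x = y}"
        then have "x \<in> {0..1}" using smooth_subset by auto
        then have "\<phi> x \<le> \<psi> x" using n x by blast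
        then show "\<phi> x / \<bar>deriv T x\<bar> \<le> \<psi> x / \<bar>deriv T x\<bar>" by (simp add: divide_right_mono)
      qed
      then show False using y by simp
    qed
  qed
  ultimately show ?thesis unfolding AE_unit_leb_iff by (rule negligible_subset)
qed

lemma image_branch_subset: "J \<in> branches \<Longrightarrow> T ` J \<subseteq> {0..1}"
  using maps smooth_subset in_components_subset[of J "smooth_set T"] by (auto simp: Pi_iff)

lemma branch_measurable_sets: "J \<in> branches \<Longrightarrow> J \<in> sets lebesgue" "J \<in> branches \<Longrightarrow> T ` J \<in> sets lebesgue"
proof -
  assume J: "J \<in> branches"
  then show m: "J \<in> sets lebesgue" using branch_interval by force
  show "T ` J \<in> sets lebesgue"
  proof (rule differentiable_image_in_sets_lebesgue[OF m])
    show "T differentiable_on J"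
      unfolding differentiable_on_def
      by (metis J differentiable_at_withinI in_components_subset real_differentiable_def smooth_deriv(1) subset_iff)
  qed simp
qed

text \<open>Change of variables on one branch, where T is injective; the Jacobian cancels the
  denominator in \<open>branch\<close>.\<close>

lemma branch_integral:
  assumes J: "J \<in> branches" and \<phi>: "\<phi> absolutely_integrable_on J"
  shows "branch J \<phi> absolutely_integrable_on {0..1} \<and> integral {0..1} (branch J \<phi>) = integral J \<phi>"
proof -
  have sub: "J \<subseteq> smooth_set T" using J by (rule in_components_subset)
  have eq: "\<bar>deriv T x\<bar> * branch J \<phi> (T x) = \<phi> x" if "x \<in> J" for x
  proof -
    have "deriv T x \<noteq> 0" using expanding[of x] lam that sub by auto
    then show ?thesis using that inj_on_branch[OF J] by (simp add: branch_def the_inv_into_f_f)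
  qed
  have "(\<lambda>x. \<bar>deriv T x\<bar> * branch J \<phi> (T x)) absolutely_integrable_on J \<and>
      integral J (\<lambda>x. \<bar>deriv T x\<bar> * branch J \<phi> (T x)) = integral J \<phi> \<longleftrightarrow>
      branch J \<phi> absolutely_integrable_on T ` J \<and> integral (T ` J) (branch J \<phi>) = integral J \<phi>"
  proof (rule has_absolute_integral_change_of_variables_1')
    show "J \<in> sets lebesgue" using J by (rule branch_measurable_sets)
    show "(T has_real_derivative deriv T x) (at x within J)" if "x \<in> J" for x
      using smooth_deriv(1) sub that by (blast intro: DERIV_subset)
    show "inj_on T J" using J by (rule inj_on_branch)
  qed
  moreover have "(\<lambda>x. \<bar>deriv T x\<bar> * branch J \<phi> (T x)) absolutely_integrable_on J"
    using \<phi> by (subst set_integrable_cong[OF refl refl eq]) auto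
  moreover have "integral J (\<lambda>x. \<bar>deriv T x\<bar> * branch J \<phi> (T x)) = integral J \<phi>"
    by (rule Henstock_Kurzweil_Integration.integral_cong) (use eq in auto)
  ultimately have *: "branch J \<phi> absolutely_integrable_on T ` J" "integral (T ` J) (branch J \<phi>) = integral J \<phi>"
    by auto
  have z: "branch J \<phi> y = 0" if "y \<notin> T ` J" for y using that by (simp add: branch_def)
  have "branch J \<phi> absolutely_integrable_on {0..1}"
    using *(1)
  proof (rule absolutely_integrable_spike_set)
  qed (rule negligible_subset[OF negligible_empty], use z image_branch_subset[OF J] in force)+
  moreover have "integral {0..1} (branch J \<phi>) = integral (T ` J) (branch J \<phi>)"
    by (rule integral_spike_set)
       ((rule negligible_subset[OF negligible_empty], use z image_branch_subset[OF J] in force)+)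
  ultimately show ?thesis using * by simp
qed

lemma AE_smooth: "AE x in unit_leb. x \<in> smooth_set T"
  using finite_nonsmooth by (rule AE_unit_leb_finiteI) auto

text \<open>Duality of the transfer operator with the constant 1, summed over the branches, which
  cover the unit interval up to a finite set.\<close>

lemma integrable_transfer:
  assumes "integrable unit_leb \<phi>"
  shows "integrable unit_leb (transfer T \<phi>)" "(\<integral>x. transfer T \<phi> x \<partial>unit_leb) = (\<integral>x. \<phi> x \<partial>unit_leb)"
proof -
  have conv: "integrable unit_leb \<psi> \<longleftrightarrow> \<psi> absolutely_integrable_on {0..1}" for \<psi> :: "real \<Rightarrow> real"
    unfolding set_integrable_def by (subst integrable_restrict_space) auto
  have ai: "\<phi> absolutely_integrable_on {0..1}" using assms conv by simp
  have J: "\<phi> absolutely_integrable_on J" if "J \<in> branches" for J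
    using set_integrable_subset[OF ai] branch_measurable_sets(1)[OF that] in_components_subset[OF that] smooth_subset
    by (metis greaterThanLessThan_subseteq_atLeastAtMost_iff order.refl order_trans)
  have eq: "transfer T \<phi> = (\<lambda>y. \<Sum>J\<in>branches. branch J \<phi> y)"
    by (auto simp: transfer_eq_branches)
  have ait: "transfer T \<phi> absolutely_integrable_on {0..1}"
    unfolding eq by (rule absolutely_integrable_sum) (use finite_branches branch_integral J in auto)
  then show it: "integrable unit_leb (transfer T \<phi>)" by (simp add: conv)
  have "integral {0..1} (transfer T \<phi>) = (\<Sum>J\<in>branches. integral {0..1} (branch J \<phi>))"
    unfolding eq
    by (rule integral_sum) (use finite_branches branch_integral J in \<open>auto intro: set_lebesgue_integral_eq_integral(1)\<close>)
  also have "\<dots> = (\<Sum>J\<in>branches. integral J \<phi>)" using branch_integral J by simp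
  also have "\<dots> = integral (smooth_set T) \<phi>"
  proof -
    have "(\<phi> has_integral (\<Sum>J\<in>branches. integral J \<phi>)) (\<Union>branches)"
    proof (rule has_integral_Union[OF finite_branches])
      show "(\<phi> has_integral integral J \<phi>) J" if "J \<in> branches" for J
        using J[OF that] by (simp add: integrable_integral set_lebesgue_integral_eq_integral(1))
      show "pairwise (\<lambda>S S'. negligible (S \<inter> S')) branches"
        unfolding pairwise_def using components_nonoverlap negligible_empty by metis
    qed
    then show ?thesis by (simp add: integral_unique)
  qed
  also have "\<dots> = integral {0..1} \<phi>"
    by (rule integral_spike_set;
        rule negligible_subset[OF negligible_finite[OF finite_nonsmooth]]) (use smooth_subset in force)+
  finally show "(\<integral>x. transfer T \<phi> x \<partial>unit_leb) = (\<integral>x. \<phi> x \<partial>unit_leb)"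
    using lebesgue_integral_eq_integral[OF it] lebesgue_integral_eq_integral[OF assms] by simp
qed

lemma transfer_bound:
  assumes "\<And>x. x \<in> smooth_set T \<Longrightarrow> \<bar>\<phi> x\<bar> \<le> B" "0 \<le> B"
  shows "\<bar>transfer T \<phi> y\<bar> \<le> real (card branches) * B"
proof -
  have "\<bar>branch J \<phi> y\<bar> \<le> B" if J: "J \<in> branches" for J
  proof (cases "y \<in> T ` J")
    case True
    then have x: "the_inv_into J T y \<in> J" using inj_on_branch[OF J] by (metis order_refl the_inv_into_into)
    then have s: "the_inv_into J T y \<in> smooth_set T" using in_components_subset[OF J] by auto
    have "\<bar>\<phi> (the_inv_into J T y)\<bar> / \<bar>deriv T (the_inv_into J T y)\<bar> \<le> B / 1"
      using assms(1)[OF s] expanding[OF s] lam assms(2) by (intro frac_le) auto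
    then show ?thesis using True by (simp add: branch_def abs_divide)
  qed (simp add: branch_def assms(2))
  then have "\<bar>\<Sum>J\<in>branches. branch J \<phi> y\<bar> \<le> (\<Sum>J\<in>branches. B)"
    by (intro order_trans[OF sum_abs] sum_mono) auto
  then show ?thesis by (simp add: transfer_eq_branches)
qed

lemma ess_bounded_transfer:
  assumes "ess_bounded \<phi>"
  shows "ess_bounded (transfer T \<phi>)"
proof -
  obtain B' where B': "AE x in unit_leb. \<bar>\<phi> x\<bar> \<le> B'" using assms by (auto simp: ess_bounded_def)
  define B where "B = max B' 0"
  have B: "AE x in unit_leb. \<phi> x \<le> B" "AE x in unit_leb. - B \<le> \<phi> x"
    using B' by (auto simp: B_def elim!: eventually_mono)
  have "AE y in unit_leb. transfer T \<phi> y \<le> transfer T (\<lambda>_. B) y"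
       "AE y in unit_leb. transfer T (\<lambda>_. - B) y \<le> transfer T \<phi> y"
    using AE_transfer_mono[OF B(1)] AE_transfer_mono[OF B(2)] by auto
  moreover have bd: "\<bar>transfer T (\<lambda>_. B) y\<bar> \<le> real (card branches) * B" "\<bar>transfer T (\<lambda>_. - B) y\<bar> \<le> real (card branches) * B" for y
    using transfer_bound[of "\<lambda>_. B" B y] transfer_bound[of "\<lambda>_. - B" B y] by (auto simp: B_def)
  ultimately have "AE y in unit_leb. \<bar>transfer T \<phi> y\<bar> \<le> real (card branches) * B"
  proof (elim eventually_rev_mp, intro AE_I2 impI)
    fix y assume "transfer T (\<lambda>_. - B) y \<le> transfer T \<phi> y" "transfer T \<phi> y \<le> transfer T (\<lambda>_. B) y"
    then show "\<bar>transfer T \<phi> y\<bar> \<le> real (card branches) * B" using bd[of y] by linarith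
  qed
  then show ?thesis
    using integrable_transfer(1)[OF ess_bounded_integrable[OF assms]] by (intro ess_boundedI) auto
qed

text \<open>Continuity on branches only handles Borel sets. The change of variables formula gives
  more: on a branch, the derivative times the indicator of S composed with T is Lebesgue measurable,
  and since the derivative does not vanish, the preimage is the set where the absolute value of this
  product is positive.\<close>

lemma measurable_vimage:
  assumes "S \<in> sets lebesgue"
  shows "{x \<in> {0..1}. T x \<in> S} \<in> sets lebesgue"
proof -
  have "{x \<in> J. T x \<in> S} \<in> sets lebesgue" if J: "J \<in> branches" for J
  proof -
    have sub: "J \<subseteq> smooth_set T" using J by (rule in_components_subset)
    let ?f = "indicator (S \<inter> T ` J) :: real \<Rightarrow> real"
    have m: "S \<inter> T ` J \<in> lmeasurable"
      using assms branch_measurable_sets(2)[OF J] image_branch_subset[OF J]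
      by (intro bounded_set_imp_lmeasurable) (auto intro: bounded_subset[OF bounded_closed_interval])
    have "?f absolutely_integrable_on T ` J"
      using m branch_measurable_sets(2)[OF J]
      unfolding set_integrable_def
      by (subst Bochner_Integration.integrable_cong[where g = ?f and N = lebesgue])
         (auto simp: indicator_def fmeasurable_def split: if_splits)
    then have "(\<lambda>x. \<bar>deriv T x\<bar> * ?f (T x)) absolutely_integrable_on J"
      using has_absolute_integral_change_of_variables_1'[of J T "deriv T" ?f "integral (T ` J) ?f"]
        branch_measurable_sets(1)[OF J] inj_on_branch[OF J] smooth_deriv(1) sub
      by (auto intro: DERIV_subset)
    then have "(\<lambda>x. indicat_real J x *\<^sub>R (\<bar>deriv T x\<bar> * ?f (T x))) \<in> borel_measurable lebesgue"
      unfolding set_integrable_def by (rule borel_measurable_integrable)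
    then have "(\<lambda>x. indicat_real J x *\<^sub>R (\<bar>deriv T x\<bar> * ?f (T x))) -` {0<..} \<inter> space lebesgue \<in> sets lebesgue"
      by (rule measurable_sets) simp
    moreover have "(\<lambda>x. indicat_real J x *\<^sub>R (\<bar>deriv T x\<bar> * ?f (T x))) -` {0<..} \<inter> space lebesgue = {x \<in> J. T x \<in> S}"
    proof -
      have "0 < \<bar>deriv T x\<bar>" if "x \<in> J" for x using expanding[of x] sub lam that by auto
      then show ?thesis by (auto simp: indicator_def split: if_splits) (auto simp: of_bool_def split: if_splits)
    qed
    ultimately show ?thesis by simp
  qed
  then have "(\<Union>J\<in>branches. {x \<in> J. T x \<in> S}) \<in> sets lebesgue"
    using finite_branches by (intro sets.finite_UN) auto
  moreover have "{x \<in> {0..1}. T x \<in> S} = (\<Union>J\<in>branches. {x \<in> J. T x \<in> S}) \<union> {x \<in> {0..1} - smooth_set T. T x \<in> S}"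
    using smooth_subset by (auto simp: in_smooth_iff subset_iff)
  moreover have "{x \<in> {0..1} - smooth_set T. T x \<in> S} \<in> sets lebesgue"
    by (rule negligible_imp_sets, rule negligible_finite, rule finite_subset[OF _ finite_nonsmooth]) auto
  ultimately show ?thesis by auto
qed

lemma measurable_map: "T \<in> unit_leb \<rightarrow>\<^sub>M unit_leb"
proof (rule measurableI)
  fix A assume "A \<in> sets unit_leb"
  then have "A \<in> sets lebesgue" by (auto simp: sets_restrict_space)
  then have "{x \<in> {0..1}. T x \<in> A} \<in> sets lebesgue" by (rule measurable_vimage)
  then show "T -` A \<inter> space unit_leb \<in> sets unit_leb"
    by (auto simp: sets_restrict_space space_restrict_space intro!: image_eqI[of _ _ "{x \<in> {0..1}. T x \<in> A}"])
qed (use maps in \<open>auto simp: space_restrict_space\<close>)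

end

section \<open>Variation along lists\<close>

fun lvar :: "(real \<Rightarrow> real) \<Rightarrow> real list \<Rightarrow> real" where
  "lvar f (x # y # zs) = \<bar>f y - f x\<bar> + lvar f (y # zs)"
| "lvar f [x] = 0"
| "lvar f [] = 0"

lemma lvar_eq_sum: "lvar f xs = (\<Sum>i<length xs - 1. \<bar>f (xs ! Suc i) - f (xs ! i)\<bar>)"
proof (induction f xs rule: lvar.induct)
  case (1 f x y zs)
  then show ?case by (simp add: sum.lessThan_Suc_shift del: sum.lessThan_Suc)
qed auto

lemma lvar_nonneg: "0 \<le> lvar f xs"
  by (simp add: lvar_eq_sum sum_nonneg)

text \<open>A real upper bound for the variation, so that estimates need neither extended reals nor
  the existence of a supremum.\<close>

definition bvar :: "(real \<Rightarrow> real) \<Rightarrow> real set \<Rightarrow> real \<Rightarrow> bool"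
  where "bvar f S v \<longleftrightarrow> (\<forall>xs. sorted xs \<and> set xs \<subseteq> S \<longrightarrow> lvar f xs \<le> v)"

lemma total_variation_le_iff: "total_variation f S \<le> ereal v \<longleftrightarrow> bvar f S v"
  by (auto simp: total_variation_def bvar_def SUP_le_iff lvar_eq_sum)

lemma bvar_nonneg: "bvar f S v \<Longrightarrow> 0 \<le> v"
  unfolding bvar_def by (drule spec[of _ "[]"]) simp

lemma bvar_subset: "bvar f S v \<Longrightarrow> S' \<subseteq> S \<Longrightarrow> bvar f S' v"
  unfolding bvar_def by blast

lemma bvar_le: "bvar f S v \<Longrightarrow> v \<le> w \<Longrightarrow> bvar f S w"
  unfolding bvar_def by force

lemma bvar_abs_diff:
  assumes "bvar f S v" "x \<in> S" "y \<in> S"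
  shows "\<bar>f x - f y\<bar> \<le> v"
proof -
  have "lvar f (if x \<le> y then [x, y] else [y, x]) \<le> v"
    using assms unfolding bvar_def by (auto split: if_splits)
  then show ?thesis by (auto split: if_splits)
qed

lemma lvar_append_ge: "lvar f xs + lvar f ys \<le> lvar f (xs @ ys)"
proof (induction f xs rule: lvar.induct)
  case (2 f x)
  then show ?case by (cases ys) auto
qed auto

lemma lvar_append: "xs \<noteq> [] \<Longrightarrow> ys \<noteq> [] \<Longrightarrow>
    lvar f (xs @ ys) = lvar f xs + \<bar>f (hd ys) - f (last xs)\<bar> + lvar f ys"
proof (induction f xs rule: lvar.induct)
  case (2 f x)
  then show ?case by (cases ys) auto
qed auto

lemma lvar_concat_ge: "(\<Sum>xs\<leftarrow>xss. lvar f xs) \<le> lvar f (concat xss)"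
proof (induction xss)
  case (Cons xs xss)
  then show ?case using lvar_append_ge[of f xs "concat xss"] by simp
qed simp

lemma lvar_cong: "(\<And>x. x \<in> set xs \<Longrightarrow> f x = g x) \<Longrightarrow> lvar f xs = lvar g xs"
  by (induction f xs rule: lvar.induct) auto

lemma lvar_add: "lvar (\<lambda>x. f x + g x) xs \<le> lvar f xs + lvar g xs"
  by (induction f xs rule: lvar.induct) auto

lemma lvar_cmult: "lvar (\<lambda>x. c * f x) xs = \<bar>c\<bar> * lvar f xs"
  by (simp add: lvar_eq_sum sum_distrib_left abs_mult flip: right_diff_distrib)

lemma lvar_sum: "lvar (\<lambda>x. \<Sum>i\<in>A. f i x) xs \<le> (\<Sum>i\<in>A. lvar (f i) xs)"
proof (induction A rule: infinite_finite_induct)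
  case (insert a A)
  then show ?case using lvar_add[of "f a" "\<lambda>x. \<Sum>i\<in>A. f i x" xs] by simp
qed (simp_all add: lvar_eq_sum)

lemma lvar_map: "lvar f (map h xs) = lvar (\<lambda>x. f (h x)) xs"
  by (induction "\<lambda>x. f (h x)" xs rule: lvar.induct) auto

lemma lvar_rev: "lvar f (rev xs) = lvar f xs"
proof (induction f xs rule: lvar.induct)
  case (1 f x y zs)
  have "lvar f (rev (x # y # zs)) = lvar f (rev (y # zs) @ [x])" by simp
  also have "\<dots> = lvar f (rev (y # zs)) + \<bar>f x - f y\<bar>"
    by (subst lvar_append) auto
  finally show ?case using 1 by simp
qed auto

lemma lvar_mult:
  assumes "\<And>x. x \<in> set xs \<Longrightarrow> \<bar>f x\<bar> \<le> A" "\<And>x. x \<in> set xs \<Longrightarrow> \<bar>g x\<bar> \<le> B"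
  shows "lvar (\<lambda>x. f x * g x) xs \<le> A * lvar g xs + B * lvar f xs"
  using assms
proof (induction f xs rule: lvar.induct)
  case (1 f x y zs)
  have "f y * g y - f x * g x = f y * (g y - g x) + g x * (f y - f x)" by (simp add: algebra_simps)
  then have "\<bar>f y * g y - f x * g x\<bar> \<le> \<bar>f y\<bar> * \<bar>g y - g x\<bar> + \<bar>g x\<bar> * \<bar>f y - f x\<bar>"
    by (metis abs_mult abs_triangle_ineq)
  also have "\<dots> \<le> A * \<bar>g y - g x\<bar> + B * \<bar>f y - f x\<bar>"
    using 1 by (intro add_mono mult_right_mono) auto
  finally show ?case using 1 by (simp add: algebra_simps)
qed auto

lemma lvar_zero: "(\<And>x. x \<in> set xs \<Longrightarrow> f x = 0) \<Longrightarrow> lvar f xs = 0"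
  by (induction f xs rule: lvar.induct) auto

text \<open>A sorted list meets an interval in one block, so there is at most one jump on entering
  and one on leaving, each of size at most \<open>M\<close>.\<close>

lemma lvar_zero_extension:
  assumes I: "is_interval I" and M: "\<And>x. \<bar>f x\<bar> \<le> M" and z: "\<And>x. x \<notin> I \<Longrightarrow> f x = 0" and "sorted xs"
  shows "lvar f xs \<le> lvar f (filter (\<lambda>x. x \<in> I) xs) + 2 * M"
proof -
  have M0: "0 \<le> M" using M[of 0] by linarith
  \<comment> \<open>Once inside the interval only the jump on leaving is still to come, hence a
    single \<open>M\<close>.\<close>
  have in_I: "lvar f (x # xs) \<le> lvar f (filter (\<lambda>x. x \<in> I) (x # xs)) + M" if "x \<in> I" "sorted (x # xs)" for x xs
    using that
  proof (induction xs arbitrary: x)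
    case (Cons y ys)
    show ?case
    proof (cases "y \<in> I")
      case True
      then show ?thesis using Cons.IH[of y] Cons.prems by auto
    next
      case False
      have "u \<notin> I" if "u \<in> set (y # ys)" for u
      proof
        assume "u \<in> I"
        moreover have "x \<le> y" "y \<le> u" using that Cons.prems by auto
        ultimately have "y \<in> I" using I \<open>x \<in> I\<close> mem_is_interval_1_I by blast
        then show False using False by simp
      qed
      then have "lvar f (y # ys) = 0" "f y = 0" by (auto intro!: lvar_zero z)
      then have "lvar f (x # y # ys) \<le> M" using M[of x] by simp
      then show ?thesis using lvar_nonneg[of f "filter (\<lambda>x. x \<in> I) (x # y # ys)"] by linarith
    qed
  qed (use M0 in auto)
  show ?thesis using \<open>sorted xs\<close>
  proof (induction xs)
    case (Cons x xs)
    show ?case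
    proof (cases "x \<in> I")
      case True
      then show ?thesis using in_I[of x xs] Cons.prems M0 by linarith
    next
      case False
      note x = this
      show ?thesis
      proof (cases xs)
        case Nil
        then show ?thesis using M0 False by simp
      next
        case (Cons y ys)
        show ?thesis
        proof (cases "y \<in> I")
          case True
          then have "lvar f xs \<le> lvar f (filter (\<lambda>x. x \<in> I) xs) + M"
            using in_I[of y ys] Cons \<open>sorted (x # xs)\<close> by auto
          moreover have "\<bar>f y - f x\<bar> \<le> M" using M[of y] z[OF x] by simp
          ultimately show ?thesis using Cons x by simp
        next
          case False
          then show ?thesis using Cons x Cons.IH Cons.prems z[OF x] z[OF False] by simp
        qed
      qed
    qed
  qed (use M0 in auto)
qed

definition pushforward :: "(real \<Rightarrow> real) \<Rightarrow> real set \<Rightarrow> (real \<Rightarrow> real) \<Rightarrow> real \<Rightarrow> real"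
  where "pushforward T Z h y = (if y \<in> T ` Z then h (the_inv_into Z T y) else 0)"

text \<open>T is strictly monotone on Z, so a sorted list in the image pulls back to a sorted or a
  reversed list in Z. The term 2 M pays for the extension by 0 outside the image.\<close>

lemma bvar_pushforward:
  assumes Z: "is_interval Z" and T: "continuous_on Z T" "inj_on T Z"
    and v: "bvar h Z v" and M: "\<And>x. x \<in> Z \<Longrightarrow> \<bar>h x\<bar> \<le> M" "0 \<le> M"
  shows "bvar (pushforward T Z h) UNIV (v + 2 * M)"
  unfolding bvar_def
proof (intro allI impI)
  fix xs :: "real list" assume xs: "sorted xs \<and> set xs \<subseteq> UNIV"
  let ?F = "pushforward T Z h" and ?I = "T ` Z" and ?inv = "the_inv_into Z T"
  let ?bs = "filter (\<lambda>x. x \<in> ?I) xs"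
  have inv: "?inv y \<in> Z" "T (?inv y) = y" if "y \<in> ?I" for y
    using that T(2) by (auto simp: the_inv_into_f_f)
  have "is_interval ?I"
    using Z T(1) by (metis connected_continuous_image is_interval_connected_1)
  then have "lvar ?F xs \<le> lvar ?F ?bs + 2 * M"
    by (rule lvar_zero_extension) (use M inv xs in \<open>auto simp: pushforward_def\<close>)
  also have "lvar ?F ?bs = lvar h (map ?inv ?bs)"
    unfolding lvar_map by (rule lvar_cong) (auto simp: pushforward_def)
  also have "\<dots> \<le> v"
  proof -
    have sub: "set (map ?inv ?bs) \<subseteq> Z" using inv by auto
    have sb: "sorted ?bs" using xs by (simp add: sorted_wrt_filter)
    have "monotone_on Z (<) (<) T \<or> monotone_on Z (<) (>) T"
      using injective_eq_monotone_map[OF Z T(1)] T(2) by simp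
    then show ?thesis
    proof
      assume m: "monotone_on Z (<) (<) T"
      have "sorted (map ?inv ?bs)"
        unfolding sorted_map
      proof (rule sorted_wrt_mono_rel[OF _ sb])
        fix x y assume "x \<in> set ?bs" "y \<in> set ?bs" "x \<le> y"
        then show "?inv x \<le> ?inv y"
          using inv[of x] inv[of y] monotone_onD[OF m, of "?inv y" "?inv x"] by fastforce
      qed
      then show ?thesis using v sub unfolding bvar_def by blast
    next
      assume m: "monotone_on Z (<) (>) T"
      have "sorted (rev (map ?inv ?bs))"
        unfolding sorted_wrt_rev sorted_wrt_map
      proof (rule sorted_wrt_mono_rel[OF _ sb])
        fix x y assume "x \<in> set ?bs" "y \<in> set ?bs" "x \<le> y"
        then show "?inv y \<le> ?inv x"
          using inv[of x] inv[of y] monotone_onD[OF m, of "?inv x" "?inv y"] by fastforce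
      qed
      moreover have "set (rev (map ?inv ?bs)) \<subseteq> Z" using sub by simp
      ultimately have "lvar h (rev (map ?inv ?bs)) \<le> v" using v unfolding bvar_def by blast
      then show ?thesis by (simp only: lvar_rev)
    qed
  qed
  finally show "lvar ?F xs \<le> v + 2 * M" by simp
qed

section \<open>Variation and infima over ordered families of intervals\<close>

definition var_on :: "(real \<Rightarrow> real) \<Rightarrow> real set \<Rightarrow> real"
  where "var_on f S = (SUP xs\<in>{xs. sorted xs \<and> set xs \<subseteq> S}. lvar f xs)"

lemma bvar_var_on: "bvar f S v \<Longrightarrow> bvar f S (var_on f S)"
  unfolding bvar_def var_on_def by (auto intro!: cSUP_upper bdd_aboveI2[where M = v])

lemma var_on_approx:
  assumes "e > 0"
  shows "\<exists>xs. sorted xs \<and> set xs \<subseteq> S \<and> var_on f S - e < lvar f xs"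
proof (rule ccontr)
  assume "\<not> ?thesis"
  then have le: "lvar f xs \<le> var_on f S - e" if "xs \<in> {xs. sorted xs \<and> set xs \<subseteq> S}" for xs
    using that by (auto simp: not_less)
  have "[] \<in> {xs. sorted xs \<and> set xs \<subseteq> S}" by simp
  then have "(SUP xs\<in>{xs. sorted xs \<and> set xs \<subseteq> S}. lvar f xs) \<le> var_on f S - e"
    using le by (intro cSUP_least) blast+
  then have "var_on f S \<le> var_on f S - e" by (simp only: var_on_def)
  then show False using assms by simp
qed

definition set_le :: "real set \<Rightarrow> real set \<Rightarrow> bool"
  where "set_le A B \<longleftrightarrow> (\<forall>x\<in>A. \<forall>y\<in>B. x \<le> y)"

text \<open>Almost optimal lists in the successive pieces concatenate to one sorted list; dropping
  the jumps between the pieces only lowers the variation.\<close>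

lemma sum_var_on_le:
  assumes ord: "sorted_wrt set_le Zs" and v: "bvar f S v" and sub: "\<And>Z. Z \<in> set Zs \<Longrightarrow> Z \<subseteq> S"
  shows "(\<Sum>Z\<leftarrow>Zs. var_on f Z) \<le> v"
proof (rule field_le_epsilon)
  fix e :: real assume e: "e > 0"
  \<comment> \<open>The error is shared among the pieces; the + 1 keeps the denominator positive for
    the empty list.\<close>
  define d where "d = e / (real (length Zs) + 1)"
  have d: "d > 0" using e by (simp add: d_def)
  have "\<exists>xs. sorted xs \<and> set xs \<subseteq> Z \<and> var_on f Z - d < lvar f xs" for Z
    using var_on_approx[OF d] by blast
  then have "\<exists>X. \<forall>Z. sorted (X Z) \<and> set (X Z) \<subseteq> Z \<and> var_on f Z - d < lvar f (X Z)"
    by (intro choice allI)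
  then obtain X where X: "\<And>Z. sorted (X Z)" "\<And>Z. set (X Z) \<subseteq> Z" "\<And>Z. var_on f Z - d < lvar f (X Z)"
    by blast
  have "sorted (concat (map X Zs))" using ord
  proof (induction Zs)
    case (Cons Z Zs)
    have "x \<le> y" if x: "x \<in> set (X Z)" and y: "y \<in> set (concat (map X Zs))" for x y
    proof -
      obtain Z' where Z': "Z' \<in> set Zs" "y \<in> set (X Z')" using y by auto
      have "set_le Z Z'" using Cons.prems Z'(1) by simp
      then show ?thesis using X(2)[of Z] X(2)[of Z'] x Z'(2) unfolding set_le_def by blast
    qed
    then show ?case using Cons X(1)[of Z] by (auto simp: sorted_append)
  qed simp
  moreover have "set (concat (map X Zs)) \<subseteq> S"
  proof
    fix x assume "x \<in> set (concat (map X Zs))"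
    then obtain Z where "Z \<in> set Zs" "x \<in> set (X Z)" by auto
    then show "x \<in> S" using X(2)[of Z] sub[of Z] by blast
  qed
  ultimately have "lvar f (concat (map X Zs)) \<le> v" using v unfolding bvar_def by blast
  moreover have "(\<Sum>Z\<leftarrow>Zs. var_on f Z - d) \<le> (\<Sum>Z\<leftarrow>Zs. lvar f (X Z))"
    by (rule sum_list_mono) (rule less_imp_le[OF X(3)])
  moreover have "(\<Sum>Z\<leftarrow>Zs. lvar f (X Z)) \<le> lvar f (concat (map X Zs))"
    using lvar_concat_ge[of f "map X Zs"] by (simp add: o_def)
  moreover have "(\<Sum>Z\<leftarrow>Zs. var_on f Z - d) = (\<Sum>Z\<leftarrow>Zs. var_on f Z) - real (length Zs) * d"
    by (simp add: sum_list_subtractf sum_list_triv)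
  moreover have "real (length Zs) * d \<le> e" using e by (simp add: d_def field_simps)
  ultimately show "(\<Sum>Z\<leftarrow>Zs. var_on f Z) \<le> v + e" by linarith
qed

text \<open>Densities are nonnegative only almost everywhere, hence the absolute value.\<close>

definition abs_inf :: "(real \<Rightarrow> real) \<Rightarrow> real set \<Rightarrow> real"
  where "abs_inf f Z = (INF x\<in>Z. \<bar>f x\<bar>)"

lemma abs_inf_le: "x \<in> Z \<Longrightarrow> abs_inf f Z \<le> \<bar>f x\<bar>"
  unfolding abs_inf_def by (intro cINF_lower bdd_belowI2[where m = 0]) auto

lemma abs_inf_nonneg: "Z \<noteq> {} \<Longrightarrow> 0 \<le> abs_inf f Z"
  unfolding abs_inf_def by (intro cINF_greatest) auto

lemma abs_inf_approx: "Z \<noteq> {} \<Longrightarrow> e > 0 \<Longrightarrow> \<exists>x\<in>Z. \<bar>f x\<bar> < abs_inf f Z + e"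
  unfolding abs_inf_def by (subst cINF_less_iff[symmetric]) (auto intro: bdd_belowI2[where m = 0])

lemma abs_le_abs_inf_plus_var:
  assumes "bvar f Z v" "x \<in> Z"
  shows "\<bar>f x\<bar> \<le> abs_inf f Z + v"
proof (rule field_le_epsilon)
  fix e :: real assume "e > 0"
  then obtain y where "y \<in> Z" "\<bar>f y\<bar> < abs_inf f Z + e" using abs_inf_approx[of Z e f] assms(2) by auto
  then show "\<bar>f x\<bar> \<le> abs_inf f Z + v + e" using bvar_abs_diff[OF assms(1) assms(2), of y] by linarith
qed

text \<open>Almost minimal points of the successive sets form a sorted list, and passing from the
  infima to the values there changes each increment by at most \<open>d\<close>.\<close>

lemma sum_abs_inf_increments_le:
  assumes ord: "sorted_wrt set_le Zs" and v: "bvar f S v"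
    and sub: "\<And>Z. Z \<in> set Zs \<Longrightarrow> Z \<subseteq> S" and ne: "\<And>Z. Z \<in> set Zs \<Longrightarrow> Z \<noteq> {}"
  shows "(\<Sum>i<length Zs - 1. \<bar>abs_inf f (Zs ! Suc i) - abs_inf f (Zs ! i)\<bar>) \<le> v"
proof (rule field_le_epsilon)
  fix e :: real assume e: "e > 0"
  define d where "d = e / (real (length Zs) + 1)"
  have d: "d > 0" using e by (simp add: d_def)
  have "\<exists>x. Z \<in> set Zs \<longrightarrow> x \<in> Z \<and> \<bar>f x\<bar> < abs_inf f Z + d" for Z
    using abs_inf_approx[OF _ d, of Z f] ne by blast
  then have "\<exists>X. \<forall>Z. Z \<in> set Zs \<longrightarrow> X Z \<in> Z \<and> \<bar>f (X Z)\<bar> < abs_inf f Z + d"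
    by (intro choice allI)
  then obtain X where X: "\<And>Z. Z \<in> set Zs \<Longrightarrow> X Z \<in> Z" "\<And>Z. Z \<in> set Zs \<Longrightarrow> \<bar>f (X Z)\<bar> < abs_inf f Z + d"
    by blast
  have "sorted (map X Zs)"
    unfolding sorted_map by (rule sorted_wrt_mono_rel[OF _ ord]) (use X(1) in \<open>auto simp: set_le_def\<close>)
  moreover have "set (map X Zs) \<subseteq> S" using X(1) sub by auto
  ultimately have *: "lvar f (map X Zs) \<le> v" using v unfolding bvar_def by blast
  have "(\<Sum>i<length Zs - 1. \<bar>abs_inf f (Zs ! Suc i) - abs_inf f (Zs ! i)\<bar>)
      \<le> (\<Sum>i<length Zs - 1. \<bar>f (X (Zs ! Suc i)) - f (X (Zs ! i))\<bar> + d)"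
  proof (rule sum_mono)
    fix i assume "i \<in> {..<length Zs - 1}"
    then have i: "Zs ! i \<in> set Zs" "Zs ! Suc i \<in> set Zs" by auto
    show "\<bar>abs_inf f (Zs ! Suc i) - abs_inf f (Zs ! i)\<bar> \<le> \<bar>f (X (Zs ! Suc i)) - f (X (Zs ! i))\<bar> + d"
      using X(2)[OF i(1)] X(2)[OF i(2)] abs_inf_le[OF X(1)[OF i(1)], of f] abs_inf_le[OF X(1)[OF i(2)], of f]
      by linarith
  qed
  also have "\<dots> = lvar f (map X Zs) + real (length Zs - 1) * d"
    by (simp add: lvar_eq_sum sum.distrib)
  also have "real (length Zs - 1) * d \<le> (real (length Zs) + 1) * d" using d by (intro mult_right_mono) auto
  also have "\<dots> = e" by (simp add: d_def)
  finally show "(\<Sum>i<length Zs - 1. \<bar>abs_inf f (Zs ! Suc i) - abs_inf f (Zs ! i)\<bar>) \<le> v + e" using * by linarith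
qed

text \<open>
  A value on a bad index is compared with the value on a nearest good index; an index or an increment
  is then used at most once for each bad index in the two adjacent runs.
\<close>

lemma sum_bad_runs_le:
  fixes c :: "nat \<Rightarrow> real"
  assumes B: "B \<subset> {..<N}" and c: "\<And>i. i < N \<Longrightarrow> 0 \<le> c i"
    and runs: "\<And>a b. {a..<b} \<subseteq> B \<Longrightarrow> real (b - a) \<le> R"
    and v: "(\<Sum>i<N - 1. \<bar>c (Suc i) - c i\<bar>) \<le> v"
  shows "(\<Sum>i\<in>B. c i) \<le> 2 * R * (v + (\<Sum>i\<in>{..<N} - B. c i))"
proof -
  define d where "d i = \<bar>c (Suc i) - c i\<bar>" for i
  have fB: "finite B" using B finite_subset by blast
  have R0: "0 \<le> R" using runs[of 0 0] by simp
  have tele: "\<bar>c b - c a\<bar> \<le> (\<Sum>j=a..<b. d j)" if "a \<le> b" for a b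
    using that by (induction b rule: dec_induct) (auto simp: d_def)
  \<comment> \<open>\<open>L j\<close> and \<open>Rt j\<close> consist of the bad indices reached
    from \<open>j\<close> to the right, respectively to the left, through bad indices only. Each is
    a single run, so the bound R applies.\<close>
  define L where "L j = {i. j < i \<and> {Suc j..<Suc i} \<subseteq> B}" for j
  define Rt where "Rt j = {i. i < j \<and> {i..<j} \<subseteq> B}" for j
  have LB: "L j \<subseteq> B" and RB: "Rt j \<subseteq> B" for j by (auto simp: L_def Rt_def subset_iff)
  have cL: "real (card (L j)) \<le> R" for j
  proof (cases "L j = {}")
    case False
    have f: "finite (L j)" using LB fB finite_subset by blast
    let ?m = "Max (L j)"
    have m: "?m \<in> L j" using f False by (rule Max_in)
    have "L j \<subseteq> {Suc j..<Suc ?m}" using f by (auto simp: L_def less_Suc_eq_le)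
    then have "card (L j) \<le> Suc ?m - Suc j" by (metis card_atLeastLessThan card_mono finite_atLeastLessThan)
    also have "real \<dots> \<le> R" using m by (intro runs) (simp add: L_def)
    finally show ?thesis by simp
  qed (use R0 in simp)
  have cR: "real (card (Rt j)) \<le> R" for j
  proof (cases "Rt j = {}")
    case False
    have f: "finite (Rt j)" using RB fB finite_subset by blast
    let ?m = "Min (Rt j)"
    have m: "?m \<in> Rt j" using f False by (rule Min_in)
    have "Rt j \<subseteq> {?m..<j}" using f by (auto simp: Rt_def)
    then have "card (Rt j) \<le> j - ?m" by (metis card_atLeastLessThan card_mono finite_atLeastLessThan)
    also have "real \<dots> \<le> R" using m by (intro runs) (simp add: Rt_def)
    finally show ?thesis by simp
  qed (use R0 in simp)
  have cLR: "real (card (L j \<union> Rt k)) \<le> 2 * R" for j k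
    using card_Un_le[of "L j" "Rt k"] cL[of j] cR[of k] by linarith
  \<comment> \<open>Properness of \<open>B\<close> supplies some good index k; the last good index
    before i is taken if k lies to the left of i, the first one after i otherwise.\<close>
  have "\<exists>g. g \<in> {..<N} - B \<and> (i \<in> L g \<or> i \<in> Rt g)" if i: "i \<in> B" for i
  proof -
    obtain k where k: "k < N" "k \<notin> B" using B by auto
    show ?thesis
    proof (cases "k < i")
      case True
      define g where "g = Max {j. j < i \<and> j \<notin> B}"
      have f: "finite {j. j < i \<and> j \<notin> B}" by simp
      have "g \<in> {j. j < i \<and> j \<notin> B}" unfolding g_def using f True k by (intro Max_in) auto
      moreover have "j \<in> B" if "g < j" "j \<le> i" for j
      proof (rule ccontr)
        assume "j \<notin> B"
        then have "j < i" using that i by (cases "j = i") auto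
        then have "j \<le> g" unfolding g_def using f \<open>j \<notin> B\<close> by (intro Max_ge) auto
        then show False using that by simp
      qed
      moreover have "i < N" using i B by auto
      ultimately show ?thesis by (intro exI[of _ g]) (auto simp: L_def)
    next
      case False
      then have "i < k" using i k by (cases "i = k") auto
      define g where "g = (LEAST j. i < j \<and> j \<notin> B)"
      have g: "i < g \<and> g \<notin> B" unfolding g_def using LeastI[of "\<lambda>j. i < j \<and> j \<notin> B" k] \<open>i < k\<close> k by simp
      have gk: "g \<le> k" unfolding g_def using Least_le[of "\<lambda>j. i < j \<and> j \<notin> B" k] \<open>i < k\<close> k by simp
      have "j \<in> B" if "i \<le> j" "j < g" for j
      proof (rule ccontr)
        assume "j \<notin> B"
        then have "i < j" using that i by (cases "i = j") auto
        then have "g \<le> j" unfolding g_def using Least_le[of "\<lambda>j. i < j \<and> j \<notin> B" j] \<open>j \<notin> B\<close> by simp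
        then show False using that by simp
      qed
      then show ?thesis using g gk k by (intro exI[of _ g]) (auto simp: Rt_def)
    qed
  qed
  then have "\<forall>i\<in>B. \<exists>g. g \<in> {..<N} - B \<and> (i \<in> L g \<or> i \<in> Rt g)" by (intro ballI)
  then have "\<exists>g. \<forall>i\<in>B. g i \<in> {..<N} - B \<and> (i \<in> L (g i) \<or> i \<in> Rt (g i))" by (rule bchoice)
  then obtain g where gg: "\<forall>i\<in>B. g i \<in> {..<N} - B \<and> (i \<in> L (g i) \<or> i \<in> Rt (g i))" ..
  have g: "g i \<in> {..<N} - B" "i \<in> L (g i) \<or> i \<in> Rt (g i)" if "i \<in> B" for i
    using gg that by simp_all
  \<comment> \<open>The increments crossed on the way from \<open>i\<close> to its good neighbour
    \<open>g i\<close>.\<close>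
  define E where "E i = {min i (g i)..<max i (g i)}" for i
  have EN: "E i \<subseteq> {..<N - 1}" if "i \<in> B" for i
  proof -
    have "i < N" "g i < N" using that g(1)[OF that] B by auto
    then show ?thesis by (auto simp: E_def)
  qed
  have le: "c i \<le> c (g i) + (\<Sum>j\<in>E i. d j)" if "i \<in> B" for i
    using tele[of "min i (g i)" "max i (g i)"] by (auto simp: E_def min_def max_def split: if_splits)
  have "(\<Sum>i\<in>B. c i) \<le> (\<Sum>i\<in>B. c (g i)) + (\<Sum>i\<in>B. \<Sum>j\<in>E i. d j)"
    unfolding sum.distrib[symmetric] by (rule sum_mono) (rule le)
  also have "(\<Sum>i\<in>B. c (g i)) = (\<Sum>k\<in>{..<N} - B. \<Sum>i | i \<in> B \<and> g i = k. c (g i))"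
    by (rule sum.group[symmetric]) (use fB g in auto)
  also have "\<dots> = (\<Sum>k\<in>{..<N} - B. real (card {i \<in> B. g i = k}) * c k)"
    by (intro sum.cong refl) simp
  also have "\<dots> \<le> (\<Sum>k\<in>{..<N} - B. 2 * R * c k)"
  proof (intro sum_mono mult_right_mono)
    fix k assume k: "k \<in> {..<N} - B"
    have "{i \<in> B. g i = k} \<subseteq> L k \<union> Rt k" using g(2) by auto
    then have "card {i \<in> B. g i = k} \<le> card (L k \<union> Rt k)"
      using finite_subset[OF LB fB] finite_subset[OF RB fB] by (intro card_mono) auto
    then show "real (card {i \<in> B. g i = k}) \<le> 2 * R" using cLR[of k k] by linarith
  qed (use c in auto)
  also have "(\<Sum>i\<in>B. \<Sum>j\<in>E i. d j) = (\<Sum>i\<in>B. \<Sum>j\<in>{..<N - 1}. if j \<in> E i then d j else 0)"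
  proof (rule sum.cong[OF refl])
    fix i assume "i \<in> B"
    then have "E i = {..<N - 1} \<inter> E i" using EN by blast
    then show "(\<Sum>j\<in>E i. d j) = (\<Sum>j\<in>{..<N - 1}. if j \<in> E i then d j else 0)"
      using sum.inter_restrict[of "{..<N - 1}" d "E i"] by simp
  qed
  also have "\<dots> = (\<Sum>j\<in>{..<N - 1}. \<Sum>i\<in>B. if j \<in> E i then d j else 0)"
    by (rule sum.swap)
  also have "\<dots> = (\<Sum>j\<in>{..<N - 1}. real (card {i \<in> B. j \<in> E i}) * d j)"
  proof (rule sum.cong[OF refl])
    fix j
    have "(\<Sum>i\<in>B. if j \<in> E i then d j else 0) = (\<Sum>i\<in>{i \<in> B. j \<in> E i}. d j)"
      using sum.inter_filter[OF fB, of "\<lambda>_. d j" "\<lambda>i. j \<in> E i"] by simp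
    then show "(\<Sum>i\<in>B. if j \<in> E i then d j else 0) = real (card {i \<in> B. j \<in> E i}) * d j"
      by simp
  qed
  also have "\<dots> \<le> (\<Sum>j\<in>{..<N - 1}. 2 * R * d j)"
  proof (intro sum_mono mult_right_mono)
    fix j
    \<comment> \<open>An index that crosses the increment from \<open>j\<close> to
      \<open>Suc j\<close> is linked through bad indices to one of these two ends, so at most 2 R
      indices cross it.\<close>
    have "i \<in> L j \<union> Rt (Suc j)" if i: "i \<in> B" "j \<in> E i" for i
      using g(2)[OF i(1)]
    proof
      assume "i \<in> L (g i)"
      then show ?thesis using i(2) by (auto simp: L_def E_def subset_iff)
    next
      assume "i \<in> Rt (g i)"
      then show ?thesis using i(2) by (auto simp: Rt_def E_def subset_iff)
    qed
    then have "card {i \<in> B. j \<in> E i} \<le> card (L j \<union> Rt (Suc j))"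
      using finite_subset[OF LB fB] finite_subset[OF RB fB] by (intro card_mono) auto
    then show "real (card {i \<in> B. j \<in> E i}) \<le> 2 * R" using cLR[of j "Suc j"] by linarith
  qed (simp add: d_def)
  also have "\<dots> = 2 * R * (\<Sum>j\<in>{..<N - 1}. d j)" by (simp add: sum_distrib_left)
  also have "\<dots> \<le> 2 * R * v" using v R0 unfolding d_def by (intro mult_left_mono) auto
  finally show ?thesis by (simp add: sum_distrib_left algebra_simps)
qed

section \<open>Open products of expanding maps\<close>

definition shift_by :: "nat \<Rightarrow> (nat \<Rightarrow> symb) \<Rightarrow> nat \<Rightarrow> symb"
  where "shift_by n \<sigma> = (\<lambda>k. \<sigma> (n + k))"

lemma shift_by_0 [simp]: "shift_by 0 \<sigma> = \<sigma>"
  by (simp add: shift_by_def)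

lemma shift_eq_shift_by: "shift \<sigma> = shift_by 1 \<sigma>"
  by (simp add: shift_def shift_by_def)

lemma shift_by_shift_by: "shift_by n (shift_by m \<sigma>) = shift_by (m + n) \<sigma>"
  by (simp add: shift_by_def add.assoc)

lemma shift_by_in_symbol_seqs: "\<sigma> \<in> symbol_seqs TT HH \<Longrightarrow> shift_by n \<sigma> \<in> symbol_seqs TT HH"
  by (auto simp: symbol_seqs_def shift_by_def)

lemma symbol_seqs_in: "\<sigma> \<in> symbol_seqs TT HH \<Longrightarrow> \<sigma> k \<in> TT \<times> HH"
  by (auto simp: symbol_seqs_def)

lemma transfer_linear: "transfer T (\<lambda>x. a * \<phi> x + b * \<psi> x) y = a * transfer T \<phi> y + b * transfer T \<psi> y"
  by (simp add: transfer_def sum_distrib_left sum.distrib add_divide_distrib)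

lemma open_transfer_linear:
  "open_transfer s (\<lambda>x. a * \<phi> x + b * \<psi> x) = (\<lambda>y. a * open_transfer s \<phi> y + b * open_transfer s \<psi> y)"
proof
  fix y
  have "(\<lambda>x. (a * \<phi> x + b * \<psi> x) * indicator (snd s) x)
      = (\<lambda>x. a * (\<phi> x * indicator (snd s) x) + b * (\<psi> x * indicator (snd s) x))"
    by (auto simp: algebra_simps)
  then show "open_transfer s (\<lambda>x. a * \<phi> x + b * \<psi> x) y = a * open_transfer s \<phi> y + b * open_transfer s \<psi> y"
    by (simp add: open_transfer_def transfer_linear)
qed

lemma L_iter_linear:
  "L_iter \<sigma> n (\<lambda>x. a * \<phi> x + b * \<psi> x) = (\<lambda>y. a * L_iter \<sigma> n \<phi> y + b * L_iter \<sigma> n \<psi> y)"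
  by (induction n) (simp_all add: open_transfer_linear)

lemma L_iter_add_fun: "L_iter \<sigma> n (\<lambda>x. \<phi> x + \<psi> x) = (\<lambda>y. L_iter \<sigma> n \<phi> y + L_iter \<sigma> n \<psi> y)"
  using L_iter_linear[of \<sigma> n 1 \<phi> 1 \<psi>] by simp

lemma L_iter_diff: "L_iter \<sigma> n (\<lambda>x. \<phi> x - \<psi> x) = (\<lambda>y. L_iter \<sigma> n \<phi> y - L_iter \<sigma> n \<psi> y)"
  using L_iter_linear[of \<sigma> n 1 \<phi> "-1" \<psi>] by simp

lemma L_iter_cmult: "L_iter \<sigma> n (\<lambda>x. a * \<phi> x) = (\<lambda>y. a * L_iter \<sigma> n \<phi> y)"
  using L_iter_linear[of \<sigma> n a \<phi> 0 \<phi>] by simp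

lemma L_iter_zero: "L_iter \<sigma> n (\<lambda>_. 0) = (\<lambda>_. 0)"
  using L_iter_cmult[of \<sigma> n 0 "\<lambda>_. 0"] by simp

lemma L_iter_add: "L_iter \<sigma> (m + n) \<phi> = L_iter (shift_by m \<sigma>) n (L_iter \<sigma> m \<phi>)"
  by (induction n) (simp_all add: shift_by_def)

text \<open>Hypotheses on the classes of maps and holes alone, without walk or environment; the
  constants obtained here depend on nothing else.\<close>

locale open_system =
  fixes TT :: "(real \<Rightarrow> real) set" and HH :: "real set set" and lam C K \<xi> :: real
  assumes finite_TT: "finite TT" and TT_ne: "TT \<noteq> {}" and HH_ne: "HH \<noteq> {}"
    and expanding: "\<And>T. T \<in> TT \<Longrightarrow> expanding_map T lam"
    and hole_interval: "\<And>H. H \<in> HH \<Longrightarrow> is_interval H"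
    and hole_subset: "\<And>H. H \<in> HH \<Longrightarrow> H \<subseteq> {0..1}"
    and distortion: "distortion_bound TT HH C"
    and C1: "cond_C1 TT HH"
    and C2: "cond_C2 TT HH K \<xi>"
begin

abbreviation "\<S> \<equiv> symbol_seqs TT HH"
abbreviation "\<Theta> \<equiv> Theta TT"
abbreviation "\<rho> \<equiv> rho TT HH"
abbreviation "\<theta> \<equiv> \<xi> * Theta TT"

lemma symbols_ne: "\<S> \<noteq> {}"
proof -
  obtain T H where "T \<in> TT" "H \<in> HH" using TT_ne HH_ne by blast
  then have "(\<lambda>_. (T, H)) \<in> \<S>" by (simp add: symbol_seqs_def)
  then show ?thesis by blast
qed

lemma hole_measurable: "H \<in> HH \<Longrightarrow> H \<in> sets lebesgue"
  using is_real_interval[OF hole_interval, of H] by (auto; simp)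

lemma K_nonneg: "0 \<le> K" and xi_ge_1: "1 \<le> \<xi>" and theta_less: "\<theta> < \<rho>" "\<theta> < 1"
  using C2 by (auto simp: cond_C2_def)

text \<open>The derivative is continuous on the open smooth set. The finitely many break points,
  where \<open>deriv\<close> has arbitrary values, are added as multiples of indicators of
  points.\<close>

lemma deriv_measurable:
  assumes "T \<in> TT"
  shows "deriv T \<in> borel_measurable unit_leb"
proof -
  interpret expanding_map T lam using assms by (rule expanding)
  let ?F = "{0..1} - smooth_set T"
  let ?d = "\<lambda>x. if x \<in> smooth_set T then deriv T x else 0"
  have "?d \<in> borel_measurable borel"
    by (rule borel_measurable_continuous_on_if)
       (use open_smooth smooth_deriv(2) in \<open>auto intro!: continuous_at_imp_continuous_on\<close>)
  then have "?d \<in> borel_measurable lborel" by (metis measurable_lborel2)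
  then have "?d \<in> borel_measurable lebesgue" by (rule measurable_completion)
  then have m: "?d \<in> borel_measurable unit_leb" by (rule measurable_restrict_space1)
  have "(\<lambda>x. ?d x + (\<Sum>p\<in>?F. indicator {p} x * deriv T p)) \<in> borel_measurable unit_leb"
    by (intro m borel_measurable_add borel_measurable_sum borel_measurable_times borel_measurable_const
        measurable_restrict_space1[of _ lebesgue] borel_measurable_indicator) auto
  moreover have eq: "deriv T x = ?d x + (\<Sum>p\<in>?F. indicator {p} x * deriv T p)" if "x \<in> space unit_leb" for x
  proof (cases "x \<in> smooth_set T")
    case True
    then have "(\<Sum>p\<in>?F. indicator {p} x * deriv T p) = 0" by (intro sum.neutral) (auto simp: indicator_def)
    then show ?thesis using True by simp
  next
    case False
    then have "x \<in> ?F" using that by (simp add: space_restrict_space)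
    then have "(\<Sum>p\<in>?F. indicator {p} x * deriv T p) = (\<Sum>p\<in>?F. if x = p then deriv T p else 0)"
      by (intro sum.cong) (auto simp: indicator_def)
    then show ?thesis using False \<open>x \<in> ?F\<close> finite_nonsmooth by simp
  qed
  ultimately show ?thesis by (subst measurable_cong[OF eq])
qed

text \<open>\<open>Theta\<close> is defined by essential infima, whereas the weights are evaluated
  at points. Continuity of the derivative closes the gap: a violation at one smooth point would
  persist on a nonempty open set, which is not negligible.\<close>

lemma Theta_pos: "0 < \<Theta>"
  and inverse_deriv_le: "T \<in> TT \<Longrightarrow> x \<in> smooth_set T \<Longrightarrow> 1 / \<bar>deriv T x\<bar> \<le> \<Theta>"
proof -
  let ?D = "\<lambda>T. ess_inf (\<lambda>x. \<bar>deriv T x\<bar>)"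
  have lam_pos: "lam > 1" using TT_ne expanding by (auto simp: expanding_map_def)
  have iff: "c \<le> ?D T \<longleftrightarrow> (AE x in unit_leb. c \<le> \<bar>deriv T x\<bar>)" if "T \<in> TT" for T c
    by (rule le_ess_inf_iff[where b = 0]) (use deriv_measurable[OF that] in auto)
  have lamD: "lam \<le> ?D T" if T: "T \<in> TT" for T
  proof -
    interpret expanding_map T lam using T by (rule local.expanding)
    show ?thesis unfolding iff[OF T]
      using AE_smooth by (rule eventually_mono) (rule expanding)
  qed
  let ?I = "INF T\<in>TT. ?D T"
  have I: "lam \<le> ?I" using lamD TT_ne by (intro cINF_greatest) auto
  show "0 < \<Theta>" using I lam_pos by (simp add: Theta_def)
  show "1 / \<bar>deriv T x\<bar> \<le> \<Theta>" if T: "T \<in> TT" and x: "x \<in> smooth_set T"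
  proof -
    interpret expanding_map T lam using T by (rule local.expanding)
    have ID: "?I \<le> ?D T" using T finite_TT by (intro cINF_lower) (auto intro: bdd_below_finite)
    have "?D T \<le> \<bar>deriv T x\<bar>"
    proof (rule ccontr)
      assume "\<not> ?thesis"
      then have lt: "\<bar>deriv T x\<bar> < ?D T" by simp
      have "isCont (\<lambda>y. \<bar>deriv T y\<bar>) x" using smooth_deriv(2)[OF x] by (intro continuous_intros)
      then have "((\<lambda>y. \<bar>deriv T y\<bar>) \<longlongrightarrow> \<bar>deriv T x\<bar>) (nhds x)" 
        unfolding isCont_def using tendsto_at_iff_tendsto_nhds[of "\<lambda>y. \<bar>deriv T y\<bar>" x] by simp
      then have "eventually (\<lambda>y. \<bar>deriv T y\<bar> < ?D T) (nhds x)" using lt by (rule order_tendstoD)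
      then obtain S where S: "open S" "x \<in> S" "\<And>y. y \<in> S \<Longrightarrow> \<bar>deriv T y\<bar> < ?D T"
        unfolding eventually_nhds by blast
      have "AE y in unit_leb. ?D T \<le> \<bar>deriv T y\<bar>" using iff[OF T, of "?D T"] by simp
      then have "negligible {y \<in> {0..1}. \<not> ?D T \<le> \<bar>deriv T y\<bar>}" by (simp only: AE_unit_leb_iff)
      then have "negligible (S \<inter> smooth_set T)"
        by (rule negligible_subset) (use S(3) smooth_subset in force)
      moreover have "open (S \<inter> smooth_set T)" "S \<inter> smooth_set T \<noteq> {}" using S open_smooth x by auto
      ultimately show False using open_not_negligible by blast
    qed
    then have "?I \<le> \<bar>deriv T x\<bar>" using ID by linarith
    then show ?thesis using I lam_pos by (simp add: Theta_def divide_inverse le_imp_inverse_le)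
  qed
qed

lemma theta_pos: "0 < \<theta>" and rho_pos: "0 < \<rho>" and Theta_le_theta: "\<Theta> \<le> \<theta>"
proof -
  show "0 < \<theta>" using Theta_pos xi_ge_1 by simp
  then show "0 < \<rho>" using theta_less by linarith
  show "\<Theta> \<le> \<theta>" using Theta_pos xi_ge_1 by simp
qed

lemma AE_open_transfer_mono:
  assumes "s \<in> TT \<times> HH" "AE x in unit_leb. \<phi> x \<le> \<psi> x"
  shows "AE x in unit_leb. open_transfer s \<phi> x \<le> open_transfer s \<psi> x"
proof -
  interpret expanding_map "fst s" lam using assms by (auto intro: expanding)
  show ?thesis unfolding open_transfer_def
    by (rule AE_transfer_mono) (use assms(2) in \<open>auto elim!: eventually_mono simp: indicator_def\<close>)
qed

lemma ess_bounded_open_transfer: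
  assumes "s \<in> TT \<times> HH" "ess_bounded \<phi>"
  shows "ess_bounded (open_transfer s \<phi>)"
proof -
  interpret expanding_map "fst s" lam using assms by (auto intro: expanding)
  show ?thesis unfolding open_transfer_def
    by (intro ess_bounded_transfer ess_bounded_mult ess_bounded_indicator hole_measurable) (use assms in auto)
qed

lemma AE_L_iter_mono:
  assumes "\<sigma> \<in> \<S>" "AE x in unit_leb. \<phi> x \<le> \<psi> x"
  shows "AE x in unit_leb. L_iter \<sigma> n \<phi> x \<le> L_iter \<sigma> n \<psi> x"
proof (induction n)
  case (Suc n)
  show ?case using AE_open_transfer_mono[OF symbol_seqs_in[OF assms(1)] Suc.IH] by simp
qed (use assms(2) in simp)

lemma AE_L_iter_cong:
  assumes "\<sigma> \<in> \<S>" "AE x in unit_leb. \<phi> x = \<psi> x"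
  shows "AE x in unit_leb. L_iter \<sigma> n \<phi> x = L_iter \<sigma> n \<psi> x"
proof -
  have "AE x in unit_leb. L_iter \<sigma> n \<phi> x \<le> L_iter \<sigma> n \<psi> x" "AE x in unit_leb. L_iter \<sigma> n \<psi> x \<le> L_iter \<sigma> n \<phi> x"
    by (rule AE_L_iter_mono[OF assms(1)], rule eventually_mono[OF assms(2)], simp)+
  then show ?thesis by eventually_elim simp
qed

lemma ess_bounded_L_iter: "\<sigma> \<in> \<S> \<Longrightarrow> ess_bounded \<phi> \<Longrightarrow> ess_bounded (L_iter \<sigma> n \<phi>)"
  by (induction n) (auto intro: ess_bounded_open_transfer symbol_seqs_in)

lemma AE_L_iter_nonneg:
  assumes "\<sigma> \<in> \<S>" "AE x in unit_leb. 0 \<le> \<phi> x"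
  shows "AE x in unit_leb. 0 \<le> L_iter \<sigma> n \<phi> x"
  using AE_L_iter_mono[OF assms(1), of "\<lambda>_. 0" \<phi> n] assms(2) by (simp add: L_iter_zero)

text \<open>Iterates (C1) by positivity, each step contributing one factor \<delta>. This makes the
  quotients in \<open>Lambda\<close> meaningful.\<close>

lemma AE_L_iter_one_ge:
  "\<exists>\<delta>>0. \<forall>\<sigma>\<in>\<S>. \<forall>n. AE x in unit_leb. \<delta> ^ n \<le> L_iter \<sigma> n (\<lambda>_. 1) x"
proof -
  obtain \<delta> where \<delta>: "\<delta> > 0" "\<And>s. s \<in> TT \<times> HH \<Longrightarrow> \<delta> \<le> ess_inf (open_transfer s (\<lambda>_. 1))"
    using C1 unfolding cond_C1_def by blast
  have "AE x in unit_leb. \<delta> ^ n \<le> L_iter \<sigma> n (\<lambda>_. 1) x" if \<sigma>: "\<sigma> \<in> \<S>" for \<sigma> n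
  proof (induction n)
    case (Suc n)
    have s: "\<sigma> n \<in> TT \<times> HH" using \<sigma> by (rule symbol_seqs_in)
    have "ess_inf (open_transfer (\<sigma> n) (\<lambda>_. 1)) > 0" using \<delta>(1) \<delta>(2)[OF s] by linarith
    from ess_inf_pos_imp(2)[OF this]
    have "AE x in unit_leb. \<delta> \<le> open_transfer (\<sigma> n) (\<lambda>_. 1) x"
      by (rule eventually_mono) (use \<delta>(2)[OF s] in auto)
    moreover have "AE x in unit_leb. open_transfer (\<sigma> n) (\<lambda>_. \<delta> ^ n) x \<le> L_iter \<sigma> (Suc n) (\<lambda>_. 1) x"
      using AE_open_transfer_mono[OF s Suc.IH] by simp
    moreover have "open_transfer (\<sigma> n) (\<lambda>_. \<delta> ^ n) = (\<lambda>x. \<delta> ^ n * open_transfer (\<sigma> n) (\<lambda>_. 1) x)"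
      using open_transfer_linear[of "\<sigma> n" "\<delta> ^ n" "\<lambda>_. 1" 0 "\<lambda>_. 1"] by simp
    ultimately show ?case
    proof (elim eventually_rev_mp, intro AE_I2 impI)
      fix x assume *: "open_transfer (\<sigma> n) (\<lambda>_. \<delta> ^ n) = (\<lambda>x. \<delta> ^ n * open_transfer (\<sigma> n) (\<lambda>_. 1) x)"
        "open_transfer (\<sigma> n) (\<lambda>_. \<delta> ^ n) x \<le> L_iter \<sigma> (Suc n) (\<lambda>_. 1) x" "\<delta> \<le> open_transfer (\<sigma> n) (\<lambda>_. 1) x"
      have "\<delta> ^ n * \<delta> \<le> \<delta> ^ n * open_transfer (\<sigma> n) (\<lambda>_. 1) x" using * \<delta>(1) by (intro mult_left_mono) auto
      then show "\<delta> ^ Suc n \<le> L_iter \<sigma> (Suc n) (\<lambda>_. 1) x" using * by (simp add: mult.commute)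
    qed
  qed simp
  then show ?thesis using \<delta>(1) by blast
qed

lemma AE_L_iter_one_pos: "\<sigma> \<in> \<S> \<Longrightarrow> AE x in unit_leb. 0 < L_iter \<sigma> n (\<lambda>_. 1) x"
proof -
  assume \<sigma>: "\<sigma> \<in> \<S>"
  obtain \<delta> where "\<delta> > 0" "\<And>\<sigma> n. \<sigma> \<in> \<S> \<Longrightarrow> AE x in unit_leb. \<delta> ^ n \<le> L_iter \<sigma> n (\<lambda>_. 1) x"
    using AE_L_iter_one_ge by blast
  from this(2)[OF \<sigma>, of n] show ?thesis
    by (rule eventually_mono) (use \<open>\<delta> > 0\<close> in \<open>auto intro: less_le_trans[OF zero_less_power]\<close>)
qed

section \<open>The functional \<open>Lambda\<close> and its behaviour along the product\<close>

definition ratio_inf :: "(nat \<Rightarrow> symb) \<Rightarrow> nat \<Rightarrow> (real \<Rightarrow> real) \<Rightarrow> real"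
  where "ratio_inf \<sigma> n \<phi> = ess_inf (\<lambda>x. L_iter \<sigma> n \<phi> x / L_iter \<sigma> n (\<lambda>_. 1) x)"

lemma Lambda_eq_lim: "Lambda \<sigma> \<phi> = lim (\<lambda>n. ratio_inf \<sigma> n \<phi>)"
  by (simp add: Lambda_def ratio_inf_def)

text \<open>Clearing the positive denominator turns bounds on infima of quotients into inequalities
  between iterates, to which positivity of the operators applies.\<close>

lemma le_ratio_inf_iff:
  assumes \<sigma>: "\<sigma> \<in> \<S>" and \<phi>: "ess_bounded \<phi>"
  shows "c \<le> ratio_inf \<sigma> n \<phi> \<longleftrightarrow> (AE x in unit_leb. c * L_iter \<sigma> n (\<lambda>_. 1) x \<le> L_iter \<sigma> n \<phi> x)"
proof -
  let ?one = "L_iter \<sigma> n (\<lambda>_. 1)"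
  have pos: "AE x in unit_leb. 0 < ?one x" using \<sigma> by (rule AE_L_iter_one_pos)
  have iff: "(AE x in unit_leb. c \<le> L_iter \<sigma> n \<phi> x / ?one x) \<longleftrightarrow> (AE x in unit_leb. c * ?one x \<le> L_iter \<sigma> n \<phi> x)" for c
    using pos by (intro iffI; elim eventually_rev_mp) (auto simp: pos_le_divide_eq intro!: AE_I2)
  obtain B where B: "AE x in unit_leb. \<bar>\<phi> x\<bar> \<le> B" using \<phi> by (auto simp: ess_bounded_def)
  have "AE x in unit_leb. (- B) * 1 \<le> \<phi> x" using B by (rule eventually_mono) auto
  from AE_L_iter_mono[OF \<sigma> this] have "AE x in unit_leb. (- B) * ?one x \<le> L_iter \<sigma> n \<phi> x"
    by (simp only: L_iter_cmult)
  then have lb: "AE x in unit_leb. - B \<le> L_iter \<sigma> n \<phi> x / ?one x" using iff by blast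
  have m: "(\<lambda>x. L_iter \<sigma> n \<phi> x / ?one x) \<in> borel_measurable unit_leb"
    using ess_bounded_L_iter[OF \<sigma> \<phi>, of n] ess_bounded_L_iter[OF \<sigma> ess_bounded_const, of n 1]
    by (intro borel_measurable_divide) (auto simp: ess_bounded_def)
  show ?thesis unfolding ratio_inf_def using le_ess_inf_iff[OF m lb] iff by blast
qed

lemma AE_ratio_inf:
  assumes "\<sigma> \<in> \<S>" "ess_bounded \<phi>"
  shows "AE x in unit_leb. ratio_inf \<sigma> n \<phi> * L_iter \<sigma> n (\<lambda>_. 1) x \<le> L_iter \<sigma> n \<phi> x"
  using le_ratio_inf_iff[OF assms] by blast

lemma ratio_inf_leI:
  assumes \<sigma>: "\<sigma> \<in> \<S>" and \<phi>: "ess_bounded \<phi>"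
    and le: "AE x in unit_leb. L_iter \<sigma> n \<phi> x \<le> c * L_iter \<sigma> n (\<lambda>_. 1) x"
  shows "ratio_inf \<sigma> n \<phi> \<le> c"
proof (rule ccontr)
  assume "\<not> ?thesis"
  then have lt: "c < ratio_inf \<sigma> n \<phi>" by simp
  have "AE x in unit_leb. False"
    using AE_ratio_inf[OF \<sigma> \<phi>, of n] le AE_L_iter_one_pos[OF \<sigma>, of n]
  proof eventually_elim
    case (elim x)
    then have "ratio_inf \<sigma> n \<phi> * L_iter \<sigma> n (\<lambda>_. 1) x \<le> c * L_iter \<sigma> n (\<lambda>_. 1) x" by linarith
    then show False using elim(3) lt by (simp add: mult_le_cancel_right)
  qed
  then show False using emeasure_unit_leb by (simp add: unit_leb.AE_False)
qed

text \<open>The inequality r L^n 1 <= L^n \<phi> survives an application of the next operator, which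
  is positive and linear.\<close>

lemma incseq_ratio_inf:
  assumes \<sigma>: "\<sigma> \<in> \<S>" and \<phi>: "ess_bounded \<phi>"
  shows "incseq (\<lambda>n. ratio_inf \<sigma> n \<phi>)"
proof (rule incseq_SucI)
  fix n
  let ?r = "ratio_inf \<sigma> n \<phi>"
  have "AE x in unit_leb. open_transfer (\<sigma> n) (\<lambda>x. ?r * L_iter \<sigma> n (\<lambda>_. 1) x) x \<le> open_transfer (\<sigma> n) (L_iter \<sigma> n \<phi>) x"
    using AE_open_transfer_mono[OF symbol_seqs_in[OF \<sigma>] AE_ratio_inf[OF assms]] .
  then show "?r \<le> ratio_inf \<sigma> (Suc n) \<phi>"
    unfolding le_ratio_inf_iff[OF assms]
    using open_transfer_linear[of "\<sigma> n" ?r "L_iter \<sigma> n (\<lambda>_. 1)" 0 "\<lambda>_. 0"] by simp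
qed

lemma ratio_inf_le_const:
  assumes \<sigma>: "\<sigma> \<in> \<S>" and \<phi>: "ess_bounded \<phi>" and B: "AE x in unit_leb. \<phi> x \<le> B"
  shows "ratio_inf \<sigma> n \<phi> \<le> B"
proof (rule ratio_inf_leI[OF \<sigma> \<phi>])
  have "AE x in unit_leb. \<phi> x \<le> B * 1" using B by simp
  from AE_L_iter_mono[OF \<sigma> this] show "AE x in unit_leb. L_iter \<sigma> n \<phi> x \<le> B * L_iter \<sigma> n (\<lambda>_. 1) x"
    by (simp only: L_iter_cmult)
qed

lemma ratio_inf_tendsto:
  assumes \<sigma>: "\<sigma> \<in> \<S>" and \<phi>: "ess_bounded \<phi>"
  shows "(\<lambda>n. ratio_inf \<sigma> n \<phi>) \<longlonglongrightarrow> Lambda \<sigma> \<phi>"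
proof -
  obtain B where B: "AE x in unit_leb. \<bar>\<phi> x\<bar> \<le> B" using \<phi> by (auto simp: ess_bounded_def)
  have "AE x in unit_leb. \<phi> x \<le> B" using B by (rule eventually_mono) auto
  then have "ratio_inf \<sigma> n \<phi> \<le> B" for n by (rule ratio_inf_le_const[OF assms])
  then obtain l where "(\<lambda>n. ratio_inf \<sigma> n \<phi>) \<longlonglongrightarrow> l"
    using incseq_convergent[OF incseq_ratio_inf[OF assms]] by blast
  then show ?thesis unfolding Lambda_eq_lim by (simp add: limI)
qed

lemma ratio_inf_le_Lambda:
  assumes "\<sigma> \<in> \<S>" "ess_bounded \<phi>"
  shows "ratio_inf \<sigma> n \<phi> \<le> Lambda \<sigma> \<phi>"
  using incseq_le[OF incseq_ratio_inf[OF assms] ratio_inf_tendsto[OF assms]] .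

lemma le_LambdaI:
  assumes "\<sigma> \<in> \<S>" "ess_bounded \<phi>" "AE x in unit_leb. c * L_iter \<sigma> n (\<lambda>_. 1) x \<le> L_iter \<sigma> n \<phi> x"
  shows "c \<le> Lambda \<sigma> \<phi>"
  using le_ratio_inf_iff[OF assms(1,2), of c n] ratio_inf_le_Lambda[OF assms(1,2), of n] assms(3) by linarith

lemma const_le_Lambda:
  assumes "\<sigma> \<in> \<S>" "ess_bounded \<phi>" "AE x in unit_leb. c \<le> \<phi> x"
  shows "c \<le> Lambda \<sigma> \<phi>"
  by (rule le_LambdaI[where n = 0]) (use assms in auto)

lemma Lambda_le_const:
  assumes "\<sigma> \<in> \<S>" "ess_bounded \<phi>" "AE x in unit_leb. \<phi> x \<le> c"
  shows "Lambda \<sigma> \<phi> \<le> c"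
  by (rule LIMSEQ_le_const2[OF ratio_inf_tendsto[OF assms(1,2)]]) (use ratio_inf_le_const[OF assms] in auto)

lemma Lambda_nonneg:
  "\<sigma> \<in> \<S> \<Longrightarrow> ess_bounded \<phi> \<Longrightarrow> AE x in unit_leb. 0 \<le> \<phi> x \<Longrightarrow> 0 \<le> Lambda \<sigma> \<phi>"
  by (rule const_le_Lambda)

lemma Lambda_one: "\<sigma> \<in> \<S> \<Longrightarrow> Lambda \<sigma> (\<lambda>_. 1) = 1"
  by (intro antisym Lambda_le_const const_le_Lambda ess_bounded_const) auto

lemma Lambda_mono:
  assumes \<sigma>: "\<sigma> \<in> \<S>" and b: "ess_bounded \<phi>" "ess_bounded \<psi>" and le: "AE x in unit_leb. \<phi> x \<le> \<psi> x"
  shows "Lambda \<sigma> \<phi> \<le> Lambda \<sigma> \<psi>"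
proof (rule LIMSEQ_le_const2[OF ratio_inf_tendsto[OF \<sigma> b(1)]], intro exI allI impI)
  fix n
  show "ratio_inf \<sigma> n \<phi> \<le> Lambda \<sigma> \<psi>"
  proof (rule le_LambdaI[OF \<sigma> b(2)])
    show "AE x in unit_leb. ratio_inf \<sigma> n \<phi> * L_iter \<sigma> n (\<lambda>_. 1) x \<le> L_iter \<sigma> n \<psi> x"
      using AE_ratio_inf[OF \<sigma> b(1), of n] AE_L_iter_mono[OF \<sigma> le, of n] by eventually_elim linarith
  qed
qed

text \<open>Infima are superadditive and the inequality passes to the limit. The arguments below are
  arranged so that additivity in this direction suffices.\<close>

lemma Lambda_superadditive:
  assumes \<sigma>: "\<sigma> \<in> \<S>" and b: "ess_bounded \<phi>" "ess_bounded \<psi>"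
  shows "Lambda \<sigma> \<phi> + Lambda \<sigma> \<psi> \<le> Lambda \<sigma> (\<lambda>x. \<phi> x + \<psi> x)"
proof (rule LIMSEQ_le_const2[OF tendsto_add[OF ratio_inf_tendsto[OF \<sigma> b(1)] ratio_inf_tendsto[OF \<sigma> b(2)]]],
    intro exI allI impI)
  fix n
  show "ratio_inf \<sigma> n \<phi> + ratio_inf \<sigma> n \<psi> \<le> Lambda \<sigma> (\<lambda>x. \<phi> x + \<psi> x)"
  proof (rule le_LambdaI[OF \<sigma> ess_bounded_add[OF b]])
    show "AE x in unit_leb. (ratio_inf \<sigma> n \<phi> + ratio_inf \<sigma> n \<psi>) * L_iter \<sigma> n (\<lambda>_. 1) x
        \<le> L_iter \<sigma> n (\<lambda>x. \<phi> x + \<psi> x) x"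
      using AE_ratio_inf[OF \<sigma> b(1), of n] AE_ratio_inf[OF \<sigma> b(2), of n]
      by eventually_elim (simp add: L_iter_add_fun algebra_simps)
  qed
qed

lemma Lambda_cmult_ge:
  assumes \<sigma>: "\<sigma> \<in> \<S>" and b: "ess_bounded \<phi>" and c: "0 \<le> c"
  shows "c * Lambda \<sigma> \<phi> \<le> Lambda \<sigma> (\<lambda>x. c * \<phi> x)"
proof (rule LIMSEQ_le_const2[OF tendsto_mult_left[OF ratio_inf_tendsto[OF \<sigma> b]]], intro exI allI impI)
  fix n
  show "c * ratio_inf \<sigma> n \<phi> \<le> Lambda \<sigma> (\<lambda>x. c * \<phi> x)"
  proof (rule le_LambdaI[OF \<sigma> ess_bounded_cmult[OF b]])
    show "AE x in unit_leb. c * ratio_inf \<sigma> n \<phi> * L_iter \<sigma> n (\<lambda>_. 1) x \<le> L_iter \<sigma> n (\<lambda>x. c * \<phi> x) x"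
      using AE_ratio_inf[OF \<sigma> b, of n]
      by eventually_elim (use c in \<open>simp add: L_iter_cmult mult.assoc mult_left_mono\<close>)
  qed
qed

lemma Lambda_sum_ge:
  assumes \<sigma>: "\<sigma> \<in> \<S>" and "\<And>i. i \<in> I \<Longrightarrow> ess_bounded (\<phi> i)"
  shows "(\<Sum>i\<in>I. Lambda \<sigma> (\<phi> i)) \<le> Lambda \<sigma> (\<lambda>x. \<Sum>i\<in>I. \<phi> i x)"
  using assms(2)
proof (induction I rule: infinite_finite_induct)
  case (insert i I)
  then show ?case
    using Lambda_superadditive[OF \<sigma>, of "\<phi> i" "\<lambda>x. \<Sum>i\<in>I. \<phi> i x"] ess_bounded_sum[of I \<phi>] by simp
qed (use Lambda_nonneg[OF \<sigma> ess_bounded_const, of 0] in auto)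

text \<open>With q and r the two infima, L^k (L \<phi>) = L^(k+1) \<phi> >= q L^(k+1) 1 = q L^k (L
  1) >= q r L^k 1; then k tends to infinity. The last inequality uses q >= 0, which comes from
  \<phi> >= 0.\<close>

lemma rho_at_Lambda_le:
  assumes \<sigma>: "\<sigma> \<in> \<S>" and b: "ess_bounded \<phi>" and nn: "AE x in unit_leb. 0 \<le> \<phi> x"
  shows "rho_at \<sigma> * Lambda \<sigma> \<phi> \<le> Lambda (shift_by 1 \<sigma>) (open_transfer (\<sigma> 0) \<phi>)"
proof -
  let ?\<tau> = "shift_by 1 \<sigma>"
  have \<tau>: "?\<tau> \<in> \<S>" using \<sigma> by (rule shift_by_in_symbol_seqs)
  have s: "\<sigma> 0 \<in> TT \<times> HH" using \<sigma> by (rule symbol_seqs_in)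
  have b1: "ess_bounded (open_transfer (\<sigma> 0) (\<lambda>_. 1))" "ess_bounded (open_transfer (\<sigma> 0) \<phi>)"
    using s b by (auto intro!: ess_bounded_open_transfer ess_bounded_const)
  have L: "L_iter ?\<tau> k (open_transfer (\<sigma> 0) \<psi>) = L_iter \<sigma> (Suc k) \<psi>" for k \<psi>
    using L_iter_add[of \<sigma> 1 k \<psi>] by simp
  have "(\<lambda>k. ratio_inf ?\<tau> k (open_transfer (\<sigma> 0) (\<lambda>_. 1))) \<longlonglongrightarrow> rho_at \<sigma>"
    using ratio_inf_tendsto[OF \<tau> b1(1)] by (simp add: rho_at_def shift_eq_shift_by)
  moreover have "(\<lambda>k. ratio_inf \<sigma> (Suc k) \<phi>) \<longlonglongrightarrow> Lambda \<sigma> \<phi>"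
    using ratio_inf_tendsto[OF \<sigma> b] by (rule LIMSEQ_Suc)
  ultimately have "(\<lambda>k. ratio_inf ?\<tau> k (open_transfer (\<sigma> 0) (\<lambda>_. 1)) * ratio_inf \<sigma> (Suc k) \<phi>) \<longlonglongrightarrow> rho_at \<sigma> * Lambda \<sigma> \<phi>"
    by (rule tendsto_mult)
  then show ?thesis
  proof (rule LIMSEQ_le_const2, intro exI allI impI)
    fix k
    let ?r = "ratio_inf ?\<tau> k (open_transfer (\<sigma> 0) (\<lambda>_. 1))" and ?q = "ratio_inf \<sigma> (Suc k) \<phi>"
    have q: "0 \<le> ?q" unfolding le_ratio_inf_iff[OF \<sigma> b] using AE_L_iter_nonneg[OF \<sigma> nn, of "Suc k"] by simp
    show "?r * ?q \<le> Lambda ?\<tau> (open_transfer (\<sigma> 0) \<phi>)"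
    proof (rule le_LambdaI[OF \<tau> b1(2)])
      show "AE x in unit_leb. ?r * ?q * L_iter ?\<tau> k (\<lambda>_. 1) x \<le> L_iter ?\<tau> k (open_transfer (\<sigma> 0) \<phi>) x"
        using AE_ratio_inf[OF \<tau> b1(1), of k] AE_ratio_inf[OF \<sigma> b, of "Suc k"] unfolding L
      proof eventually_elim
        case (elim x)
        have "?q * (?r * L_iter ?\<tau> k (\<lambda>_. 1) x) \<le> ?q * L_iter \<sigma> (Suc k) (\<lambda>_. 1) x"
          using elim(1) q by (rule mult_left_mono)
        then show ?case using elim(2) by (simp only: mult_ac)
      qed
    qed
  qed
qed

lemma rho_le_rho_at:
  assumes "\<sigma> \<in> \<S>"
  shows "\<rho> \<le> rho_at \<sigma>"
  unfolding rho_def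
proof (rule cINF_lower[OF _ assms])
  have "0 \<le> rho_at \<sigma>" if "\<sigma> \<in> \<S>" for \<sigma>
    unfolding rho_at_def shift_eq_shift_by
  proof (rule Lambda_nonneg)
    show "shift_by 1 \<sigma> \<in> \<S>" using that by (rule shift_by_in_symbol_seqs)
    show "ess_bounded (open_transfer (\<sigma> 0) (\<lambda>_. 1))"
      using symbol_seqs_in[OF that] by (intro ess_bounded_open_transfer ess_bounded_const) auto
    show "AE x in unit_leb. 0 \<le> open_transfer (\<sigma> 0) (\<lambda>_. 1) x"
      using AE_L_iter_nonneg[OF that, of "\<lambda>_. 1" "Suc 0"] by simp
  qed
  then show "bdd_below (rho_at ` \<S>)" by (intro bdd_belowI2[where m = 0])
qed

lemma Lambda_L_iter_ge:
  assumes \<sigma>: "\<sigma> \<in> \<S>" and b: "ess_bounded \<phi>" and nn: "AE x in unit_leb. 0 \<le> \<phi> x"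
  shows "\<rho> ^ n * Lambda \<sigma> \<phi> \<le> Lambda (shift_by n \<sigma>) (L_iter \<sigma> n \<phi>)"
proof (induction n)
  case (Suc n)
  let ?\<tau> = "shift_by n \<sigma>" and ?\<psi> = "L_iter \<sigma> n \<phi>"
  have \<tau>: "?\<tau> \<in> \<S>" using \<sigma> by (rule shift_by_in_symbol_seqs)
  have b': "ess_bounded ?\<psi>" using \<sigma> b by (rule ess_bounded_L_iter)
  have nn': "AE x in unit_leb. 0 \<le> ?\<psi> x" using \<sigma> nn by (rule AE_L_iter_nonneg)
  have "\<rho> ^ Suc n * Lambda \<sigma> \<phi> \<le> \<rho> * Lambda ?\<tau> ?\<psi>"
    using Suc.IH rho_pos by (simp add: mult.assoc mult_left_mono)
  also have "\<dots> \<le> rho_at ?\<tau> * Lambda ?\<tau> ?\<psi>"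
    using rho_le_rho_at[OF \<tau>] Lambda_nonneg[OF \<tau> b' nn'] by (rule mult_right_mono)
  also have "\<dots> \<le> Lambda (shift_by 1 ?\<tau>) (open_transfer (?\<tau> 0) ?\<psi>)"
    using \<tau> b' nn' by (rule rho_at_Lambda_le)
  also have "\<dots> = Lambda (shift_by (Suc n) \<sigma>) (L_iter \<sigma> (Suc n) \<phi>)"
    by (simp add: shift_by_shift_by) (simp add: shift_by_def)
  finally show ?case .
qed simp

text \<open>After k further steps the error is t L^k 1. This is at most t L^(n+k) 1 divided by the
  infimum of L^k (L^n 1) / L^k 1, and that infimum tends to \<open>Lambda\<close> of L^n 1, which is
  at least \<rho>^n.\<close>

lemma Lambda_leI:
  assumes \<sigma>: "\<sigma> \<in> \<S>" and b: "ess_bounded \<phi>" and t: "0 \<le> t"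
    and le: "AE x in unit_leb. L_iter \<sigma> n \<phi> x \<le> q * L_iter \<sigma> n (\<lambda>_. 1) x + t"
  shows "Lambda \<sigma> \<phi> \<le> q + t / \<rho> ^ n"
proof -
  let ?\<tau> = "shift_by n \<sigma>" and ?one = "L_iter \<sigma> n (\<lambda>_. 1)"
  have \<tau>: "?\<tau> \<in> \<S>" using \<sigma> by (rule shift_by_in_symbol_seqs)
  have b1: "ess_bounded ?one" using \<sigma> ess_bounded_const by (rule ess_bounded_L_iter)
  define l where "l = Lambda ?\<tau> ?one"
  have l: "\<rho> ^ n \<le> l" using Lambda_L_iter_ge[OF \<sigma> ess_bounded_const, of 1 n] Lambda_one[OF \<sigma>] by (simp add: l_def)
  have rn: "0 < \<rho> ^ n" using rho_pos by simp
  have r: "(\<lambda>k. ratio_inf ?\<tau> k ?one) \<longlonglongrightarrow> l" unfolding l_def using \<tau> b1 by (rule ratio_inf_tendsto)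
  have "Lambda \<sigma> \<phi> \<le> q + t / l"
  proof (rule LIMSEQ_le)
    show "(\<lambda>k. ratio_inf \<sigma> (k + n) \<phi>) \<longlonglongrightarrow> Lambda \<sigma> \<phi>"
      using ratio_inf_tendsto[OF \<sigma> b] by (rule LIMSEQ_ignore_initial_segment)
    show "(\<lambda>k. q + t / ratio_inf ?\<tau> k ?one) \<longlonglongrightarrow> q + t / l"
      using l rn by (intro tendsto_intros r) auto
    have "eventually (\<lambda>k. 0 < ratio_inf ?\<tau> k ?one) sequentially"
      using r by (rule order_tendstoD) (use l rn in linarith)
    then obtain k0 where k0: "\<And>k. k \<ge> k0 \<Longrightarrow> 0 < ratio_inf ?\<tau> k ?one" unfolding eventually_sequentially by blast
    show "\<exists>N. \<forall>k\<ge>N. ratio_inf \<sigma> (k + n) \<phi> \<le> q + t / ratio_inf ?\<tau> k ?one"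
    proof (intro exI allI impI)
      fix k assume "k \<ge> k0"
      let ?r = "ratio_inf ?\<tau> k ?one"
      have r0: "0 < ?r" using k0 \<open>k \<ge> k0\<close> .
      show "ratio_inf \<sigma> (k + n) \<phi> \<le> q + t / ?r"
      proof (rule ratio_inf_leI[OF \<sigma> b])
        have le': "AE x in unit_leb. L_iter \<sigma> n \<phi> x \<le> q * ?one x + t * 1" using le by simp
        have L: "L_iter \<sigma> (k + n) \<psi> = L_iter ?\<tau> k (L_iter \<sigma> n \<psi>)" for \<psi>
          using L_iter_add[of \<sigma> n k \<psi>] by (simp add: add.commute)
        show "AE x in unit_leb. L_iter \<sigma> (k + n) \<phi> x \<le> (q + t / ?r) * L_iter \<sigma> (k + n) (\<lambda>_. 1) x"
          using AE_L_iter_mono[OF \<tau> le', of k] AE_ratio_inf[OF \<tau> b1, of k] unfolding L L_iter_linear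
        proof eventually_elim
          case (elim x)
          have "t * L_iter ?\<tau> k (\<lambda>_. 1) x = t / ?r * (?r * L_iter ?\<tau> k (\<lambda>_. 1) x)" using r0 by simp
          also have "\<dots> \<le> t / ?r * L_iter ?\<tau> k ?one x" using elim(2) t r0 by (intro mult_left_mono) auto
          finally show ?case using elim(1) by (simp add: algebra_simps)
        qed
      qed
    qed
  qed
  also have "\<dots> \<le> q + t / \<rho> ^ n" using l rn t by (simp add: divide_left_mono)
  finally show ?thesis .
qed

end

section \<open>The partitions of an open product\<close>

lemma finite_frontier_interval:
  fixes S :: "real set"
  assumes "is_interval S" "bounded S"
  shows "finite (frontier S)"
proof (cases "S = {}")
  case False
  have bdd: "bdd_above S" "bdd_below S" using assms(2) by (auto simp: bounded_imp_bdd_above bounded_imp_bdd_below)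
  have "frontier S \<subseteq> {Inf S, Sup S}"
  proof
    fix p assume p: "p \<in> frontier S"
    have "S \<subseteq> {Inf S..Sup S}" using bdd by (auto intro: cInf_lower cSup_upper)
    then have "closure S \<subseteq> {Inf S..Sup S}" by (simp add: closure_minimal)
    then have pc: "Inf S \<le> p" "p \<le> Sup S" using p by (auto simp: frontier_def)
    show "p \<in> {Inf S, Sup S}"
    proof (rule ccontr)
      assume "\<not> ?thesis"
      then have "Inf S < p" "p < Sup S" using pc by auto
      then obtain a b where ab: "a \<in> S" "a < p" "b \<in> S" "p < b"
        using cInf_less_iff[OF False bdd(2)] less_cSup_iff[OF False bdd(1)] by blast
      have "{a<..<b} \<subseteq> S"
      proof
        fix z assume "z \<in> {a<..<b}"
        then show "z \<in> S" using assms(1) ab mem_is_interval_1_I[of S a b z] by auto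
      qed
      then have "p \<in> interior S" using ab by (intro interiorI[of "{a<..<b}"]) auto
      then show False using p by (simp add: frontier_def)
    qed
  qed
  then show ?thesis by (rule finite_subset) simp
qed simp

text \<open>In this form the condition can be pulled back along continuous iterates and combined
  over finitely many times, which locates the frontier of \<open>H_iter\<close>.\<close>

lemma notin_frontier_iff: "x \<notin> frontier S \<longleftrightarrow> (\<forall>\<^sub>F y in nhds x. y \<in> S \<longleftrightarrow> x \<in> S)"
proof
  assume "x \<notin> frontier S"
  then consider "x \<in> interior S" | "x \<in> interior (- S)" 
    unfolding frontier_def interior_complement by blast
  then show "\<forall>\<^sub>F y in nhds x. y \<in> S \<longleftrightarrow> x \<in> S"
  proof cases
    case 1
    then show ?thesis unfolding eventually_nhds
      using interior_subset[of S] by (intro exI[of _ "interior S"]) auto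
  next
    case 2
    then show ?thesis unfolding eventually_nhds
      using interior_subset[of "- S"] by (intro exI[of _ "interior (- S)"]) auto
  qed
next
  assume "\<forall>\<^sub>F y in nhds x. y \<in> S \<longleftrightarrow> x \<in> S"
  then obtain U where U: "open U" "x \<in> U" "\<And>y. y \<in> U \<Longrightarrow> y \<in> S \<longleftrightarrow> x \<in> S"
    unfolding eventually_nhds by blast
  show "x \<notin> frontier S"
  proof (cases "x \<in> S")
    case True
    then have "U \<subseteq> S" using U(3) by blast
    then have "x \<in> interior S" using U(1,2) interiorI by blast
    then show ?thesis by (simp add: frontier_def)
  next
    case False
    then have "U \<inter> S = {}" using U(3) by blast
    then have "U \<inter> closure S = {}" using U(1) open_Int_closure_eq_empty by blast
    then show ?thesis using U(2) by (auto simp: frontier_def)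
  qed
qed

text \<open>The union of the elements of \<open>smooth_partition\<close>.\<close>

definition smooth_dom :: "(nat \<Rightarrow> symb) \<Rightarrow> nat \<Rightarrow> real set"
  where "smooth_dom \<sigma> n = {x \<in> {0<..<1}. \<forall>j<n. T_iter \<sigma> j x \<in> smooth_set (fst (\<sigma> j))}"

lemma smooth_dom_Suc:
  "smooth_dom \<sigma> (Suc n) = {x \<in> smooth_dom \<sigma> n. T_iter \<sigma> n x \<in> smooth_set (fst (\<sigma> n))}"
  by (auto simp: smooth_dom_def less_Suc_eq)

lemma smooth_dom_subset: "smooth_dom \<sigma> n \<subseteq> {0<..<1}"
  by (auto simp: smooth_dom_def)

lemma smooth_dom_antimono: "m \<le> n \<Longrightarrow> smooth_dom \<sigma> n \<subseteq> smooth_dom \<sigma> m"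
  by (auto simp: smooth_dom_def)

lemma H_iter_subset: "H_iter \<sigma> n \<subseteq> {0..1}"
  by (auto simp: H_iter_def)

lemma H_iter_Suc: "H_iter \<sigma> (Suc n) = {x \<in> H_iter \<sigma> n. T_iter \<sigma> n x \<in> snd (\<sigma> n)}"
  by (auto simp: H_iter_def less_Suc_eq)

lemma pushforward_eq_sum:
  assumes "inj_on T Z"
  shows "pushforward T Z h y = (\<Sum>x | x \<in> Z \<and> T x = y. h x)"
proof (cases "y \<in> T ` Z")
  case True
  then obtain x where x: "x \<in> Z" "y = T x" by blast
  have "{z. z \<in> Z \<and> T z = y} = {x}" using x assms by (auto dest: inj_onD)
  then have "(\<Sum>x | x \<in> Z \<and> T x = y. h x) = h x" by (simp only: sum.insert sum.empty) simp
  moreover have "the_inv_into Z T y = x" unfolding x(2) using assms x(1) by (rule the_inv_into_f_f)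
  ultimately show ?thesis using True by (simp add: pushforward_def)
next
  case False
  then have "{x. x \<in> Z \<and> T x = y} = {}" by auto
  then show ?thesis using False unfolding pushforward_def by (simp only: sum.empty if_False)
qed

lemma pushforward_add:
  "pushforward T Z (\<lambda>x. f x + g x) y = pushforward T Z f y + pushforward T Z g y"
  by (simp add: pushforward_def)

lemma pushforward_mono:
  assumes "inj_on T Z" "\<And>x. x \<in> Z \<Longrightarrow> f x \<le> g x"
  shows "pushforward T Z f y \<le> pushforward T Z g y"
  unfolding pushforward_eq_sum[OF assms(1)] by (rule sum_mono) (use assms(2) in auto)

lemma pushforward_le:
  assumes "inj_on T Z" "\<And>x. x \<in> Z \<Longrightarrow> f x \<le> M" "0 \<le> M"
  shows "pushforward T Z f y \<le> M"
proof (cases "y \<in> T ` Z")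
  case True
  then have "the_inv_into Z T y \<in> Z" using assms(1) by (auto simp: the_inv_into_f_f)
  then show ?thesis using assms(2) True by (simp add: pushforward_def)
qed (simp add: pushforward_def assms(3))

context open_system
begin

lemma expanding_map_at: "\<sigma> \<in> \<S> \<Longrightarrow> expanding_map (fst (\<sigma> k)) lam"
  using symbol_seqs_in[of \<sigma> TT HH k] by (auto intro: expanding)

lemma T_iter_in: "\<sigma> \<in> \<S> \<Longrightarrow> x \<in> {0..1} \<Longrightarrow> T_iter \<sigma> n x \<in> {0..1}"
proof (induction n)
  case (Suc n)
  then show ?case using expanding_map.maps[OF expanding_map_at[OF Suc.prems(1), of n]] by (auto simp: Pi_iff)
qed simp

lemma finite_smooth_dom_fibre:
  assumes \<sigma>: "\<sigma> \<in> \<S>"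
  shows "finite {x \<in> smooth_dom \<sigma> n. T_iter \<sigma> n x = y}"
proof (induction n arbitrary: y)
  case (Suc n)
  have "{x \<in> smooth_dom \<sigma> (Suc n). T_iter \<sigma> (Suc n) x = y}
      = (\<Union>z\<in>{z \<in> smooth_set (fst (\<sigma> n)). fst (\<sigma> n) z = y}. {x \<in> smooth_dom \<sigma> n. T_iter \<sigma> n x = z})"
    by (auto simp: smooth_dom_Suc)
  then show ?case using Suc.IH expanding_map.finite_fibre[OF expanding_map_at[OF \<sigma>, of n], of y] by auto
qed simp

text \<open>Apart from the endpoints, a point is lost only when its orbit hits a break point of some
  factor, and fibres of the iterates are finite.\<close>

lemma finite_compl_smooth_dom:
  assumes \<sigma>: "\<sigma> \<in> \<S>"
  shows "finite ({0..1} - smooth_dom \<sigma> n)"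
proof (induction n)
  case 0
  have "{0..1} - smooth_dom \<sigma> 0 \<subseteq> {0, 1}" by (auto simp: smooth_dom_def)
  then show ?case by (rule finite_subset) simp
next
  case (Suc n)
  have "{0..1} - smooth_dom \<sigma> (Suc n) \<subseteq> ({0..1} - smooth_dom \<sigma> n) \<union>
      (\<Union>p\<in>{0..1} - smooth_set (fst (\<sigma> n)). {x \<in> smooth_dom \<sigma> n. T_iter \<sigma> n x = p})"
    using T_iter_in[OF \<sigma>] by (auto simp: smooth_dom_Suc)
  moreover have "finite \<dots>"
    using Suc.IH finite_smooth_dom_fibre[OF \<sigma>] expanding_map.finite_nonsmooth[OF expanding_map_at[OF \<sigma>, of n]]
    by auto
  ultimately show ?case by (rule finite_subset)
qed

lemma isCont_T_iter:
  assumes \<sigma>: "\<sigma> \<in> \<S>"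
  shows "x \<in> smooth_dom \<sigma> n \<Longrightarrow> isCont (T_iter \<sigma> n) x"
proof (induction n)
  case (Suc n)
  then have x: "x \<in> smooth_dom \<sigma> n" "T_iter \<sigma> n x \<in> smooth_set (fst (\<sigma> n))" by (auto simp: smooth_dom_Suc)
  have "isCont (fst (\<sigma> n)) (T_iter \<sigma> n x)"
    using expanding_map.smooth_deriv(1)[OF expanding_map_at[OF \<sigma>] x(2)] by (rule DERIV_isCont)
  then show ?case unfolding T_iter.simps by (rule continuous_at_compose[OF Suc.IH[OF x(1)]])
qed simp

lemma inj_on_T_iter:
  assumes \<sigma>: "\<sigma> \<in> \<S>" and Z: "is_interval Z"
  shows "Z \<subseteq> smooth_dom \<sigma> n \<Longrightarrow> inj_on (T_iter \<sigma> n) Z"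
proof (induction n)
  case (Suc n)
  then have sub: "Z \<subseteq> smooth_dom \<sigma> n" "T_iter \<sigma> n ` Z \<subseteq> smooth_set (fst (\<sigma> n))"
    by (auto simp: smooth_dom_Suc)
  have "continuous_on Z (T_iter \<sigma> n)"
    using isCont_T_iter[OF \<sigma>] sub(1) by (auto intro!: continuous_at_imp_continuous_on)
  then have "is_interval (T_iter \<sigma> n ` Z)"
    using Z by (metis connected_continuous_image is_interval_connected_1)
  then have "inj_on (fst (\<sigma> n)) (T_iter \<sigma> n ` Z)"
    using sub(2) by (rule expanding_map.inj_on_smooth_interval[OF expanding_map_at[OF \<sigma>]])
  with Suc.IH[OF sub(1)] show ?case unfolding T_iter.simps by (rule comp_inj_on)
qed simp

text \<open>The explicit formula behind the variation estimates. The endpoints are excluded because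
  for n = 0 the sum runs over the open unit interval.\<close>

lemma L_iter_eq_sum:
  assumes \<sigma>: "\<sigma> \<in> \<S>"
  shows "y \<in> {0<..<1} \<Longrightarrow> L_iter \<sigma> n \<phi> y =
    (\<Sum>x | x \<in> smooth_dom \<sigma> n \<inter> H_iter \<sigma> n \<and> T_iter \<sigma> n x = y. \<phi> x * g_iter \<sigma> n x)"
proof (induction n arbitrary: y)
  case 0
  then have "{x. x \<in> smooth_dom \<sigma> 0 \<inter> H_iter \<sigma> 0 \<and> T_iter \<sigma> 0 x = y} = {y}"
    by (auto simp: smooth_dom_def H_iter_def)
  then show ?case by (simp only: sum.insert sum.empty) (simp add: g_iter_def)
next
  case (Suc n)
  interpret expanding_map "fst (\<sigma> n)" lam using \<sigma> by (rule expanding_map_at)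
  let ?T = "fst (\<sigma> n)" and ?H = "snd (\<sigma> n)"
  let ?A = "{z \<in> smooth_set ?T. ?T z = y}"
  let ?B = "\<lambda>z. {x. x \<in> smooth_dom \<sigma> n \<inter> H_iter \<sigma> n \<and> T_iter \<sigma> n x = z}"
  let ?S = "{x. x \<in> smooth_dom \<sigma> (Suc n) \<inter> H_iter \<sigma> (Suc n) \<and> T_iter \<sigma> (Suc n) x = y}"
  have fB: "finite (?B z)" for z
    using finite_smooth_dom_fibre[OF \<sigma>, of n z] by (rule rev_finite_subset) auto
  have "L_iter \<sigma> (Suc n) \<phi> y = (\<Sum>z\<in>?A. L_iter \<sigma> n \<phi> z * indicator ?H z / \<bar>deriv ?T z\<bar>)"
    by (simp add: open_transfer_def transfer_def)
  also have "\<dots> = (\<Sum>z\<in>?A. \<Sum>x\<in>?B z. \<phi> x * g_iter \<sigma> (Suc n) x)"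
  proof (rule sum.cong[OF refl])
    fix z assume "z \<in> ?A"
    then have z: "z \<in> {0<..<1}" using smooth_subset by auto
    have "L_iter \<sigma> n \<phi> z * indicator ?H z / \<bar>deriv ?T z\<bar>
        = (\<Sum>x\<in>?B z. \<phi> x * g_iter \<sigma> n x) * (indicator ?H z / \<bar>deriv ?T z\<bar>)"
      using Suc.IH[OF z] by simp
    also have "\<dots> = (\<Sum>x\<in>?B z. \<phi> x * g_iter \<sigma> (Suc n) x)"
      unfolding sum_distrib_right by (rule sum.cong) (auto simp: g_iter_def weight_def)
    finally show "L_iter \<sigma> n \<phi> z * indicator ?H z / \<bar>deriv ?T z\<bar> = (\<Sum>x\<in>?B z. \<phi> x * g_iter \<sigma> (Suc n) x)" .
  qed
  also have "\<dots> = (\<Sum>x\<in>(\<Union>z\<in>?A. ?B z). \<phi> x * g_iter \<sigma> (Suc n) x)"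
    by (rule sum.UNION_disjoint[symmetric]) (use finite_fibre fB in auto)
  \<comment> \<open>Preimages whose last point misses the hole may be dropped, since
    \<open>weight\<close> vanishes there.\<close>
  also have "\<dots> = (\<Sum>x\<in>?S. \<phi> x * g_iter \<sigma> (Suc n) x)"
  proof (rule sum.mono_neutral_right)
    show "finite (\<Union>z\<in>?A. ?B z)" using finite_fibre[of y] fB by blast
    show "?S \<subseteq> (\<Union>z\<in>?A. ?B z)" by (auto simp: smooth_dom_Suc H_iter_Suc)
    show "\<forall>x\<in>(\<Union>z\<in>?A. ?B z) - ?S. \<phi> x * g_iter \<sigma> (Suc n) x = 0"
    proof
      fix x assume x: "x \<in> (\<Union>z\<in>?A. ?B z) - ?S"
      then have "T_iter \<sigma> n x \<notin> ?H" by (auto simp: smooth_dom_Suc H_iter_Suc)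
      then have "weight (\<sigma> n) (T_iter \<sigma> n x) = 0" by (simp add: weight_def)
      then show "\<phi> x * g_iter \<sigma> (Suc n) x = 0" by (simp add: g_iter_def)
    qed
  qed
  finally show ?case .
qed

lemma g_iter_bounds:
  assumes \<sigma>: "\<sigma> \<in> \<S>" and x: "x \<in> smooth_dom \<sigma> n"
  shows "0 \<le> g_iter \<sigma> n x" "g_iter \<sigma> n x \<le> \<Theta> ^ n"
proof -
  have w: "0 \<le> weight (\<sigma> k) (T_iter \<sigma> k x)" for k by (simp add: weight_def)
  show "0 \<le> g_iter \<sigma> n x" unfolding g_iter_def by (rule prod_nonneg) (use w in auto)
  have "weight (\<sigma> k) (T_iter \<sigma> k x) \<le> \<Theta>" if "k < n" for k
  proof -
    have "T_iter \<sigma> k x \<in> smooth_set (fst (\<sigma> k))" "fst (\<sigma> k) \<in> TT"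
      using x that symbol_seqs_in[OF \<sigma>, of k] by (auto simp: smooth_dom_def)
    then have "1 / \<bar>deriv (fst (\<sigma> k)) (T_iter \<sigma> k x)\<bar> \<le> \<Theta>" by (rule inverse_deriv_le[rotated])
    then show ?thesis using Theta_pos by (auto simp: weight_def indicator_def)
  qed
  then have "g_iter \<sigma> n x \<le> (\<Prod>k<n. \<Theta>)"
    unfolding g_iter_def by (intro prod_mono) (use w in auto)
  then show "g_iter \<sigma> n x \<le> \<Theta> ^ n" by simp
qed

text \<open>Where the orbit is smooth and avoids the frontiers of the holes, membership in
  \<open>H_iter\<close> is locally constant. The remaining points are finitely many, because
  intervals have finite frontiers and the fibres are finite.\<close>

lemma finite_frontier_H_iter:
  assumes \<sigma>: "\<sigma> \<in> \<S>"
  shows "finite (frontier (H_iter \<sigma> n))"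
proof -
  let ?H = "H_iter \<sigma> n"
  let ?E = "({0..1} - smooth_dom \<sigma> n) \<union> (\<Union>j<n. \<Union>p\<in>frontier (snd (\<sigma> j)). {x \<in> smooth_dom \<sigma> j. T_iter \<sigma> j x = p})"
  have "finite (frontier (snd (\<sigma> j)))" for j
  proof (rule finite_frontier_interval)
    have "snd (\<sigma> j) \<in> HH" using symbol_seqs_in[OF \<sigma>, of j] by auto
    then show "is_interval (snd (\<sigma> j))" "bounded (snd (\<sigma> j))"
      using hole_interval hole_subset bounded_subset[OF bounded_closed_interval] by blast+
  qed
  then have "finite ?E" using finite_compl_smooth_dom[OF \<sigma>] finite_smooth_dom_fibre[OF \<sigma>] by auto
  moreover have "frontier ?H \<subseteq> ?E"
  proof
    fix x assume x: "x \<in> frontier ?H"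
    show "x \<in> ?E"
    proof (rule ccontr)
      assume nE: "x \<notin> ?E"
      have "closure ?H \<subseteq> {0..1}" using H_iter_subset by (simp add: closure_minimal)
      then have "x \<in> {0..1}" using x by (auto simp: frontier_def)
      then have dom: "x \<in> smooth_dom \<sigma> n" using nE by auto
      have ev: "\<forall>\<^sub>F y in nhds x. T_iter \<sigma> j y \<in> snd (\<sigma> j) \<longleftrightarrow> T_iter \<sigma> j x \<in> snd (\<sigma> j)" if j: "j < n" for j
      proof -
        have dj: "x \<in> smooth_dom \<sigma> j" using dom smooth_dom_antimono[of j n] j by auto
        then have "T_iter \<sigma> j x \<notin> frontier (snd (\<sigma> j))" using nE j by auto
        then have "\<forall>\<^sub>F z in nhds (T_iter \<sigma> j x). z \<in> snd (\<sigma> j) \<longleftrightarrow> T_iter \<sigma> j x \<in> snd (\<sigma> j)"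
          by (simp add: notin_frontier_iff)
        moreover have "filterlim (T_iter \<sigma> j) (nhds (T_iter \<sigma> j x)) (nhds x)"
          using isCont_T_iter[OF \<sigma> dj] unfolding isCont_def tendsto_at_iff_tendsto_nhds .
        ultimately show ?thesis by (rule eventually_compose_filterlim)
      qed
      have x01: "x \<in> {0<..<1}" using dom smooth_dom_subset by blast
      then have "\<forall>\<^sub>F y in nhds x. y \<in> {0<..<1}" by (intro eventually_nhds_in_open) auto
      moreover have "\<forall>\<^sub>F y in nhds x. \<forall>j\<in>{..<n}. T_iter \<sigma> j y \<in> snd (\<sigma> j) \<longleftrightarrow> T_iter \<sigma> j x \<in> snd (\<sigma> j)"
        by (rule eventually_ball_finite) (use ev in auto)
      ultimately have "\<forall>\<^sub>F y in nhds x. y \<in> ?H \<longleftrightarrow> x \<in> ?H"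
      proof eventually_elim
        case (elim y)
        then show ?case using x01 by (auto simp: H_iter_def)
      qed
      then show False using x by (simp add: notin_frontier_iff[symmetric])
    qed
  qed
  ultimately show ?thesis by (rule rev_finite_subset)
qed

text \<open>The set whose components form \<open>hat_partition\<close>. It is (0,1) without finitely
  many points, so these components are finitely many open intervals.\<close>

definition regular_set :: "(nat \<Rightarrow> symb) \<Rightarrow> nat \<Rightarrow> real set"
  where "regular_set \<sigma> n = smooth_dom \<sigma> n - frontier (H_iter \<sigma> n)"

lemma hat_partition_eq: "hat_partition \<sigma> n = components (regular_set \<sigma> n)"
  by (simp only: hat_partition_def smooth_partition_def regular_set_def Union_components smooth_dom_def)

lemma finite_compl_regular_set:
  assumes \<sigma>: "\<sigma> \<in> \<S>"
  shows "finite ({0..1} - regular_set \<sigma> n)"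
proof -
  have "{0..1} - regular_set \<sigma> n \<subseteq> ({0..1} - smooth_dom \<sigma> n) \<union> frontier (H_iter \<sigma> n)"
    by (auto simp: regular_set_def)
  then show ?thesis
    using finite_compl_smooth_dom[OF \<sigma>] finite_frontier_H_iter[OF \<sigma>] by (meson finite_UnI finite_subset)
qed

lemma regular_set_eq:
  "regular_set \<sigma> n = {0<..<1} - ({0<..<1} - regular_set \<sigma> n)"
  using smooth_dom_subset[of \<sigma> n] by (auto simp: regular_set_def)

lemma finite_compl_regular_set':
  assumes \<sigma>: "\<sigma> \<in> \<S>"
  shows "finite ({0<..<1} - regular_set \<sigma> n)"
  by (rule finite_subset[OF _ finite_compl_regular_set[OF \<sigma>, of n]]) auto

lemma finite_Z_star: "\<sigma> \<in> \<S> \<Longrightarrow> finite (Z_star \<sigma> n)"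
  using finite_components_interval_diff(1)[OF finite_compl_regular_set', of \<sigma> n] regular_set_eq[of \<sigma> n]
  by (simp add: Z_star_def hat_partition_eq)

lemma Z_star_interval:
  assumes "\<sigma> \<in> \<S>" "Z \<in> Z_star \<sigma> n"
  shows "\<exists>a b. a < b \<and> Z = {a<..<b}"
  using finite_components_interval_diff(2)[OF finite_compl_regular_set'[OF assms(1), of n], of Z] regular_set_eq[of \<sigma> n] assms(2)
  by (auto simp: Z_star_def hat_partition_eq)

lemma Z_star_subset:
  assumes "Z \<in> Z_star \<sigma> n"
  shows "Z \<subseteq> regular_set \<sigma> n" "Z \<subseteq> smooth_dom \<sigma> n" "Z \<subseteq> H_iter \<sigma> n" "Z \<subseteq> {0..1}"
proof -
  show "Z \<subseteq> regular_set \<sigma> n" using assms in_components_subset by (auto simp: Z_star_def hat_partition_eq)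
  then show "Z \<subseteq> smooth_dom \<sigma> n" by (auto simp: regular_set_def)
  show "Z \<subseteq> H_iter \<sigma> n" using assms by (auto simp: Z_star_def)
  then show "Z \<subseteq> {0..1}" using H_iter_subset by blast
qed

lemma Z_star_disjoint: "Z \<in> Z_star \<sigma> n \<Longrightarrow> Z' \<in> Z_star \<sigma> n \<Longrightarrow> Z \<noteq> Z' \<Longrightarrow> Z \<inter> Z' = {}"
  using components_nonoverlap[of Z "regular_set \<sigma> n" Z'] by (auto simp: Z_star_def hat_partition_eq)

text \<open>A connected set that meets \<open>H_iter\<close> and avoids its frontier lies inside
  it.\<close>

lemma Z_star_cover:
  assumes "x \<in> regular_set \<sigma> n" "x \<in> H_iter \<sigma> n"
  shows "\<exists>Z\<in>Z_star \<sigma> n. x \<in> Z"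
proof -
  obtain Z where Z: "Z \<in> components (regular_set \<sigma> n)" "x \<in> Z"
    using assms(1) Union_components[of "regular_set \<sigma> n"] by blast
  have "Z \<subseteq> H_iter \<sigma> n"
  proof (rule ccontr)
    assume "\<not> ?thesis"
    then have "Z \<inter> frontier (H_iter \<sigma> n) \<noteq> {}"
      using Z assms(2) in_components_connected[OF Z(1)] by (intro connected_Int_frontier) auto
    then show False using in_components_subset[OF Z(1)] by (auto simp: regular_set_def)
  qed
  then show ?thesis using Z by (auto simp: Z_star_def hat_partition_eq)
qed

text \<open>Disjoint open intervals are ordered by their left endpoints. Lists are needed to speak
  of successive elements and of the increments between them.\<close>

lemma Z_star_list:
  assumes \<sigma>: "\<sigma> \<in> \<S>"
  shows "\<exists>Zs. set Zs = Z_star \<sigma> n \<and> distinct Zs \<and> sorted_wrt set_le Zs"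
proof -
  let ?A = "Z_star \<sigma> n"
  have fin: "finite ?A" using \<sigma> by (rule finite_Z_star)
  have order: "set_le Z Z'" if Z: "Z \<in> ?A" "Z' \<in> ?A" and le: "Inf Z < Inf Z'" for Z Z'
  proof -
    obtain a b where ab: "a < b" "Z = {a<..<b}" using Z_star_interval[OF \<sigma> Z(1)] by blast
    obtain a' b' where ab': "a' < b'" "Z' = {a'<..<b'}" using Z_star_interval[OF \<sigma> Z(2)] by blast
    have lt: "a < a'" using le ab ab' by simp
    have "b \<le> a'"
    proof (rule ccontr)
      assume "\<not> ?thesis"
      then have "(a' + min b b') / 2 \<in> Z \<inter> Z'" using ab ab' lt by (auto simp: min_def field_simps)
      moreover have "Z \<noteq> Z'" using le by auto
      ultimately show False using Z_star_disjoint[OF Z] by blast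
    qed
    then show ?thesis using ab ab' by (auto simp: set_le_def)
  qed
  have inj: "inj_on Inf ?A"
  proof (rule inj_onI, rule ccontr)
    fix Z Z' assume Z: "Z \<in> ?A" "Z' \<in> ?A" and eq: "Inf Z = Inf Z'" and ne: "Z \<noteq> Z'"
    obtain a b where ab: "a < b" "Z = {a<..<b}" using Z_star_interval[OF \<sigma> Z(1)] by blast
    obtain a' b' where ab': "a' < b'" "Z' = {a'<..<b'}" using Z_star_interval[OF \<sigma> Z(2)] by blast
    have "a = a'" using eq ab ab' by simp
    then have "(a' + min b b') / 2 \<in> Z \<inter> Z'" using ab ab' by (auto simp: min_def field_simps)
    then show False using Z_star_disjoint[OF Z ne] by blast
  qed
  let ?L = "sorted_list_of_set (Inf ` ?A)"
  let ?inv = "the_inv_into ?A Inf"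
  have L: "set ?L = Inf ` ?A" using fin by simp
  have inv: "?inv y \<in> ?A" "Inf (?inv y) = y" if "y \<in> set ?L" for y
    using that inj unfolding L by (auto simp: the_inv_into_f_f)
  have "set (map ?inv ?L) = ?A"
    unfolding set_map L using inj by (simp add: the_inv_into_onto image_comp[symmetric]) 
  moreover have "distinct (map ?inv ?L)"
    unfolding distinct_map using inj_on_the_inv_into[OF inj] L by simp
  moreover have "sorted_wrt set_le (map ?inv ?L)"
    unfolding sorted_wrt_map
  proof (rule sorted_wrt_mono_rel)
    show "sorted_wrt (<) ?L" by (rule strict_sorted_list_of_set)
    fix x y assume xy: "x \<in> set ?L" "y \<in> set ?L" "x < y"
    then show "set_le (?inv x) (?inv y)" using inv[OF xy(1)] inv[OF xy(2)] by (intro order) auto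
  qed
  ultimately show ?thesis by blast
qed

text \<open>No interior point of \<open>H_iter\<close> can lie in the gap between two successive
  elements: near it there would be a regular point of \<open>H_iter\<close>, and the element
  containing that point would come in between. A nonempty gap is therefore a component of the
  complement.\<close>

lemma consecutive_contiguous:
  assumes \<sigma>: "\<sigma> \<in> \<S>" and Zs: "set Zs = Z_star \<sigma> n" "sorted_wrt set_le Zs"
    and i: "Suc i < length Zs"
  shows "contiguous \<sigma> n (Zs ! i) (Zs ! Suc i)"
proof -
  let ?H = "H_iter \<sigma> n" and ?Z = "Zs ! i" and ?Z' = "Zs ! Suc i"
  have Z: "?Z \<in> Z_star \<sigma> n" "?Z' \<in> Z_star \<sigma> n" using i Zs(1) nth_mem by (metis Suc_lessD, metis)
  obtain a b where ab: "a < b" "?Z = {a<..<b}" using Z_star_interval[OF \<sigma> Z(1)] by blast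
  obtain a' b' where ab': "a' < b'" "?Z' = {a'<..<b'}" using Z_star_interval[OF \<sigma> Z(2)] by blast
  have le: "set_le (Zs ! j) (Zs ! k)" if "j < k" "k < length Zs" for j k
    using Zs(2) that by (simp add: sorted_wrt_iff_nth_less)
  have ba: "b \<le> a'"
  proof (rule ccontr)
    assume "\<not> ?thesis"
    define m where "m = max a a'"
    define M where "M = min b b'"
    have x: "a' < b" using \<open>\<not> b \<le> a'\<close> by simp
    obtain y where y: "max a a' < y" "y < b" using ab x by (metis dense max_less_iff_conj)
    obtain z where z: "a' < z" "z < min y b'" using ab' y by (metis dense max_less_iff_conj min_less_iff_conj)
    have "y \<in> ?Z" "z \<in> ?Z'" using ab ab' y z by auto
    then have "y \<le> z" using le[of i "Suc i"] i by (auto simp: set_le_def)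
    then show False using z by simp
  qed
  have S: "Sup ?Z = b" "Inf ?Z' = a'" using ab ab' by simp_all
  show ?thesis
  proof (cases "b = a'")
    case True
    then show ?thesis using S by (simp add: contiguous_def)
  next
    case False
    then have lt: "b < a'" using ba by simp
    let ?D = "{b<..<a'}" and ?C = "closure (interior ?H)"
    have "?Z \<subseteq> {0..1}" "?Z' \<subseteq> {0..1}" using Z Z_star_subset(4) by blast+
    then have "closure ?Z \<subseteq> {0..1}" "closure ?Z' \<subseteq> {0..1}" by (simp_all add: closure_minimal)
    then have ba01: "b \<in> {0..1}" "a' \<in> {0..1}" using ab ab' by auto
    have "?D \<inter> interior ?H = {}"
    proof (rule ccontr)
      assume ne: "?D \<inter> interior ?H \<noteq> {}"
      have "open (?D \<inter> interior ?H)" by auto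
      \<comment> \<open>A nonempty open set is infinite and thus contains a point outside the finite
        exceptional set.\<close>
      then have "infinite (?D \<inter> interior ?H)" using ne finite_imp_not_open by blast
      moreover have "finite ({0..1} - regular_set \<sigma> n)" using \<sigma> by (rule finite_compl_regular_set)
      ultimately obtain x where x: "x \<in> ?D \<inter> interior ?H" "x \<notin> {0..1} - regular_set \<sigma> n"
        by (meson finite_subset subsetI)
      then have xH: "x \<in> ?H" using interior_subset by blast
      then have "x \<in> regular_set \<sigma> n" using x H_iter_subset by blast
      then obtain W where W: "W \<in> Z_star \<sigma> n" "x \<in> W" using Z_star_cover xH by blast
      then obtain k where k: "k < length Zs" "W = Zs ! k" using Zs(1) by (metis in_set_conv_nth)
      consider "k < i" | "k = i" | "k = Suc i" | "Suc i < k" by linarith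
      then show False
      proof cases
        case 1
        then have "set_le W ?Z" using le[of k i] i k by simp
        moreover have "(a + b) / 2 \<in> ?Z" using ab by auto
        ultimately have "x \<le> (a + b) / 2" using W(2) unfolding set_le_def by blast
        then show False using x(1) ab by auto
      next
        case 2
        then show False using x(1) W(2) k ab by auto
      next
        case 3
        then show False using x(1) W(2) k ab' by auto
      next
        case 4
        then have "set_le ?Z' W" using le[of "Suc i" k] i k by simp
        moreover have "(a' + b') / 2 \<in> ?Z'" using ab' by auto
        ultimately have "(a' + b') / 2 \<le> x" using W(2) unfolding set_le_def by blast
        then show False using x(1) ab' by auto
      qed
    qed
    then have DC: "?D \<inter> ?C = {}" using open_Int_closure_eq_empty[of ?D "interior ?H"] by simp
    have "?Z \<subseteq> interior ?H" "?Z' \<subseteq> interior ?H"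
      using Z Z_star_subset(3) ab ab' by (metis interior_maximal open_greaterThanLessThan)+
    then have "closure ?Z \<subseteq> ?C" "closure ?Z' \<subseteq> ?C" by (auto intro: closure_mono[THEN subsetD])
    then have ends: "b \<in> ?C" "a' \<in> ?C" using ab ab' by auto
    have "?D \<in> components ({0..1} - ?C)"
      unfolding in_components_maximal
    proof (intro conjI allI impI)
      show "?D \<noteq> {}" using lt by simp
      show "?D \<subseteq> {0..1} - ?C" using DC ba01 by auto
      show "connected ?D" by simp
      fix d assume d: "d \<noteq> {} \<and> ?D \<subseteq> d \<and> d \<subseteq> {0..1} - ?C \<and> connected d"
      have mid: "(b + a') / 2 \<in> d" using d lt by (auto simp: subset_iff)
      have "y \<in> ?D" if y: "y \<in> d" for y
      proof (rule ccontr)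
        assume "y \<notin> ?D"
        then consider "y \<le> b" | "a' \<le> y" by force
        then show False
        proof cases
          case 1
          then have "b \<in> {y..(b + a') / 2}" using lt by (auto simp: field_simps)
          then have "b \<in> d" using connected_contains_Icc[of d y "(b + a') / 2"] d y mid by blast
          then show False using d ends by auto
        next
          case 2
          then have "a' \<in> {(b + a') / 2..y}" using lt by (auto simp: field_simps)
          then have "a' \<in> d" using connected_contains_Icc[of d "(b + a') / 2" y] d y mid by blast
          then show False using d ends by auto
        qed
      qed
      then show "d = ?D" using d by blast
    qed
    then show ?thesis unfolding contiguous_def S using lt by (intro disjI2 bexI[of _ ?D]) auto
  qed
qed

text \<open>Contiguity of successive elements makes a block of bad indices a chain to which (C2)
  applies.\<close>

lemma bad_run_length:
  assumes \<sigma>: "\<sigma> \<in> \<S>" and Zs: "set Zs = Z_star \<sigma> n" "sorted_wrt set_le Zs"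
    and sub: "{a..<b} \<subseteq> {i. i < length Zs \<and> Zs ! i \<in> Z_bad \<sigma> n}"
  shows "real (b - a) \<le> K * \<xi> ^ n"
proof -
  let ?ys = "map ((!) Zs) [a..<b]"
  have "set ?ys \<subseteq> Z_bad \<sigma> n" using sub by auto
  moreover have "successively (contiguous \<sigma> n) ?ys"
    unfolding successively_conv_nth
  proof (intro allI impI)
    fix i assume i: "Suc i < length ?ys"
    then have "Suc (a + i) \<in> {a..<b}" by auto
    then have "Suc (a + i) < length Zs" using subsetD[OF sub] by blast
    then show "contiguous \<sigma> n (?ys ! i) (?ys ! Suc i)" using consecutive_contiguous[OF \<sigma> Zs] i by simp
  qed
  ultimately have "real (length ?ys) \<le> K * \<xi> ^ n" using C2 \<sigma> unfolding cond_C2_def by blast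
  then show ?thesis by simp
qed

end

section \<open>Lasota-Yorke inequality\<close>

context open_system
begin

lemma Z_star_measurable: "\<sigma> \<in> \<S> \<Longrightarrow> Z \<in> Z_star \<sigma> n \<Longrightarrow> Z \<in> sets lebesgue"
  using Z_star_interval by force

lemma Z_star_ne: "\<sigma> \<in> \<S> \<Longrightarrow> Z \<in> Z_star \<sigma> n \<Longrightarrow> Z \<noteq> {}"
  using Z_star_interval by force

lemma Z_star_is_interval: "\<sigma> \<in> \<S> \<Longrightarrow> Z \<in> Z_star \<sigma> n \<Longrightarrow> is_interval Z"
  using Z_star_interval[of \<sigma> Z n] by auto

lemma inj_on_Z_star: "\<sigma> \<in> \<S> \<Longrightarrow> Z \<in> Z_star \<sigma> n \<Longrightarrow> inj_on (T_iter \<sigma> n) Z"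
  by (intro inj_on_T_iter Z_star_is_interval Z_star_subset(2))

lemma AE_g_iter_bounds: "\<sigma> \<in> \<S> \<Longrightarrow> AE x in unit_leb. \<bar>g_iter \<sigma> n x\<bar> \<le> \<Theta> ^ n"
  using g_iter_bounds[of \<sigma> _ n] by (intro AE_unit_leb_finiteI[OF finite_compl_smooth_dom[of \<sigma> n]]) auto

text \<open>Read off from the distortion bound at n = 0, where \<open>g_iter\<close> is 1 and
  \<open>Z_star\<close> is not empty.\<close>

lemma C_nonneg: "0 \<le> C"
proof -
  obtain \<sigma> where \<sigma>: "\<sigma> \<in> \<S>" using symbols_ne by blast
  have H: "H_iter \<sigma> 0 = {0..1}" by (auto simp: H_iter_def)
  have "1 / 2 \<in> regular_set \<sigma> 0" by (simp add: regular_set_def smooth_dom_def H frontier_def)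
  then obtain Z where Z: "Z \<in> Z_star \<sigma> 0" using Z_star_cover[of "1 / 2" \<sigma> 0] H by auto
  have "total_variation (g_iter \<sigma> 0) Z \<le> ereal (C * ess_norm (g_iter \<sigma> 0))"
    using distortion \<sigma> Z unfolding distortion_bound_def by blast
  then have "0 \<le> C * ess_norm (g_iter \<sigma> 0)" unfolding total_variation_le_iff by (rule bvar_nonneg)
  moreover have "g_iter \<sigma> 0 = (\<lambda>_. 1)" by (auto simp: g_iter_def)
  moreover have "ess_norm (\<lambda>_. 1) = 1"
    unfolding ess_norm_def using emeasure_unit_leb by (subst esssup_const) auto
  ultimately show ?thesis by simp
qed

lemma bvar_g_iter:
  assumes \<sigma>: "\<sigma> \<in> \<S>" and Z: "Z \<in> Z_star \<sigma> n"
  shows "bvar (g_iter \<sigma> n) Z (C * \<Theta> ^ n)"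
proof -
  have "total_variation (g_iter \<sigma> n) Z \<le> ereal (C * ess_norm (g_iter \<sigma> n))"
    using distortion \<sigma> Z unfolding distortion_bound_def by blast
  then have "bvar (g_iter \<sigma> n) Z (C * ess_norm (g_iter \<sigma> n))" unfolding total_variation_le_iff .
  moreover have "ess_norm (g_iter \<sigma> n) \<le> \<Theta> ^ n"
    using AE_g_iter_bounds[OF \<sigma>] Theta_pos by (intro ess_norm_le) auto
  ultimately show ?thesis using C_nonneg by (auto intro: bvar_le mult_left_mono)
qed

lemma Z_bad_good: 
  assumes "\<sigma> \<in> \<S>"
  shows "Z_bad \<sigma> n \<union> Z_good \<sigma> n = Z_star \<sigma> n" "Z_bad \<sigma> n \<inter> Z_good \<sigma> n = {}"
proof -
  have "0 \<le> Lambda \<sigma> (indicator Z)" if "Z \<in> Z_star \<sigma> n" for Z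
    using that assms by (intro Lambda_nonneg ess_bounded_indicator Z_star_measurable) auto
  then show "Z_bad \<sigma> n \<union> Z_good \<sigma> n = Z_star \<sigma> n"
    by (fastforce simp: Z_bad_def Z_good_def)
  show "Z_bad \<sigma> n \<inter> Z_good \<sigma> n = {}" by (auto simp: Z_bad_def Z_good_def)
qed

lemma Z_bad_subset: "Z_bad \<sigma> n \<subseteq> Z_star \<sigma> n" and Z_good_subset: "Z_good \<sigma> n \<subseteq> Z_star \<sigma> n"
  by (auto simp: Z_bad_def Z_good_def)

text \<open>Carries the combinatorial estimate over to the partition. The function \<open>F\<close>
  serves two purposes: the identity for the Lasota-Yorke inequality, and the excess over a level q
  for the lower bound in the cone.\<close>

lemma sum_bad_le:
  assumes \<sigma>: "\<sigma> \<in> \<S>" and v: "bvar v {0..1} V" and good: "Z_good \<sigma> n \<noteq> {}"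
    and F: "\<And>a b. \<bar>F a - F b\<bar> \<le> \<bar>a - b\<bar>" "\<And>a. 0 \<le> a \<Longrightarrow> 0 \<le> F a"
  shows "(\<Sum>Z\<in>Z_bad \<sigma> n. F (abs_inf v Z)) \<le> 2 * (K * \<xi> ^ n) * (V + (\<Sum>Z\<in>Z_good \<sigma> n. F (abs_inf v Z)))"
proof -
  obtain Zs where Zs: "set Zs = Z_star \<sigma> n" "distinct Zs" "sorted_wrt set_le Zs"
    using Z_star_list[OF \<sigma>] by blast
  let ?N = "length Zs"
  let ?c = "\<lambda>i. F (abs_inf v (Zs ! i))"
  define B where "B = {i. i < ?N \<and> Zs ! i \<in> Z_bad \<sigma> n}"
  have ZsS: "Zs ! i \<in> Z_star \<sigma> n" if "i < ?N" for i using that Zs(1) nth_mem by blast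
  have inj: "inj_on ((!) Zs) {..<?N}" using Zs(2) by (auto intro: inj_on_nth)
  have imgB: "(!) Zs ` B = Z_bad \<sigma> n"
  proof
    show "Z_bad \<sigma> n \<subseteq> (!) Zs ` B"
    proof
      fix Z assume Z: "Z \<in> Z_bad \<sigma> n"
      then have "Z \<in> set Zs" using Zs(1) Z_bad_subset by blast
      then obtain i where "i < ?N" "Z = Zs ! i" by (metis in_set_conv_nth)
      then show "Z \<in> (!) Zs ` B" using Z by (auto simp: B_def)
    qed
  qed (auto simp: B_def)
  have imgG: "(!) Zs ` ({..<?N} - B) = Z_good \<sigma> n"
  proof
    show "(!) Zs ` ({..<?N} - B) \<subseteq> Z_good \<sigma> n"
      using ZsS Z_bad_good(1)[OF \<sigma>, of n] by (auto simp: B_def)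
    show "Z_good \<sigma> n \<subseteq> (!) Zs ` ({..<?N} - B)"
    proof
      fix Z assume Z: "Z \<in> Z_good \<sigma> n"
      then have "Z \<in> set Zs" using Zs(1) Z_good_subset by blast
      then obtain i where "i < ?N" "Z = Zs ! i" by (metis in_set_conv_nth)
      then show "Z \<in> (!) Zs ` ({..<?N} - B)" using Z Z_bad_good(2)[OF \<sigma>, of n] by (auto simp: B_def)
    qed
  qed
  have BN: "B \<subset> {..<?N}" using good imgG by (auto simp: B_def)
  have sB: "(\<Sum>Z\<in>Z_bad \<sigma> n. F (abs_inf v Z)) = (\<Sum>i\<in>B. ?c i)"
    unfolding imgB[symmetric] using inj BN by (subst sum.reindex) (auto intro: inj_on_subset)
  have sG: "(\<Sum>Z\<in>Z_good \<sigma> n. F (abs_inf v Z)) = (\<Sum>i\<in>{..<?N} - B. ?c i)"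
    unfolding imgG[symmetric] using inj by (subst sum.reindex) (auto intro: inj_on_subset)
  have "(\<Sum>i\<in>B. ?c i) \<le> 2 * (K * \<xi> ^ n) * (V + (\<Sum>i\<in>{..<?N} - B. ?c i))"
  proof (rule sum_bad_runs_le[OF BN])
    show "0 \<le> ?c i" if "i < ?N" for i
      using ZsS[OF that] Z_star_ne[OF \<sigma>] by (intro F(2) abs_inf_nonneg) auto
    show "real (b - a) \<le> K * \<xi> ^ n" if "{a..<b} \<subseteq> B" for a b
      using bad_run_length[OF \<sigma> Zs(1,3)] that unfolding B_def .
    have "(\<Sum>i<?N - 1. \<bar>?c (Suc i) - ?c i\<bar>) \<le> (\<Sum>i<?N - 1. \<bar>abs_inf v (Zs ! Suc i) - abs_inf v (Zs ! i)\<bar>)"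
      by (rule sum_mono) (rule F(1))
    also have "\<dots> \<le> V"
      by (rule sum_abs_inf_increments_le[OF Zs(3) v]) (use Zs(1) Z_star_subset(4) Z_star_ne[OF \<sigma>] in auto)
    finally show "(\<Sum>i<?N - 1. \<bar>?c (Suc i) - ?c i\<bar>) \<le> V" .
  qed
  then show ?thesis using sB sG by simp
qed

text \<open>Without good elements the whole of \<open>Z_star\<close> is one bad run.\<close>

lemma card_Z_star_le:
  assumes \<sigma>: "\<sigma> \<in> \<S>" and bad: "Z_good \<sigma> n = {}"
  shows "real (card (Z_star \<sigma> n)) \<le> K * \<xi> ^ n"
proof -
  obtain Zs where Zs: "set Zs = Z_star \<sigma> n" "distinct Zs" "sorted_wrt set_le Zs"
    using Z_star_list[OF \<sigma>] by blast
  have "Zs ! i \<in> Z_bad \<sigma> n" if "i < length Zs" for i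
    using that bad Z_bad_good(1)[OF \<sigma>, of n] Zs(1) nth_mem by blast
  then have "{0..<length Zs} \<subseteq> {i. i < length Zs \<and> Zs ! i \<in> Z_bad \<sigma> n}" by auto
  from bad_run_length[OF \<sigma> Zs(1,3) this] show ?thesis
    using distinct_card[OF Zs(2)] Zs(1) by simp
qed

lemma sum_var_Z_star_le:
  assumes \<sigma>: "\<sigma> \<in> \<S>" and v: "bvar v {0..1} V"
  shows "(\<Sum>Z\<in>Z_star \<sigma> n. var_on v Z) \<le> V"
proof -
  obtain Zs where Zs: "set Zs = Z_star \<sigma> n" "distinct Zs" "sorted_wrt set_le Zs"
    using Z_star_list[OF \<sigma>] by blast
  have "(\<Sum>Z\<leftarrow>Zs. var_on v Z) \<le> V"
    by (rule sum_var_on_le[OF Zs(3) v]) (use Zs(1) Z_star_subset(4) in auto)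
  then show ?thesis using Zs by (simp add: sum_list_distinct_conv_sum_set)
qed

text \<open>Groups the preimages by the element of \<open>Z_star\<close> that contains them. Besides
  the endpoints, only images of frontier points of \<open>H_iter\<close> have to be
  excluded.\<close>

lemma AE_L_iter_eq_pushforward:
  assumes \<sigma>: "\<sigma> \<in> \<S>"
  shows "AE y in unit_leb. L_iter \<sigma> n \<phi> y =
    (\<Sum>Z\<in>Z_star \<sigma> n. pushforward (T_iter \<sigma> n) Z (\<lambda>x. \<phi> x * g_iter \<sigma> n x) y)"
proof (rule AE_unit_leb_finiteI)
  let ?H = "H_iter \<sigma> n" and ?T = "T_iter \<sigma> n"
  show "finite ({0, 1} \<union> ?T ` frontier ?H)" using finite_frontier_H_iter[OF \<sigma>] by simp
  fix y :: real assume y: "y \<in> {0..1}" "y \<notin> {0, 1} \<union> ?T ` frontier ?H"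
  have eq: "{x. x \<in> smooth_dom \<sigma> n \<inter> ?H \<and> ?T x = y} = (\<Union>Z\<in>Z_star \<sigma> n. {x. x \<in> Z \<and> ?T x = y})"
  proof
    show "{x. x \<in> smooth_dom \<sigma> n \<inter> ?H \<and> ?T x = y} \<subseteq> (\<Union>Z\<in>Z_star \<sigma> n. {x. x \<in> Z \<and> ?T x = y})"
    proof
      fix x assume x: "x \<in> {x. x \<in> smooth_dom \<sigma> n \<inter> ?H \<and> ?T x = y}"
      then have "x \<in> regular_set \<sigma> n" using y by (auto simp: regular_set_def)
      then show "x \<in> (\<Union>Z\<in>Z_star \<sigma> n. {x. x \<in> Z \<and> ?T x = y})" using Z_star_cover[of x \<sigma> n] x by auto
    qed
    show "(\<Union>Z\<in>Z_star \<sigma> n. {x. x \<in> Z \<and> ?T x = y}) \<subseteq> {x. x \<in> smooth_dom \<sigma> n \<inter> ?H \<and> ?T x = y}"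
      using Z_star_subset(2,3) by blast
  qed
  have "L_iter \<sigma> n \<phi> y = (\<Sum>x | x \<in> smooth_dom \<sigma> n \<inter> ?H \<and> ?T x = y. \<phi> x * g_iter \<sigma> n x)"
    using \<sigma> by (rule L_iter_eq_sum) (use y in force)
  also have "\<dots> = (\<Sum>Z\<in>Z_star \<sigma> n. \<Sum>x | x \<in> Z \<and> ?T x = y. \<phi> x * g_iter \<sigma> n x)"
    unfolding eq
  proof (rule sum.UNION_disjoint[OF finite_Z_star[OF \<sigma>]])
    show "\<forall>Z\<in>Z_star \<sigma> n. finite {x \<in> Z. ?T x = y}"
    proof
      fix Z assume "Z \<in> Z_star \<sigma> n"
      then have "{x \<in> Z. ?T x = y} \<subseteq> {x \<in> smooth_dom \<sigma> n. ?T x = y}" using Z_star_subset(2) by blast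
      then show "finite {x \<in> Z. ?T x = y}" using finite_smooth_dom_fibre[OF \<sigma>] by (rule finite_subset)
    qed
    show "\<forall>Z\<in>Z_star \<sigma> n. \<forall>Z'\<in>Z_star \<sigma> n. Z \<noteq> Z' \<longrightarrow> {x \<in> Z. ?T x = y} \<inter> {x \<in> Z'. ?T x = y} = {}"
      using Z_star_disjoint by blast
  qed
  also have "\<dots> = (\<Sum>Z\<in>Z_star \<sigma> n. pushforward ?T Z (\<lambda>x. \<phi> x * g_iter \<sigma> n x) y)"
    using inj_on_Z_star[OF \<sigma>] by (intro sum.cong refl) (simp add: pushforward_eq_sum)
  finally show "L_iter \<sigma> n \<phi> y = (\<Sum>Z\<in>Z_star \<sigma> n. pushforward ?T Z (\<lambda>x. \<phi> x * g_iter \<sigma> n x) y)" .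
qed

lemma var_on_Z_star:
  assumes \<sigma>: "\<sigma> \<in> \<S>" and Z: "Z \<in> Z_star \<sigma> n" and v: "bvar v {0..1} V"
  shows "bvar v Z (var_on v Z)" "0 \<le> var_on v Z" "0 \<le> abs_inf v Z"
    "\<And>x. x \<in> Z \<Longrightarrow> \<bar>v x\<bar> \<le> abs_inf v Z + var_on v Z"
proof -
  show b: "bvar v Z (var_on v Z)" using bvar_subset[OF v Z_star_subset(4)[OF Z]] by (rule bvar_var_on)
  show "0 \<le> var_on v Z" using b by (rule bvar_nonneg)
  show "0 \<le> abs_inf v Z" using Z_star_ne[OF \<sigma> Z] by (rule abs_inf_nonneg)
  show "\<And>x. x \<in> Z \<Longrightarrow> \<bar>v x\<bar> \<le> abs_inf v Z + var_on v Z" using b by (rule abs_le_abs_inf_plus_var)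
qed

text \<open>On one interval the supremum is at most inf + var, so the product rule and the extension
  by 0 give \<Theta>^n ((C + 3) var + (C + 2) inf). Rounding up produces the coefficients 3 (C + 1)
  and 3 C + 2 that enter \<open>C_star\<close>.\<close>

lemma ex_variation_L_iter:
  assumes \<sigma>: "\<sigma> \<in> \<S>" and v: "bvar v {0..1} V"
  shows "\<exists>w. (AE y in unit_leb. L_iter \<sigma> n v y = w y) \<and>
    bvar w {0..1} (\<Theta> ^ n * (3 * (C + 1) * V + (3 * C + 2) * (\<Sum>Z\<in>Z_star \<sigma> n. abs_inf v Z)))"
proof -
  let ?T = "T_iter \<sigma> n"
  let ?h = "\<lambda>x. v x * g_iter \<sigma> n x"
  define w where "w y = (\<Sum>Z\<in>Z_star \<sigma> n. pushforward ?T Z ?h y)" for y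
  have th: "0 \<le> \<Theta> ^ n" using Theta_pos by simp
  have pf: "lvar (pushforward ?T Z ?h) xs \<le> \<Theta> ^ n * (3 * (C + 1) * var_on v Z + (3 * C + 2) * abs_inf v Z)"
    if Z: "Z \<in> Z_star \<sigma> n" and xs: "sorted xs" for Z xs
  proof -
    note vZ = var_on_Z_star[OF \<sigma> Z v]
    let ?c = "abs_inf v Z" and ?V = "var_on v Z"
    have g: "0 \<le> g_iter \<sigma> n x" "g_iter \<sigma> n x \<le> \<Theta> ^ n" if "x \<in> Z" for x
      using g_iter_bounds[OF \<sigma>] Z_star_subset(2)[OF Z] that by auto
    have "bvar ?h Z ((?c + ?V) * (C * \<Theta> ^ n) + \<Theta> ^ n * ?V)"
      unfolding bvar_def
    proof (intro allI impI)
      fix zs assume zs: "sorted zs \<and> set zs \<subseteq> Z"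
      have "lvar ?h zs \<le> (?c + ?V) * lvar (g_iter \<sigma> n) zs + \<Theta> ^ n * lvar v zs"
        using zs vZ(4) g by (intro lvar_mult) (auto simp: subset_iff)
      also have "\<dots> \<le> (?c + ?V) * (C * \<Theta> ^ n) + \<Theta> ^ n * ?V"
        using zs vZ bvar_g_iter[OF \<sigma> Z] th unfolding bvar_def by (intro add_mono mult_left_mono) auto
      finally show "lvar ?h zs \<le> (?c + ?V) * (C * \<Theta> ^ n) + \<Theta> ^ n * ?V" .
    qed
    moreover have "continuous_on Z ?T"
      using isCont_T_iter[OF \<sigma>] Z_star_subset(2)[OF Z] by (auto intro!: continuous_at_imp_continuous_on)
    moreover have "\<bar>?h x\<bar> \<le> (?c + ?V) * \<Theta> ^ n" if "x \<in> Z" for x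
      unfolding abs_mult using vZ(4)[OF that] g[OF that] vZ(2,3) by (intro mult_mono) auto
    ultimately have "bvar (pushforward ?T Z ?h) UNIV
        ((?c + ?V) * (C * \<Theta> ^ n) + \<Theta> ^ n * ?V + 2 * ((?c + ?V) * \<Theta> ^ n))"
      using vZ(2,3) th by (intro bvar_pushforward Z_star_is_interval[OF \<sigma> Z] inj_on_Z_star[OF \<sigma> Z]) auto
    then have "lvar (pushforward ?T Z ?h) xs \<le> (?c + ?V) * (C * \<Theta> ^ n) + \<Theta> ^ n * ?V + 2 * ((?c + ?V) * \<Theta> ^ n)"
      using xs unfolding bvar_def by blast
    also have "\<dots> = \<Theta> ^ n * ((C + 3) * ?V + (C + 2) * ?c)" by (simp add: algebra_simps)
    also have "\<dots> \<le> \<Theta> ^ n * (3 * (C + 1) * ?V + (3 * C + 2) * ?c)"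
      using th C_nonneg vZ(2,3) by (intro mult_left_mono add_mono mult_right_mono) auto
    finally show ?thesis .
  qed
  have "bvar w {0..1} (\<Theta> ^ n * (3 * (C + 1) * V + (3 * C + 2) * (\<Sum>Z\<in>Z_star \<sigma> n. abs_inf v Z)))"
    unfolding bvar_def
  proof (intro allI impI)
    fix xs :: "real list" assume xs: "sorted xs \<and> set xs \<subseteq> {0..1}"
    have "lvar w xs \<le> (\<Sum>Z\<in>Z_star \<sigma> n. lvar (pushforward ?T Z ?h) xs)"
      unfolding w_def[abs_def] by (rule lvar_sum)
    also have "\<dots> \<le> (\<Sum>Z\<in>Z_star \<sigma> n. \<Theta> ^ n * (3 * (C + 1) * var_on v Z + (3 * C + 2) * abs_inf v Z))"
      using xs by (intro sum_mono pf) auto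
    also have "\<dots> = \<Theta> ^ n * (3 * (C + 1) * (\<Sum>Z\<in>Z_star \<sigma> n. var_on v Z) + (3 * C + 2) * (\<Sum>Z\<in>Z_star \<sigma> n. abs_inf v Z))"
      by (simp only: sum_distrib_left[symmetric] sum.distrib)
    also have "\<dots> \<le> \<Theta> ^ n * (3 * (C + 1) * V + (3 * C + 2) * (\<Sum>Z\<in>Z_star \<sigma> n. abs_inf v Z))"
      using th C_nonneg sum_var_Z_star_le[OF \<sigma> v, of n] by (intro mult_left_mono add_right_mono) auto
    finally show "lvar w xs \<le> \<Theta> ^ n * (3 * (C + 1) * V + (3 * C + 2) * (\<Sum>Z\<in>Z_star \<sigma> n. abs_inf v Z))" .
  qed
  moreover have "AE y in unit_leb. L_iter \<sigma> n v y = w y"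
    unfolding w_def using \<sigma> by (rule AE_L_iter_eq_pushforward)
  ultimately show ?thesis by blast
qed

text \<open>The elements are disjoint, so at each point at most one summand survives.\<close>

lemma AE_abs_inf_step_le:
  assumes \<sigma>: "\<sigma> \<in> \<S>" and uv: "AE x in unit_leb. u x = v x" and nn: "AE x in unit_leb. 0 \<le> u x"
    and A: "A \<subseteq> Z_star \<sigma> n"
  shows "AE x in unit_leb. (\<Sum>Z\<in>A. abs_inf v Z * indicator Z x) \<le> u x"
  using uv nn
proof eventually_elim
  case (elim x)
  have fA: "finite A" using A finite_Z_star[OF \<sigma>] finite_subset by blast
  show ?case
  proof (cases "\<exists>Z\<in>A. x \<in> Z")
    case True
    then obtain Z where Z: "Z \<in> A" "x \<in> Z" by blast
    have "(\<Sum>Z'\<in>A. abs_inf v Z' * indicator Z' x) = (\<Sum>Z'\<in>{Z}. abs_inf v Z' * indicator Z' x)"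
    proof (rule sum.mono_neutral_right[OF fA])
      show "\<forall>Z'\<in>A - {Z}. abs_inf v Z' * indicator Z' x = 0"
      proof
        fix Z' assume "Z' \<in> A - {Z}"
        then have "Z \<inter> Z' = {}" using Z(1) A by (intro Z_star_disjoint[of Z \<sigma> n Z']) auto
        then show "abs_inf v Z' * indicator Z' x = 0" using Z(2) by (auto simp: indicator_def)
      qed
    qed (use Z in auto)
    also have "\<dots> \<le> \<bar>v x\<bar>" using Z abs_inf_le[of x Z v] by simp
    also have "\<dots> = u x" using elim by simp
    finally show ?thesis .
  next
    case False
    then have "(\<Sum>Z\<in>A. abs_inf v Z * indicator Z x) = 0" by (intro sum.neutral) auto
    then show ?thesis using elim by simp
  qed
qed

text \<open>Superadditivity and monotonicity of \<open>Lambda\<close>, applied to the step function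
  below u. On good intervals, where \<open>Lambda\<close> of the indicator is bounded below, this
  controls the infima by \<open>Lambda\<close> of u.\<close>

lemma sum_abs_inf_Lambda_le:
  assumes \<sigma>: "\<sigma> \<in> \<S>" and u: "ess_bounded u" and uv: "AE x in unit_leb. u x = v x"
    and nn: "AE x in unit_leb. 0 \<le> u x" and A: "A \<subseteq> Z_star \<sigma> n"
  shows "(\<Sum>Z\<in>A. abs_inf v Z * Lambda \<sigma> (indicator Z)) \<le> Lambda \<sigma> u"
proof -
  have b: "ess_bounded (indicator Z :: real \<Rightarrow> real)" if "Z \<in> A" for Z
    using that A by (intro ess_bounded_indicator Z_star_measurable[OF \<sigma>]) auto
  have b': "ess_bounded (\<lambda>x. abs_inf v Z * indicator Z x)" if "Z \<in> A" for Z
    using b[OF that] by (rule ess_bounded_cmult)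
  have "(\<Sum>Z\<in>A. abs_inf v Z * Lambda \<sigma> (indicator Z)) \<le> (\<Sum>Z\<in>A. Lambda \<sigma> (\<lambda>x. abs_inf v Z * indicator Z x))"
  proof (rule sum_mono)
    fix Z assume Z: "Z \<in> A"
    have "0 \<le> abs_inf v Z" using Z A Z_star_ne[OF \<sigma>] by (intro abs_inf_nonneg) blast
    then show "abs_inf v Z * Lambda \<sigma> (indicator Z) \<le> Lambda \<sigma> (\<lambda>x. abs_inf v Z * indicator Z x)"
      using Lambda_cmult_ge[OF \<sigma> b[OF Z]] by blast
  qed
  also have "\<dots> \<le> Lambda \<sigma> (\<lambda>x. \<Sum>Z\<in>A. abs_inf v Z * indicator Z x)"
    using \<sigma> b' by (rule Lambda_sum_ge)
  also have "\<dots> \<le> Lambda \<sigma> u"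
    using \<sigma> ess_bounded_sum[OF b'] u AE_abs_inf_step_le[OF \<sigma> uv nn A] by (rule Lambda_mono)
  finally show ?thesis .
qed

text \<open>The infimum is at most \<open>Lambda\<close>, and the oscillation is at most the
  variation.\<close>

lemma bvar_le_Lambda:
  assumes \<sigma>: "\<sigma> \<in> \<S>" and u: "ess_bounded u" and uv: "AE x in unit_leb. u x = v x"
    and nn: "AE x in unit_leb. 0 \<le> u x" and v: "bvar v {0..1} V" and x: "x \<in> {0..1}"
  shows "\<bar>v x\<bar> \<le> Lambda \<sigma> u + V"
proof -
  have "AE y in unit_leb. y \<in> {0..1}" by (rule AE_unit_leb_finiteI[of "{}"]) auto
  then have "AE y in unit_leb. abs_inf v {0..1} \<le> u y"
    using uv nn
  proof eventually_elim
    case (elim y)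
    then show ?case using abs_inf_le[of y "{0..1}" v] by simp
  qed
  then have "abs_inf v {0..1} \<le> Lambda \<sigma> u" using \<sigma> u by (intro const_le_Lambda)
  then show ?thesis using abs_le_abs_inf_plus_var[OF v x] by linarith
qed

text \<open>If all intervals were bad, there would be at most K \<xi>^n of them, each adding at most
  \<Theta>^n to the image of 1. Then \<open>Lambda\<close> of 1, which is 1, would be at most K
  (\<theta>/\<rho>)^n < 1.\<close>

lemma ex_good:
  assumes \<sigma>: "\<sigma> \<in> \<S>" and n: "K * \<theta> ^ n < \<rho> ^ n"
  shows "Z_good \<sigma> n \<noteq> {}"
proof
  assume "Z_good \<sigma> n = {}"
  then have card: "real (card (Z_star \<sigma> n)) \<le> K * \<xi> ^ n" by (rule card_Z_star_le[OF \<sigma>])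
  have th: "0 \<le> \<Theta> ^ n" using Theta_pos by simp
  have "AE y in unit_leb. L_iter \<sigma> n (\<lambda>_. 1) y \<le> 0 * L_iter \<sigma> n (\<lambda>_. 1) y + K * \<theta> ^ n"
    using AE_L_iter_eq_pushforward[OF \<sigma>, of n "\<lambda>_. 1"]
  proof eventually_elim
    case (elim y)
    have "L_iter \<sigma> n (\<lambda>_. 1) y \<le> (\<Sum>Z\<in>Z_star \<sigma> n. \<Theta> ^ n)"
      unfolding elim
    proof (rule sum_mono)
      fix Z assume Z: "Z \<in> Z_star \<sigma> n"
      have "1 * g_iter \<sigma> n x \<le> \<Theta> ^ n" if "x \<in> Z" for x
        using g_iter_bounds(2)[OF \<sigma>] Z_star_subset(2)[OF Z] that by auto
      then show "pushforward (T_iter \<sigma> n) Z (\<lambda>x. 1 * g_iter \<sigma> n x) y \<le> \<Theta> ^ n"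
        using inj_on_Z_star[OF \<sigma> Z] th by (intro pushforward_le)
    qed
    also have "\<dots> \<le> K * \<xi> ^ n * \<Theta> ^ n" using card th by (simp add: mult_right_mono)
    finally show ?case by (simp add: power_mult_distrib mult.assoc)
  qed
  then have "Lambda \<sigma> (\<lambda>_. 1) \<le> 0 + K * \<theta> ^ n / \<rho> ^ n"
    using K_nonneg theta_pos by (intro Lambda_leI[OF \<sigma> ess_bounded_const]) auto
  moreover have "K * \<theta> ^ n / \<rho> ^ n < 1" using n rho_pos by simp
  ultimately show False using Lambda_one[OF \<sigma>] by simp
qed

text \<open>Good intervals are paid for by \<open>Lambda\<close> through \<epsilon>, bad ones by
  their good neighbours and the variation. If no interval is good, there are few intervals and each
  infimum is at most \<open>Lambda \<sigma> u + V\<close>, which the same bound covers.\<close>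

lemma sum_abs_inf_le:
  assumes \<sigma>: "\<sigma> \<in> \<S>" and u: "ess_bounded u" and uv: "AE x in unit_leb. u x = v x"
    and nn: "AE x in unit_leb. 0 \<le> u x" and v: "bvar v {0..1} V"
    and eps: "0 < \<epsilon>" "\<epsilon> \<le> 1" "\<And>Z. Z \<in> Z_good \<sigma> n \<Longrightarrow> \<epsilon> \<le> Lambda \<sigma> (indicator Z)"
  shows "(\<Sum>Z\<in>Z_star \<sigma> n. abs_inf v Z) \<le> 2 * (K * \<xi> ^ n) * V + (2 * (K * \<xi> ^ n) + 1) * (Lambda \<sigma> u / \<epsilon>)"
proof (cases "Z_good \<sigma> n = {}")
  case True
  let ?R = "K * \<xi> ^ n"
  have V: "0 \<le> V" using v by (rule bvar_nonneg)
  have L: "0 \<le> Lambda \<sigma> u" using \<sigma> u nn by (rule Lambda_nonneg)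
  have R: "0 \<le> ?R" using K_nonneg xi_ge_1 by simp
  have "abs_inf v Z \<le> Lambda \<sigma> u + V" if Z: "Z \<in> Z_star \<sigma> n" for Z
  proof -
    obtain x where x: "x \<in> Z" using Z_star_ne[OF \<sigma> Z] by blast
    then have "x \<in> {0..1}" using Z_star_subset(4)[OF Z] by blast
    from bvar_le_Lambda[OF \<sigma> u uv nn v this] show ?thesis using abs_inf_le[OF x, of v] by linarith
  qed
  then have "(\<Sum>Z\<in>Z_star \<sigma> n. abs_inf v Z) \<le> (\<Sum>Z\<in>Z_star \<sigma> n. Lambda \<sigma> u + V)"
    by (intro sum_mono)
  also have "\<dots> \<le> ?R * (Lambda \<sigma> u + V)"
    using card_Z_star_le[OF \<sigma> True] L V by (simp add: mult_right_mono)
  also have "\<dots> \<le> 2 * ?R * V + (2 * ?R + 1) * Lambda \<sigma> u"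
  proof -
    have "0 \<le> ?R * V" "0 \<le> ?R * Lambda \<sigma> u" using R L V by simp_all
    then show ?thesis using L by (simp add: algebra_simps)
  qed
  also have "\<dots> \<le> 2 * ?R * V + (2 * ?R + 1) * (Lambda \<sigma> u / \<epsilon>)"
  proof -
    have "Lambda \<sigma> u * \<epsilon> \<le> Lambda \<sigma> u" using L eps by (simp add: mult_left_le)
    then have "Lambda \<sigma> u \<le> Lambda \<sigma> u / \<epsilon>" using eps by (simp add: pos_le_divide_eq)
    then show ?thesis using R by (intro add_left_mono mult_left_mono) auto
  qed
  finally show ?thesis .
next
  case False
  let ?R = "K * \<xi> ^ n"
  let ?G = "\<Sum>Z\<in>Z_good \<sigma> n. abs_inf v Z" and ?B = "\<Sum>Z\<in>Z_bad \<sigma> n. abs_inf v Z"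
  have R: "0 \<le> ?R" using K_nonneg xi_ge_1 by simp
  have "\<epsilon> * ?G \<le> (\<Sum>Z\<in>Z_good \<sigma> n. abs_inf v Z * Lambda \<sigma> (indicator Z))"
    unfolding sum_distrib_left
  proof (rule sum_mono)
    fix Z assume Z: "Z \<in> Z_good \<sigma> n"
    then have "0 \<le> abs_inf v Z" using Z_good_subset Z_star_ne[OF \<sigma>] by (intro abs_inf_nonneg) blast
    then show "\<epsilon> * abs_inf v Z \<le> abs_inf v Z * Lambda \<sigma> (indicator Z)"
      using eps(3)[OF Z] by (subst mult.commute) (rule mult_left_mono)
  qed
  also have "\<dots> \<le> Lambda \<sigma> u" using sum_abs_inf_Lambda_le[OF \<sigma> u uv nn Z_good_subset] .
  finally have G: "?G \<le> Lambda \<sigma> u / \<epsilon>" using eps by (simp add: pos_le_divide_eq mult.commute)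
  have B: "?B \<le> 2 * ?R * (V + ?G)"
    using sum_bad_le[OF \<sigma> v False, of "\<lambda>x. x"] by simp
  have fin: "finite (Z_bad \<sigma> n)" "finite (Z_good \<sigma> n)"
    using finite_subset[OF Z_bad_subset finite_Z_star[OF \<sigma>]] finite_subset[OF Z_good_subset finite_Z_star[OF \<sigma>]] by auto
  have "(\<Sum>Z\<in>Z_star \<sigma> n. abs_inf v Z) = ?B + ?G"
    unfolding Z_bad_good(1)[OF \<sigma>, symmetric]
    using fin Z_bad_good(2)[OF \<sigma>, of n] by (rule sum.union_disjoint)
  also have "\<dots> \<le> 2 * ?R * V + (2 * ?R + 1) * ?G" using B by (simp add: algebra_simps)
  also have "\<dots> \<le> 2 * ?R * V + (2 * ?R + 1) * (Lambda \<sigma> u / \<epsilon>)"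
    using G R by (intro add_left_mono mult_left_mono) auto
  finally show ?thesis .
qed

text \<open>Every term carries \<Theta>^n, and the bad runs multiply by at most a multiple of
  \<xi>^n; hence the rate \<theta> = \<xi> \<Theta>.\<close>

lemma Lasota_Yorke:
  assumes \<sigma>: "\<sigma> \<in> \<S>" and u: "ess_bounded u" and uv: "AE x in unit_leb. u x = v x"
    and nn: "AE x in unit_leb. 0 \<le> u x" and v: "bvar v {0..1} V" and n: "1 \<le> n"
    and eps: "0 < \<epsilon>" "\<epsilon> \<le> 1" "\<And>Z. Z \<in> Z_good \<sigma> n \<Longrightarrow> \<epsilon> \<le> Lambda \<sigma> (indicator Z)"
  shows "\<exists>w. (AE y in unit_leb. L_iter \<sigma> n u y = w y) \<and>
    bvar w {0..1} (C_star C K * \<theta> ^ n * V + (3 * C + 2) * (2 * K * \<xi> + 1) * \<Theta> / \<epsilon> * Lambda \<sigma> u)"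
proof -
  let ?L = "Lambda \<sigma> u / \<epsilon>" and ?S = "\<Sum>Z\<in>Z_star \<sigma> n. abs_inf v Z"
  obtain w where w: "AE y in unit_leb. L_iter \<sigma> n v y = w y"
      "bvar w {0..1} (\<Theta> ^ n * (3 * (C + 1) * V + (3 * C + 2) * ?S))"
    using ex_variation_L_iter[OF \<sigma> v] by blast
  have "AE y in unit_leb. L_iter \<sigma> n u y = w y"
    using AE_L_iter_cong[OF \<sigma> uv, of n] w(1) by eventually_elim simp
  moreover have "\<Theta> ^ n * (3 * (C + 1) * V + (3 * C + 2) * ?S)
      \<le> C_star C K * \<theta> ^ n * V + (3 * C + 2) * (2 * K * \<xi> + 1) * \<Theta> / \<epsilon> * Lambda \<sigma> u"
  proof -
    have V: "0 \<le> V" using v by (rule bvar_nonneg)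
    have L: "0 \<le> ?L" using Lambda_nonneg[OF \<sigma> u nn] eps by simp
    have th: "0 \<le> \<Theta> ^ n" using Theta_pos by simp
    have xi: "1 \<le> \<xi> ^ n" using xi_ge_1 by (rule one_le_power)
    \<comment> \<open>As n >= 1 and both rates are below 1, the powers in front of
      \<open>Lambda\<close> are replaced by first powers. Then 2 K \<theta> + \<Theta> = (2 K \<xi>
      + 1) \<Theta> yields the numerator of \<open>C_n\<close>.\<close>
    have T1: "\<Theta> ^ n \<le> \<Theta>"
      using power_decreasing[OF n, of \<Theta>] Theta_pos Theta_le_theta theta_less by simp
    have t1: "\<theta> ^ n \<le> \<theta>"
      using power_decreasing[OF n, of \<theta>] theta_pos theta_less by simp
    have tn: "\<Theta> ^ n * \<xi> ^ n = \<theta> ^ n" by (simp add: power_mult_distrib)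
    have Tt: "\<Theta> ^ n \<le> \<theta> ^ n" unfolding tn[symmetric] using mult_left_mono[OF xi th] by simp
    have "\<Theta> ^ n * (3 * (C + 1) * V + (3 * C + 2) * ?S)
        \<le> \<Theta> ^ n * (3 * (C + 1) * V + (3 * C + 2) * (2 * (K * \<xi> ^ n) * V + (2 * (K * \<xi> ^ n) + 1) * ?L))"
      using sum_abs_inf_le[OF \<sigma> u uv nn v eps] th C_nonneg by (intro mult_left_mono add_left_mono) auto
    also have "\<dots> = 3 * (C + 1) * V * \<Theta> ^ n + (3 * C + 2) * (2 * K * V * \<theta> ^ n + (2 * K * \<theta> ^ n + \<Theta> ^ n) * ?L)"
      unfolding tn[symmetric] by (simp add: algebra_simps add_divide_distrib)
    also have "\<dots> \<le> 3 * (C + 1) * V * \<theta> ^ n + (3 * C + 2) * (2 * K * V * \<theta> ^ n + (2 * K * \<theta> + \<Theta>) * ?L)"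
      using Tt T1 t1 C_nonneg V K_nonneg L
      by (intro add_mono mult_left_mono mult_right_mono order_refl) auto
    also have "\<dots> = C_star C K * \<theta> ^ n * V + (3 * C + 2) * (2 * K * \<xi> + 1) * \<Theta> / \<epsilon> * Lambda \<sigma> u"
      by (simp add: C_star_def algebra_simps add_divide_distrib)
    finally show ?thesis .
  qed
  ultimately show ?thesis using w(2) bvar_le by blast
qed

text \<open>On each interval v is at most q plus the excess of its infimum over q plus its
  variation. The excess vanishes on good intervals, so its sum over the bad ones is at most 2 K
  \<xi>^n V; \<open>Lambda_leI\<close> then divides the total error by \<rho>^n.\<close>

lemma Lambda_le_max_good:
  assumes \<sigma>: "\<sigma> \<in> \<S>" and u: "ess_bounded u" and uv: "AE x in unit_leb. u x = v x"
    and v: "bvar v {0..1} V" and good: "Z_good \<sigma> n \<noteq> {}"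
    and q: "0 \<le> q" "\<And>Z. Z \<in> Z_good \<sigma> n \<Longrightarrow> abs_inf v Z \<le> q"
  shows "Lambda \<sigma> u \<le> q + (2 * K + 1) * V * (\<theta> / \<rho>) ^ n"
proof -
  let ?T = "T_iter \<sigma> n" and ?g = "g_iter \<sigma> n"
  let ?F = "\<lambda>x. max (x - q) (0::real)"
  have V: "0 \<le> V" using v by (rule bvar_nonneg)
  have th: "0 \<le> \<Theta> ^ n" using Theta_pos by simp
  have tn: "\<Theta> ^ n * \<xi> ^ n = \<theta> ^ n" by (simp add: power_mult_distrib)
  have Tt: "\<Theta> ^ n \<le> \<theta> ^ n" unfolding tn[symmetric] using mult_left_mono[OF one_le_power[OF xi_ge_1, of n] th] by simp
  have "(\<Sum>Z\<in>Z_bad \<sigma> n. ?F (abs_inf v Z)) \<le> 2 * (K * \<xi> ^ n) * (V + (\<Sum>Z\<in>Z_good \<sigma> n. ?F (abs_inf v Z)))"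
    by (rule sum_bad_le[OF \<sigma> v good]) auto
  moreover have G0: "(\<Sum>Z\<in>Z_good \<sigma> n. ?F (abs_inf v Z)) = 0"
    using q(2) by (intro sum.neutral) auto
  moreover have fin: "finite (Z_bad \<sigma> n)" "finite (Z_good \<sigma> n)"
    using finite_subset[OF Z_bad_subset finite_Z_star[OF \<sigma>]] finite_subset[OF Z_good_subset finite_Z_star[OF \<sigma>]] by auto
  have "(\<Sum>Z\<in>Z_star \<sigma> n. ?F (abs_inf v Z)) = (\<Sum>Z\<in>Z_bad \<sigma> n. ?F (abs_inf v Z)) + (\<Sum>Z\<in>Z_good \<sigma> n. ?F (abs_inf v Z))"
    unfolding Z_bad_good(1)[OF \<sigma>, symmetric]
    using fin Z_bad_good(2)[OF \<sigma>, of n] by (rule sum.union_disjoint)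
  ultimately have F: "(\<Sum>Z\<in>Z_star \<sigma> n. ?F (abs_inf v Z)) \<le> 2 * (K * \<xi> ^ n) * V" by simp
  have "AE y in unit_leb. L_iter \<sigma> n u y \<le> q * L_iter \<sigma> n (\<lambda>_. 1) y + (2 * K + 1) * V * \<theta> ^ n"
    using AE_L_iter_cong[OF \<sigma> uv, of n] AE_L_iter_eq_pushforward[OF \<sigma>, of n v]
      AE_L_iter_eq_pushforward[OF \<sigma>, of n "\<lambda>_. q"]
  proof eventually_elim
    case (elim y)
    have "L_iter \<sigma> n u y \<le> (\<Sum>Z\<in>Z_star \<sigma> n. pushforward ?T Z (\<lambda>x. q * ?g x) y + (?F (abs_inf v Z) + var_on v Z) * \<Theta> ^ n)"
      unfolding elim(1) elim(2)
    proof (rule sum_mono)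
      fix Z assume Z: "Z \<in> Z_star \<sigma> n"
      note vZ = var_on_Z_star[OF \<sigma> Z v]
      have g: "0 \<le> ?g x" "?g x \<le> \<Theta> ^ n" if "x \<in> Z" for x
        using g_iter_bounds[OF \<sigma>] Z_star_subset(2)[OF Z] that by auto
      let ?e = "?F (abs_inf v Z) + var_on v Z"
      have e: "0 \<le> ?e" using vZ(2) by simp
      have "pushforward ?T Z (\<lambda>x. v x * ?g x) y \<le> pushforward ?T Z (\<lambda>x. q * ?g x + ?e * ?g x) y"
      proof (rule pushforward_mono[OF inj_on_Z_star[OF \<sigma> Z]])
        fix x assume x: "x \<in> Z"
        have "v x \<le> q + ?e" using vZ(4)[OF x] by linarith
        then have "v x * ?g x \<le> (q + ?e) * ?g x" using g(1)[OF x] by (rule mult_right_mono)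
        then show "v x * ?g x \<le> q * ?g x + ?e * ?g x" by (simp add: distrib_right)
      qed
      also have "\<dots> = pushforward ?T Z (\<lambda>x. q * ?g x) y + pushforward ?T Z (\<lambda>x. ?e * ?g x) y"
        by (rule pushforward_add)
      also have "pushforward ?T Z (\<lambda>x. ?e * ?g x) y \<le> ?e * \<Theta> ^ n"
        by (rule pushforward_le[OF inj_on_Z_star[OF \<sigma> Z]]) (use e th g in \<open>auto intro: mult_left_mono\<close>)
      finally show "pushforward ?T Z (\<lambda>x. v x * ?g x) y \<le> pushforward ?T Z (\<lambda>x. q * ?g x) y + ?e * \<Theta> ^ n" by simp
    qed
    also have "\<dots> = L_iter \<sigma> n (\<lambda>_. q) y + (\<Sum>Z\<in>Z_star \<sigma> n. ?F (abs_inf v Z) + var_on v Z) * \<Theta> ^ n"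
      unfolding elim(3) by (subst sum.distrib, subst sum_distrib_right, rule refl)
    also have "\<dots> \<le> L_iter \<sigma> n (\<lambda>_. q) y + (2 * (K * \<xi> ^ n) * V + V) * \<Theta> ^ n"
      unfolding sum.distrib using F sum_var_Z_star_le[OF \<sigma> v, of n] th
      by (intro add_left_mono mult_right_mono) auto
    also have "(2 * (K * \<xi> ^ n) * V + V) * \<Theta> ^ n = 2 * K * V * \<theta> ^ n + V * \<Theta> ^ n"
      unfolding tn[symmetric] by (simp add: algebra_simps)
    also have "\<dots> \<le> 2 * K * V * \<theta> ^ n + V * \<theta> ^ n" using Tt V by (intro add_left_mono mult_left_mono)
    also have "\<dots> = (2 * K + 1) * V * \<theta> ^ n" by (simp add: algebra_simps)
    also have "L_iter \<sigma> n (\<lambda>_. q) y = q * L_iter \<sigma> n (\<lambda>_. 1) y"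
      using fun_cong[OF L_iter_cmult[of \<sigma> n q "\<lambda>_. 1"], of y] by simp
    finally show ?case by simp
  qed
  then have "Lambda \<sigma> u \<le> q + (2 * K + 1) * V * \<theta> ^ n / \<rho> ^ n"
    using K_nonneg V theta_pos by (intro Lambda_leI[OF \<sigma> u]) auto
  then show ?thesis by (simp add: power_divide)
qed

end

section \<open>Contraction of cones\<close>

lemma bvar_linear:
  assumes "bvar f S v" "bvar g S w"
  shows "bvar (\<lambda>x. a * f x + c * g x) S (\<bar>a\<bar> * v + \<bar>c\<bar> * w)"
  unfolding bvar_def
proof (intro allI impI)
  fix xs assume xs: "sorted xs \<and> set xs \<subseteq> S"
  have "lvar (\<lambda>x. a * f x + c * g x) xs \<le> \<bar>a\<bar> * lvar f xs + \<bar>c\<bar> * lvar g xs"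
    using lvar_add[of "\<lambda>x. a * f x" "\<lambda>x. c * g x" xs] by (simp add: lvar_cmult)
  also have "\<dots> \<le> \<bar>a\<bar> * v + \<bar>c\<bar> * w"
    using assms xs unfolding bvar_def by (intro add_mono mult_left_mono) auto
  finally show "lvar (\<lambda>x. a * f x + c * g x) xs \<le> \<bar>a\<bar> * v + \<bar>c\<bar> * w" .
qed

text \<open>The scale \<alpha> cancels and the quotients agree up to a factor 1 + s. The relative
  error becomes an absolute one because A' / B' is at most 1.\<close>

lemma ratio_diff_le:
  fixes A B A' B' \<alpha> s :: real
  assumes "0 < B" "0 < B'" "0 \<le> A'" "A' \<le> B'" "0 < \<alpha>" "0 \<le> s"
    and "\<alpha> * B' \<le> B" "B \<le> \<alpha> * (1 + s) * B'" "\<alpha> * A' \<le> A" "A \<le> \<alpha> * (1 + s) * A'"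
  shows "\<bar>A / B - A' / B'\<bar> \<le> s"
proof -
  have r: "0 \<le> A' / B'" "A' / B' \<le> 1" using assms by auto
  have "A / B \<le> (\<alpha> * (1 + s) * A') / (\<alpha> * B')"
    using assms by (intro frac_le) auto
  also have "\<dots> = (1 + s) * (A' / B')" using assms by simp
  finally have 1: "A / B - A' / B' \<le> s * (A' / B')" by (simp add: algebra_simps add_divide_distrib)
  have "s * (A' / B') \<le> s" using r assms by (intro mult_left_le) auto
  have "(\<alpha> * A') / (\<alpha> * (1 + s) * B') \<le> A / B"
    using assms by (intro frac_le) (auto intro: order_trans[of 0 "\<alpha> * A'" A])
  then have "(A' / B') / (1 + s) \<le> A / B" using assms by (simp add: mult.commute)
  then have "A' / B' \<le> (A / B) * (1 + s)" using assms(6) by (subst (asm) pos_divide_le_eq) auto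
  then have 2: "A' / B' \<le> A / B + s * (A / B)" 
    using distrib_left[of "A / B" 1 s] mult.commute[of s "A / B"] by linarith
  have 3: "s * (A / B) \<le> s" if "A / B \<le> A' / B'"
    using r(2) that order_trans by (intro mult_left_le assms(6)) blast
  show ?thesis
  proof (cases "A / B \<le> A' / B'")
    case True
    then show ?thesis using 2 3[OF True] by linarith
  next
    case False
    then show ?thesis using 1 \<open>s * (A' / B') \<le> s\<close> by linarith
  qed
qed

text \<open>The conditional probability of the next jump, expressed by the open product. It does not
  change when u is multiplied by a positive constant, so proportionality of densities is all that
  matters.\<close>

definition next_ratio :: "(nat \<Rightarrow> symb) \<Rightarrow> nat \<Rightarrow> (real \<Rightarrow> real) \<Rightarrow> real"
  where "next_ratio \<sigma> n u = (\<integral>x. L_iter \<sigma> (Suc n) u x \<partial>unit_leb) / (\<integral>x. L_iter \<sigma> n u x \<partial>unit_leb)"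

section \<open>Cones of controlled variation\<close>

context open_system
begin

text \<open>
  The variation is that of a representative: pointwise, \<open>L_iter \<sigma> n u\<close> has additional jumps at the
  images of the finitely many points where \<open>H_iter \<sigma> n\<close> degenerates.
\<close>

definition cone :: "(nat \<Rightarrow> symb) \<Rightarrow> real \<Rightarrow> (real \<Rightarrow> real) \<Rightarrow> bool"
  where "cone \<sigma> p u \<longleftrightarrow> ess_bounded u \<and> (AE x in unit_leb. 0 \<le> u x) \<and>
    (\<exists>v. (AE x in unit_leb. u x = v x) \<and> bvar v {0..1} (p * Lambda \<sigma> u))"

lemma coneI:
  assumes "ess_bounded u" "AE x in unit_leb. 0 \<le> u x" "AE x in unit_leb. u x = v x"
    "bvar v {0..1} (p * Lambda \<sigma> u)"
  shows "cone \<sigma> p u"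
  using assms unfolding cone_def by (intro conjI exI[of _ v])

lemma coneD:
  assumes "cone \<sigma> p u"
  shows "ess_bounded u" "AE x in unit_leb. 0 \<le> u x"
    "\<exists>v. (AE x in unit_leb. u x = v x) \<and> bvar v {0..1} (p * Lambda \<sigma> u)"
  using assms by (auto simp: cone_def)

lemma cone_Lambda_nonneg: "\<sigma> \<in> \<S> \<Longrightarrow> cone \<sigma> p u \<Longrightarrow> 0 \<le> Lambda \<sigma> u"
  using Lambda_nonneg coneD by blast

lemma cone_mono:
  assumes "\<sigma> \<in> \<S>" "cone \<sigma> p u" "p \<le> q"
  shows "cone \<sigma> q u"
proof -
  have "p * Lambda \<sigma> u \<le> q * Lambda \<sigma> u"
    using cone_Lambda_nonneg[OF assms(1,2)] assms(3) by (rule mult_right_mono[rotated])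
  then show ?thesis using assms(2) bvar_le unfolding cone_def by blast
qed

lemma cone_scale:
  assumes \<sigma>: "\<sigma> \<in> \<S>" and u: "cone \<sigma> p u" and c: "0 \<le> c" and p: "0 \<le> p"
  shows "cone \<sigma> p (\<lambda>x. c * u x)"
proof -
  obtain v where v: "AE x in unit_leb. u x = v x" "bvar v {0..1} (p * Lambda \<sigma> u)" using coneD(3)[OF u] by blast
  have b: "bvar (\<lambda>x. c * v x) {0..1} (c * (p * Lambda \<sigma> u))"
    using bvar_linear[OF v(2) v(2), of c 0] c by simp
  have "c * (p * Lambda \<sigma> u) \<le> p * Lambda \<sigma> (\<lambda>x. c * u x)"
    using mult_left_mono[OF Lambda_cmult_ge[OF \<sigma> coneD(1)[OF u] c] p] by (simp add: mult.left_commute)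
  with b have bb: "bvar (\<lambda>x. c * v x) {0..1} (p * Lambda \<sigma> (\<lambda>x. c * u x))" by (rule bvar_le)
  have e: "AE x in unit_leb. c * u x = c * v x" using v(1) by eventually_elim simp
  have "AE x in unit_leb. 0 \<le> c * u x" using coneD(2)[OF u] by eventually_elim (use c in simp)
  from coneI[OF ess_bounded_cmult[OF coneD(1)[OF u]] this e bb] show ?thesis .
qed

lemma cone_sup_le:
  assumes \<sigma>: "\<sigma> \<in> \<S>" and u: "cone \<sigma> p u"
  shows "AE x in unit_leb. u x \<le> (1 + p) * Lambda \<sigma> u"
proof -
  obtain v where v: "AE x in unit_leb. u x = v x" "bvar v {0..1} (p * Lambda \<sigma> u)" using coneD(3)[OF u] by blast
  have "AE x in unit_leb. x \<in> {0..1}" by (rule AE_unit_leb_finiteI[of "{}"]) auto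
  then show ?thesis using v(1)
  proof eventually_elim
    case (elim x)
    then show ?case using bvar_le_Lambda[OF \<sigma> coneD(1)[OF u] v(1) coneD(2)[OF u] v(2), of x]
      by (simp add: algebra_simps)
  qed
qed

lemma integral_L_iter_Suc:
  assumes \<sigma>: "\<sigma> \<in> \<S>" and u: "ess_bounded u" and nn: "AE x in unit_leb. 0 \<le> u x"
  shows "0 \<le> (\<integral>x. L_iter \<sigma> (Suc n) u x \<partial>unit_leb)"
    "(\<integral>x. L_iter \<sigma> (Suc n) u x \<partial>unit_leb) \<le> (\<integral>x. L_iter \<sigma> n u x \<partial>unit_leb)"
proof -
  interpret expanding_map "fst (\<sigma> n)" lam using \<sigma> by (rule expanding_map_at)
  show "0 \<le> (\<integral>x. L_iter \<sigma> (Suc n) u x \<partial>unit_leb)"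
    using AE_L_iter_nonneg[OF \<sigma> nn] by (rule integral_nonneg_AE)
  let ?\<phi> = "\<lambda>x. L_iter \<sigma> n u x * indicator (snd (\<sigma> n)) x"
  have H: "snd (\<sigma> n) \<in> HH" using symbol_seqs_in[OF \<sigma>, of n] by auto
  have b: "ess_bounded ?\<phi>"
    by (intro ess_bounded_mult ess_bounded_L_iter ess_bounded_indicator hole_measurable \<sigma> u H)
  have "(\<integral>x. L_iter \<sigma> (Suc n) u x \<partial>unit_leb) = (\<integral>x. ?\<phi> x \<partial>unit_leb)"
    using integrable_transfer(2)[OF ess_bounded_integrable[OF b]] by (simp add: open_transfer_def)
  also have "\<dots> \<le> (\<integral>x. L_iter \<sigma> n u x \<partial>unit_leb)"
    using AE_L_iter_nonneg[OF \<sigma> nn, of n]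
    by (intro integral_mono_AE ess_bounded_integrable b ess_bounded_L_iter \<sigma> u)
       (auto elim!: eventually_mono simp: indicator_def)
  finally show "(\<integral>x. L_iter \<sigma> (Suc n) u x \<partial>unit_leb) \<le> (\<integral>x. L_iter \<sigma> n u x \<partial>unit_leb)" .
qed

text \<open>An iterate with integral 0 would vanish almost everywhere and have \<open>Lambda\<close>
  at most 0, whereas \<open>Lambda\<close> of the n-th iterate is at least \<rho>^n times that of
  u.\<close>

lemma integral_L_iter_pos:
  assumes \<sigma>: "\<sigma> \<in> \<S>" and u: "ess_bounded u" and nn: "AE x in unit_leb. 0 \<le> u x" and L: "0 < Lambda \<sigma> u"
  shows "0 < (\<integral>x. L_iter \<sigma> n u x \<partial>unit_leb)"
proof (rule ccontr)
  assume np: "\<not> ?thesis"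
  have b: "ess_bounded (L_iter \<sigma> n u)" using \<sigma> u by (rule ess_bounded_L_iter)
  have nn': "AE x in unit_leb. 0 \<le> L_iter \<sigma> n u x" using \<sigma> nn by (rule AE_L_iter_nonneg)
  have "(\<integral>x. L_iter \<sigma> n u x \<partial>unit_leb) = 0"
    using np integral_nonneg_AE[OF nn'] by linarith
  then have "AE x in unit_leb. L_iter \<sigma> n u x = 0"
    using integral_nonneg_eq_0_iff_AE[OF ess_bounded_integrable[OF b] nn'] by simp
  then have "AE x in unit_leb. L_iter \<sigma> n u x \<le> 0" by eventually_elim simp
  then have "Lambda (shift_by n \<sigma>) (L_iter \<sigma> n u) \<le> 0"
    using shift_by_in_symbol_seqs[OF \<sigma>] b by (intro Lambda_le_const)
  then have "\<rho> ^ n * Lambda \<sigma> u \<le> 0" using Lambda_L_iter_ge[OF \<sigma> u nn, of n] by linarith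
  moreover have "0 < \<rho> ^ n * Lambda \<sigma> u" using L rho_pos by simp
  ultimately show False by linarith
qed

end

text \<open>What the contraction argument needs from the estimates. Aperture b becomes b / 12 + (b -
  1) / 2, below 7 b / 12; \<open>P\<close> controls the aperture during an incomplete block, and the
  lower bound with \<open>\<eta>\<close> is what (C3) provides.\<close>

locale contracting_open_system = open_system +
  fixes n\<^sub>0 n\<^sub>3 :: nat and b \<eta> :: real and P :: "real \<Rightarrow> real"
  assumes n0: "1 \<le> n\<^sub>0" and n3: "1 \<le> n\<^sub>3" and b: "1 \<le> b" and eta: "0 < \<eta>" "\<eta> \<le> 1"
    and cone_invariant: "\<And>\<sigma> p u. \<sigma> \<in> symbol_seqs TT HH \<Longrightarrow> 0 \<le> p \<Longrightarrow> cone \<sigma> p u \<Longrightarrow>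
      cone (shift_by n\<^sub>0 \<sigma>) (p / 12 + (b - 1) / 2) (L_iter \<sigma> n\<^sub>0 u)"
    and cone_lower: "\<And>\<sigma> u. \<sigma> \<in> symbol_seqs TT HH \<Longrightarrow> cone \<sigma> b u \<Longrightarrow>
      AE x in unit_leb. \<eta> * Lambda \<sigma> u * L_iter \<sigma> n\<^sub>3 (\<lambda>_. 1) x \<le> L_iter \<sigma> n\<^sub>3 u x"
    and cone_short: "\<And>\<sigma> p u r. \<sigma> \<in> symbol_seqs TT HH \<Longrightarrow> 0 \<le> p \<Longrightarrow> cone \<sigma> p u \<Longrightarrow> r \<le> n\<^sub>0 \<Longrightarrow>
      cone (shift_by r \<sigma>) (P p) (L_iter \<sigma> r u)"
    and P_nonneg: "\<And>p. 0 \<le> p \<Longrightarrow> 0 \<le> P p"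
begin

text \<open>While the aperture is at least b, the summand (b - 1) / 2 is at most half of it, so a
  block reduces it by the factor 7/12.\<close>

lemma cone_L_iter_blocks:
  assumes \<sigma>: "\<sigma> \<in> \<S>" and p: "0 \<le> p" and u: "cone \<sigma> p u"
  shows "cone (shift_by (n\<^sub>0 * k) \<sigma>) (max b ((7 / 12) ^ k * p)) (L_iter \<sigma> (n\<^sub>0 * k) u)"
proof (induction k)
  case 0
  then show ?case using cone_mono[OF \<sigma> u, of "max b p"] by simp
next
  case (Suc k)
  let ?q = "max b ((7 / 12) ^ k * p)"
  have q: "b \<le> ?q" "0 \<le> ?q" using b by auto
  have s: "shift_by (n\<^sub>0 * k) \<sigma> \<in> \<S>" using \<sigma> by (rule shift_by_in_symbol_seqs)
  have "cone (shift_by n\<^sub>0 (shift_by (n\<^sub>0 * k) \<sigma>)) (?q / 12 + (b - 1) / 2) (L_iter (shift_by (n\<^sub>0 * k) \<sigma>) n\<^sub>0 (L_iter \<sigma> (n\<^sub>0 * k) u))"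
    using s q(2) Suc by (rule cone_invariant)
  then have "cone (shift_by (n\<^sub>0 * Suc k) \<sigma>) (?q / 12 + (b - 1) / 2) (L_iter \<sigma> (n\<^sub>0 * Suc k) u)"
    by (simp add: shift_by_shift_by L_iter_add[symmetric] add.commute)
  moreover have "?q / 12 + (b - 1) / 2 \<le> 7 / 12 * ?q" using q by simp
  moreover have "7 / 12 * ?q \<le> max b ((7 / 12) ^ Suc k * p)" using b by (auto simp: max_def)
  ultimately show ?case using shift_by_in_symbol_seqs[OF \<sigma>] by (meson cone_mono order_trans)
qed

text \<open>A multiple of \<open>n\<^sub>0\<close>, for the invariance of the cone, and at least
  \<open>n\<^sub>3\<close>, for the lower bound.\<close>

definition N\<^sub>1 :: nat where "N\<^sub>1 = n\<^sub>0 * n\<^sub>3"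

lemma N1: "1 \<le> N\<^sub>1" "n\<^sub>3 \<le> N\<^sub>1"
  using n0 n3 by (auto simp: N\<^sub>1_def)

lemma cone_L_iter_block:
  assumes \<sigma>: "\<sigma> \<in> \<S>" and u: "cone \<sigma> b u"
  shows "cone (shift_by N\<^sub>1 \<sigma>) (7 / 12 * b) (L_iter \<sigma> N\<^sub>1 u)"
proof -
  obtain k where k: "n\<^sub>3 = Suc k" using n3 by (cases n\<^sub>3) auto
  have N: "N\<^sub>1 = n\<^sub>0 * k + n\<^sub>0" unfolding N\<^sub>1_def unfolding k by simp
  have s: "shift_by (n\<^sub>0 * k) \<sigma> \<in> \<S>" using \<sigma> by (rule shift_by_in_symbol_seqs)
  have "(7 / 12) ^ k * b \<le> b" using b by (simp add: mult_left_le_one_le power_le_one)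
  then have "cone (shift_by (n\<^sub>0 * k) \<sigma>) b (L_iter \<sigma> (n\<^sub>0 * k) u)"
    using cone_L_iter_blocks[OF \<sigma> _ u, of k] b by (simp add: max_def split: if_splits)
  then have "cone (shift_by n\<^sub>0 (shift_by (n\<^sub>0 * k) \<sigma>)) (b / 12 + (b - 1) / 2) (L_iter (shift_by (n\<^sub>0 * k) \<sigma>) n\<^sub>0 (L_iter \<sigma> (n\<^sub>0 * k) u))"
    using s b by (intro cone_invariant) auto
  then have "cone (shift_by N\<^sub>1 \<sigma>) (b / 12 + (b - 1) / 2) (L_iter \<sigma> N\<^sub>1 u)"
    by (simp add: shift_by_shift_by L_iter_add[symmetric] N)
  then show ?thesis by (rule cone_mono[OF shift_by_in_symbol_seqs[OF \<sigma>]]) simp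
qed

text \<open>The lower bound is given after \<open>n\<^sub>3\<close> steps and persists because
  \<open>ratio_inf\<close> increases; the upper bound is the supremum bound in the cone.\<close>

lemma block_bounds:
  assumes \<sigma>: "\<sigma> \<in> \<S>" and u: "cone \<sigma> b u"
  shows "AE x in unit_leb. \<eta> * Lambda \<sigma> u * L_iter \<sigma> N\<^sub>1 (\<lambda>_. 1) x \<le> L_iter \<sigma> N\<^sub>1 u x"
    and "AE x in unit_leb. L_iter \<sigma> N\<^sub>1 u x \<le> (1 + b) * Lambda \<sigma> u * L_iter \<sigma> N\<^sub>1 (\<lambda>_. 1) x"
proof -
  have "\<eta> * Lambda \<sigma> u \<le> ratio_inf \<sigma> n\<^sub>3 u"
    using cone_lower[OF \<sigma> u] le_ratio_inf_iff[OF \<sigma> coneD(1)[OF u]] by blast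
  also have "\<dots> \<le> ratio_inf \<sigma> N\<^sub>1 u" using incseq_ratio_inf[OF \<sigma> coneD(1)[OF u]] N1(2) by (rule incseqD)
  finally show "AE x in unit_leb. \<eta> * Lambda \<sigma> u * L_iter \<sigma> N\<^sub>1 (\<lambda>_. 1) x \<le> L_iter \<sigma> N\<^sub>1 u x"
    using le_ratio_inf_iff[OF \<sigma> coneD(1)[OF u]] by blast
  have "AE x in unit_leb. u x \<le> (1 + b) * Lambda \<sigma> u * 1" using cone_sup_le[OF \<sigma> u] by simp
  from AE_L_iter_mono[OF \<sigma> this, of N\<^sub>1]
  show "AE x in unit_leb. L_iter \<sigma> N\<^sub>1 u x \<le> (1 + b) * Lambda \<sigma> u * L_iter \<sigma> N\<^sub>1 (\<lambda>_. 1) x"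
    by (simp only: L_iter_cmult)
qed

text \<open>Here 5/12 is the slack 1 - 7/12 in the aperture after a block. The factor 1 + b bounds
  the subtracted image by the image of 1; the factor 2 + b pays for its variation and for the loss
  in \<open>Lambda\<close> of the difference.\<close>

definition \<kappa> :: real where "\<kappa> = 5 * \<eta> / (12 * (1 + b) * (2 + b))"

lemma kappa: "0 < \<kappa>" "\<kappa> \<le> 1" "\<kappa> * (1 + b) \<le> \<eta>" "\<kappa> * (1 + b) * (2 + b) = 5 / 12 * \<eta>"
proof -
  show p: "0 < \<kappa>" using eta b by (simp add: \<kappa>_def)
  show e: "\<kappa> * (1 + b) * (2 + b) = 5 / 12 * \<eta>" 
  proof -
    have "5 * \<eta> / (12 * X * Y) * X * Y = 5 / 12 * \<eta>" if "X \<noteq> 0" "Y \<noteq> 0" for X Y :: real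
      using that by simp
    from this[of "1 + b" "2 + b"] show ?thesis using b unfolding \<kappa>_def by simp
  qed
  have "\<kappa> * (1 + b) * 1 \<le> \<kappa> * (1 + b) * (2 + b)" using p b by (intro mult_left_mono) auto
  then show *: "\<kappa> * (1 + b) \<le> \<eta>" using e eta by linarith
  have "\<kappa> * 1 \<le> \<kappa> * (1 + b)" using p b by (intro mult_left_mono) auto
  then show "\<kappa> \<le> 1" using * eta by linarith
qed

text \<open>
  A block maps the cone into a part of it from which a definite multiple of any other such image can
  be subtracted: this replaces the estimate of the diameter in the Hilbert metric.
\<close>

lemma cone_diff:
  assumes \<sigma>: "\<sigma> \<in> \<S>" and u: "cone \<sigma> b u" and v: "cone \<sigma> b v" and Lv: "0 < Lambda \<sigma> v"
    and t: "t = \<kappa> * Lambda \<sigma> u / Lambda \<sigma> v"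
  shows "cone (shift_by N\<^sub>1 \<sigma>) b (\<lambda>x. L_iter \<sigma> N\<^sub>1 u x - t * L_iter \<sigma> N\<^sub>1 v x)"
proof -
  let ?\<tau> = "shift_by N\<^sub>1 \<sigma>" and ?u = "L_iter \<sigma> N\<^sub>1 u" and ?v = "L_iter \<sigma> N\<^sub>1 v" and ?one = "L_iter \<sigma> N\<^sub>1 (\<lambda>_. 1)"
  have \<tau>: "?\<tau> \<in> \<S>" using \<sigma> by (rule shift_by_in_symbol_seqs)
  have Lu: "0 \<le> Lambda \<sigma> u" using \<sigma> u by (rule cone_Lambda_nonneg)
  have t0: "0 \<le> t" using t Lu Lv kappa by simp
  have tv: "t * Lambda \<sigma> v = \<kappa> * Lambda \<sigma> u" using t Lv by simp
  have cu: "cone ?\<tau> (7 / 12 * b) ?u" and cv: "cone ?\<tau> (7 / 12 * b) ?v"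
    using cone_L_iter_block[OF \<sigma>] u v by auto
  have bd: "ess_bounded ?u" "ess_bounded ?v" "ess_bounded ?one"
    using coneD(1)[OF cu] coneD(1)[OF cv] ess_bounded_L_iter[OF \<sigma> ess_bounded_const] by auto
  have bdd: "ess_bounded (\<lambda>x. ?u x - t * ?v x)" using bd by (intro ess_bounded_diff ess_bounded_cmult)
  have nn: "AE x in unit_leb. 0 \<le> ?u x - t * ?v x"
    using block_bounds(1)[OF \<sigma> u] block_bounds(2)[OF \<sigma> v] AE_L_iter_one_pos[OF \<sigma>, of N\<^sub>1]
  proof eventually_elim
    case (elim x)
    have "t * ?v x \<le> t * ((1 + b) * Lambda \<sigma> v * ?one x)" using elim(2) t0 by (rule mult_left_mono)
    also have "\<dots> = (t * Lambda \<sigma> v) * ((1 + b) * ?one x)" by (simp only: mult_ac)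
    also have "\<dots> = \<kappa> * (1 + b) * (Lambda \<sigma> u * ?one x)" unfolding tv by (simp only: mult_ac)
    also have "\<dots> \<le> \<eta> * (Lambda \<sigma> u * ?one x)" using kappa(3) Lu elim(3) by (intro mult_right_mono) auto
    finally show ?case using elim(1) by (simp add: mult.assoc)
  qed
  let ?R = "Lambda ?\<tau> ?one"
  have one_nn: "AE x in unit_leb. 0 \<le> ?one x" using AE_L_iter_one_pos[OF \<sigma>, of N\<^sub>1] by eventually_elim simp
  have R: "0 \<le> ?R" using \<tau> bd(3) one_nn by (rule Lambda_nonneg)
  have Lu': "\<eta> * Lambda \<sigma> u * ?R \<le> Lambda ?\<tau> ?u"
    using Lambda_cmult_ge[OF \<tau> bd(3), of "\<eta> * Lambda \<sigma> u"] Lu eta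
      Lambda_mono[OF \<tau> ess_bounded_cmult[OF bd(3)] bd(1) block_bounds(1)[OF \<sigma> u]] by simp
  \<comment> \<open>For positive factors \<open>Lambda\<close> is only known to be superhomogeneous,
    so the image of v is scaled down before monotonicity is applied.\<close>
  have Lv': "Lambda ?\<tau> ?v \<le> (1 + b) * Lambda \<sigma> v * ?R"
  proof -
    have pos: "0 < (1 + b) * Lambda \<sigma> v" using b Lv by simp
    have "1 / ((1 + b) * Lambda \<sigma> v) * Lambda ?\<tau> ?v \<le> Lambda ?\<tau> (\<lambda>x. 1 / ((1 + b) * Lambda \<sigma> v) * ?v x)"
      using \<tau> bd(2) by (rule Lambda_cmult_ge) (use pos in simp)
    also have "\<dots> \<le> ?R"
    proof (rule Lambda_mono[OF \<tau> ess_bounded_cmult[OF bd(2)] bd(3)])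
      show "AE x in unit_leb. 1 / ((1 + b) * Lambda \<sigma> v) * ?v x \<le> ?one x"
        using block_bounds(2)[OF \<sigma> v]
        by eventually_elim (use pos in \<open>simp add: pos_divide_le_eq mult.commute\<close>)
    qed
    finally have "Lambda ?\<tau> ?v / ((1 + b) * Lambda \<sigma> v) \<le> ?R" by simp
    then show ?thesis using pos by (simp add: pos_divide_le_eq mult.commute)
  qed
  have Lv0: "0 \<le> Lambda ?\<tau> ?v" using \<tau> cv by (rule cone_Lambda_nonneg)
  have key: "t * (2 + b) * Lambda ?\<tau> ?v \<le> 5 / 12 * Lambda ?\<tau> ?u"
  proof -
    have "t * (2 + b) * Lambda ?\<tau> ?v \<le> t * (2 + b) * ((1 + b) * Lambda \<sigma> v * ?R)"
      using Lv' t0 b by (intro mult_left_mono) auto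
    also have "\<dots> = (t * Lambda \<sigma> v) * ((1 + b) * (2 + b)) * ?R" by (simp add: algebra_simps)
    also have "\<dots> = (\<kappa> * (1 + b) * (2 + b)) * (Lambda \<sigma> u * ?R)" unfolding tv by (simp add: algebra_simps)
    also have "\<dots> = 5 / 12 * (\<eta> * Lambda \<sigma> u * ?R)" unfolding kappa(4) by simp
    also have "\<dots> \<le> 5 / 12 * Lambda ?\<tau> ?u" using Lu' by simp
    finally show ?thesis .
  qed
  \<comment> \<open>In place of linearity, the subtracted term is bounded below by a constant, minus
    its supremum bound, and superadditivity does the rest.\<close>
  have LD: "Lambda ?\<tau> ?u - t * (1 + b) * Lambda ?\<tau> ?v \<le> Lambda ?\<tau> (\<lambda>x. ?u x - t * ?v x)"
  proof -
    have "cone ?\<tau> b ?v" using cone_mono[OF \<tau> cv, of b] b by simp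
    from cone_sup_le[OF \<tau> this]
    have "AE x in unit_leb. - (t * (1 + b) * Lambda ?\<tau> ?v) \<le> - t * ?v x"
    proof eventually_elim
      case (elim x)
      from mult_left_mono[OF elim t0] show ?case by (simp add: mult.assoc)
    qed
    then have "- (t * (1 + b) * Lambda ?\<tau> ?v) \<le> Lambda ?\<tau> (\<lambda>x. - t * ?v x)"
      by (rule const_le_Lambda[OF \<tau> ess_bounded_cmult[OF bd(2)]])
    moreover have "Lambda ?\<tau> ?u + Lambda ?\<tau> (\<lambda>x. - t * ?v x) \<le> Lambda ?\<tau> (\<lambda>x. ?u x + - t * ?v x)"
      using \<tau> bd(1) ess_bounded_cmult[OF bd(2)] by (rule Lambda_superadditive)
    ultimately show ?thesis by simp
  qed
  obtain u' where u': "AE x in unit_leb. ?u x = u' x" "bvar u' {0..1} (7 / 12 * b * Lambda ?\<tau> ?u)"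
    using coneD(3)[OF cu] by blast
  obtain v' where v': "AE x in unit_leb. ?v x = v' x" "bvar v' {0..1} (7 / 12 * b * Lambda ?\<tau> ?v)"
    using coneD(3)[OF cv] by blast
  have "bvar (\<lambda>x. u' x - t * v' x) {0..1} (7 / 12 * b * Lambda ?\<tau> ?u + t * (7 / 12 * b * Lambda ?\<tau> ?v))"
    using bvar_linear[OF u'(2) v'(2), of 1 "- t"] t0 by simp
  moreover have "7 / 12 * b * Lambda ?\<tau> ?u + t * (7 / 12 * b * Lambda ?\<tau> ?v) \<le> b * Lambda ?\<tau> (\<lambda>x. ?u x - t * ?v x)"
  proof -
    \<comment> \<open>This amounts to t (1 + b + 7/12) times \<open>Lambda\<close> of the second
      image being at most 5/12 of that of the first; \<open>key\<close> has 2 + b instead and leaves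
      room.\<close>
    have "7 / 12 * Lambda ?\<tau> ?u + 7 / 12 * (t * Lambda ?\<tau> ?v) \<le> Lambda ?\<tau> ?u - t * (1 + b) * Lambda ?\<tau> ?v"
      using key mult_nonneg_nonneg[OF t0 Lv0] by (simp add: algebra_simps)
    then have "7 / 12 * Lambda ?\<tau> ?u + 7 / 12 * (t * Lambda ?\<tau> ?v) \<le> Lambda ?\<tau> (\<lambda>x. ?u x - t * ?v x)"
      using LD by linarith
    then have "b * (7 / 12 * Lambda ?\<tau> ?u + 7 / 12 * (t * Lambda ?\<tau> ?v)) \<le> b * Lambda ?\<tau> (\<lambda>x. ?u x - t * ?v x)"
      using b by (intro mult_left_mono) auto
    then show ?thesis by (simp add: algebra_simps)
  qed
  ultimately have bb: "bvar (\<lambda>x. u' x - t * v' x) {0..1} (b * Lambda ?\<tau> (\<lambda>x. ?u x - t * ?v x))" by (rule bvar_le)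
  have "AE x in unit_leb. ?u x - t * ?v x = u' x - t * v' x"
    using u'(1) v'(1) by eventually_elim simp
  from coneI[OF bdd nn this bb] show ?thesis .
qed

text \<open>The relative amount by which a block narrows the gap between the two constants of
  proportionality.\<close>

definition \<gamma> :: real where "\<gamma> = \<kappa> / (1 + b)"

lemma gamma: "0 < \<gamma>" "\<gamma> < 1"
  using kappa b by (auto simp: \<gamma>_def pos_divide_less_eq)

text \<open>After a block a multiple of the image of g can be subtracted from the images of both
  differences by \<open>cone_diff\<close>. This raises \<alpha> and lowers \<beta>.\<close>

lemma cone_pair_step:
  assumes \<sigma>: "\<sigma> \<in> \<S>" and g: "cone \<sigma> b g" "0 < Lambda \<sigma> g"
    and x: "cone \<sigma> b (\<lambda>x. f x - \<alpha> * g x)" and y: "cone \<sigma> b (\<lambda>x. \<beta> * g x - f x)"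
  shows "\<exists>\<alpha>' \<beta>'. \<alpha> \<le> \<alpha>' \<and> \<beta>' - \<alpha>' \<le> (1 - \<gamma>) * (\<beta> - \<alpha>) \<and>
    cone (shift_by N\<^sub>1 \<sigma>) b (\<lambda>x. L_iter \<sigma> N\<^sub>1 f x - \<alpha>' * L_iter \<sigma> N\<^sub>1 g x) \<and>
    cone (shift_by N\<^sub>1 \<sigma>) b (\<lambda>x. \<beta>' * L_iter \<sigma> N\<^sub>1 g x - L_iter \<sigma> N\<^sub>1 f x)"
proof -
  let ?X = "\<lambda>x. f x - \<alpha> * g x" and ?Y = "\<lambda>x. \<beta> * g x - f x"
  define s where "s = \<kappa> * Lambda \<sigma> ?X / Lambda \<sigma> g"
  define t where "t = \<kappa> * Lambda \<sigma> ?Y / Lambda \<sigma> g"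
  have LX: "0 \<le> Lambda \<sigma> ?X" and LY: "0 \<le> Lambda \<sigma> ?Y" using \<sigma> x y by (auto intro: cone_Lambda_nonneg)
  have st: "0 \<le> s" "0 \<le> t" using LX LY g kappa by (auto simp: s_def t_def)
  have "cone (shift_by N\<^sub>1 \<sigma>) b (\<lambda>x. L_iter \<sigma> N\<^sub>1 ?X x - s * L_iter \<sigma> N\<^sub>1 g x)"
    using \<sigma> x g s_def by (rule cone_diff)
  then have cx: "cone (shift_by N\<^sub>1 \<sigma>) b (\<lambda>x. L_iter \<sigma> N\<^sub>1 f x - (\<alpha> + s) * L_iter \<sigma> N\<^sub>1 g x)"
    by (simp add: L_iter_diff L_iter_cmult algebra_simps)
  have "cone (shift_by N\<^sub>1 \<sigma>) b (\<lambda>x. L_iter \<sigma> N\<^sub>1 ?Y x - t * L_iter \<sigma> N\<^sub>1 g x)"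
    using \<sigma> y g t_def by (rule cone_diff)
  then have cy: "cone (shift_by N\<^sub>1 \<sigma>) b (\<lambda>x. (\<beta> - t) * L_iter \<sigma> N\<^sub>1 g x - L_iter \<sigma> N\<^sub>1 f x)"
    by (simp add: L_iter_diff L_iter_cmult algebra_simps)
  have "\<gamma> * (\<beta> - \<alpha>) \<le> s + t"
  proof (cases "\<alpha> \<le> \<beta>")
    case True
    \<comment> \<open>The two differences add up to (\<beta> - \<alpha>) g. Their sum is estimated
      by its supremum, as subadditivity of \<open>Lambda\<close> is not at hand; this costs 1 + b
      and explains the denominator of \<gamma>.\<close>
    have "(\<beta> - \<alpha>) * Lambda \<sigma> g \<le> Lambda \<sigma> (\<lambda>x. (\<beta> - \<alpha>) * g x)"
      using \<sigma> coneD(1)[OF g(1)] by (rule Lambda_cmult_ge) (use True in simp)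
    also have "\<dots> \<le> (1 + b) * (Lambda \<sigma> ?X + Lambda \<sigma> ?Y)"
    proof (rule Lambda_le_const[OF \<sigma> ess_bounded_cmult[OF coneD(1)[OF g(1)]]])
      show "AE x in unit_leb. (\<beta> - \<alpha>) * g x \<le> (1 + b) * (Lambda \<sigma> ?X + Lambda \<sigma> ?Y)"
        using cone_sup_le[OF \<sigma> x] cone_sup_le[OF \<sigma> y] by eventually_elim (simp add: algebra_simps)
    qed
    finally have "(\<beta> - \<alpha>) / (1 + b) \<le> (Lambda \<sigma> ?X + Lambda \<sigma> ?Y) / Lambda \<sigma> g"
      using b g by (simp add: field_simps)
    then have "\<kappa> * ((\<beta> - \<alpha>) / (1 + b)) \<le> \<kappa> * ((Lambda \<sigma> ?X + Lambda \<sigma> ?Y) / Lambda \<sigma> g)"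
      using kappa(1) by (intro mult_left_mono) auto
    then show ?thesis by (simp add: \<gamma>_def s_def t_def add_divide_distrib distrib_left)
  next
    case False
    then have "\<gamma> * (\<beta> - \<alpha>) \<le> 0" using gamma by (intro mult_nonneg_nonpos) auto
    then show ?thesis using st by linarith
  qed
  then have "\<beta> - t - (\<alpha> + s) \<le> (1 - \<gamma>) * (\<beta> - \<alpha>)" by (simp add: algebra_simps)
  then show ?thesis using cx cy st(1) by (intro exI[of _ "\<alpha> + s"] exI[of _ "\<beta> - t"]) auto
qed

lemma Lambda_L_iter_pos:
  assumes \<sigma>: "\<sigma> \<in> \<S>" and u: "cone \<sigma> p u" and L: "0 < Lambda \<sigma> u"
  shows "0 < Lambda (shift_by n \<sigma>) (L_iter \<sigma> n u)"
proof -
  have "0 < \<rho> ^ n * Lambda \<sigma> u" using L rho_pos by simp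
  then show ?thesis using Lambda_L_iter_ge[OF \<sigma> coneD(1,2)[OF u], of n] by linarith
qed

lemma cone_pair_iterate:
  assumes \<sigma>: "\<sigma> \<in> \<S>" and f: "cone \<sigma> b f" "0 < Lambda \<sigma> f" and g: "cone \<sigma> b g" "0 < Lambda \<sigma> g"
  defines "r \<equiv> Lambda \<sigma> f / Lambda \<sigma> g"
  shows "\<exists>\<alpha> \<beta>. \<kappa> * r \<le> \<alpha> \<and> \<beta> - \<alpha> \<le> (1 - \<gamma>) ^ j * (r / \<kappa>) \<and>
    cone (shift_by (N\<^sub>1 * Suc j) \<sigma>) b (\<lambda>x. L_iter \<sigma> (N\<^sub>1 * Suc j) f x - \<alpha> * L_iter \<sigma> (N\<^sub>1 * Suc j) g x) \<and>
    cone (shift_by (N\<^sub>1 * Suc j) \<sigma>) b (\<lambda>x. \<beta> * L_iter \<sigma> (N\<^sub>1 * Suc j) g x - L_iter \<sigma> (N\<^sub>1 * Suc j) f x) \<and>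
    cone (shift_by (N\<^sub>1 * Suc j) \<sigma>) b (L_iter \<sigma> (N\<^sub>1 * Suc j) g)"
proof (induction j)
  case 0
  let ?\<tau> = "shift_by N\<^sub>1 \<sigma>"
  have \<tau>: "?\<tau> \<in> \<S>" using \<sigma> by (rule shift_by_in_symbol_seqs)
  have r: "0 < r" using f g by (simp add: r_def)
  \<comment> \<open>The first block creates the two constants: \<open>cone_diff\<close> is applied
    to f and g, and then with the roles exchanged; scaling the second difference by r / \<kappa>
    gives the upper one.\<close>
  have "cone ?\<tau> b (\<lambda>x. L_iter \<sigma> N\<^sub>1 f x - (\<kappa> * r) * L_iter \<sigma> N\<^sub>1 g x)"
    by (rule cone_diff[OF \<sigma> f(1) g]) (simp add: r_def)
  moreover have "cone ?\<tau> b (\<lambda>x. L_iter \<sigma> N\<^sub>1 g x - (\<kappa> / r) * L_iter \<sigma> N\<^sub>1 f x)"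
    by (rule cone_diff[OF \<sigma> g(1) f]) (simp add: r_def)
  from cone_scale[OF \<tau> this, of "r / \<kappa>"]
  have "cone ?\<tau> b (\<lambda>x. (r / \<kappa>) * L_iter \<sigma> N\<^sub>1 g x - L_iter \<sigma> N\<^sub>1 f x)"
    using r kappa b by (simp add: right_diff_distrib)
  moreover have "cone ?\<tau> b (L_iter \<sigma> N\<^sub>1 g)"
    using cone_mono[OF \<tau> cone_L_iter_block[OF \<sigma> g(1)], of b] b by simp
  moreover have "r / \<kappa> - \<kappa> * r \<le> r / \<kappa>" using r kappa by simp
  ultimately show ?case by (intro exI[of _ "\<kappa> * r"] exI[of _ "r / \<kappa>"]) simp
next
  case (Suc j)
  let ?M = "N\<^sub>1 * Suc j"
  let ?\<tau> = "shift_by ?M \<sigma>"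
  have \<tau>: "?\<tau> \<in> \<S>" using \<sigma> by (rule shift_by_in_symbol_seqs)
  obtain \<alpha> \<beta> where ab: "\<kappa> * r \<le> \<alpha>" "\<beta> - \<alpha> \<le> (1 - \<gamma>) ^ j * (r / \<kappa>)"
    "cone ?\<tau> b (\<lambda>x. L_iter \<sigma> ?M f x - \<alpha> * L_iter \<sigma> ?M g x)"
    "cone ?\<tau> b (\<lambda>x. \<beta> * L_iter \<sigma> ?M g x - L_iter \<sigma> ?M f x)"
    "cone ?\<tau> b (L_iter \<sigma> ?M g)"
    using Suc.IH by blast
  have eq: "shift_by N\<^sub>1 ?\<tau> = shift_by (N\<^sub>1 * Suc (Suc j)) \<sigma>"
    "\<And>\<phi>. L_iter ?\<tau> N\<^sub>1 (L_iter \<sigma> ?M \<phi>) = L_iter \<sigma> (N\<^sub>1 * Suc (Suc j)) \<phi>"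
    by (simp_all add: shift_by_shift_by L_iter_add[symmetric] add.commute add.left_commute)
  obtain \<alpha>' \<beta>' where ab': "\<alpha> \<le> \<alpha>'" "\<beta>' - \<alpha>' \<le> (1 - \<gamma>) * (\<beta> - \<alpha>)"
    "cone (shift_by N\<^sub>1 ?\<tau>) b (\<lambda>x. L_iter ?\<tau> N\<^sub>1 (L_iter \<sigma> ?M f) x - \<alpha>' * L_iter ?\<tau> N\<^sub>1 (L_iter \<sigma> ?M g) x)"
    "cone (shift_by N\<^sub>1 ?\<tau>) b (\<lambda>x. \<beta>' * L_iter ?\<tau> N\<^sub>1 (L_iter \<sigma> ?M g) x - L_iter ?\<tau> N\<^sub>1 (L_iter \<sigma> ?M f) x)"
    using cone_pair_step[OF \<tau> ab(5) Lambda_L_iter_pos[OF \<sigma> g] ab(3,4)] by blast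
  have "cone (shift_by N\<^sub>1 ?\<tau>) b (L_iter ?\<tau> N\<^sub>1 (L_iter \<sigma> ?M g))"
    using cone_mono[OF shift_by_in_symbol_seqs[OF \<tau>] cone_L_iter_block[OF \<tau> ab(5)], of b] b by simp
  moreover have "\<beta>' - \<alpha>' \<le> (1 - \<gamma>) ^ Suc j * (r / \<kappa>)"
  proof -
    have "(1 - \<gamma>) * (\<beta> - \<alpha>) \<le> (1 - \<gamma>) * ((1 - \<gamma>) ^ j * (r / \<kappa>))"
      using ab(2) gamma by (intro mult_left_mono) auto
    then show ?thesis using ab'(2) by (simp add: mult.assoc)
  qed
  moreover have "\<kappa> * r \<le> \<alpha>'" using ab(1) ab'(1) by linarith
  ultimately show ?case using ab'(3,4) unfolding eq by blast
qed

text \<open>Turns the contraction per block into a rate per step.\<close>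

definition \<nu> :: real where "\<nu> = root N\<^sub>1 (1 - \<gamma>)"

lemma nu: "0 < \<nu>" "\<nu> < 1" "\<nu> ^ N\<^sub>1 = 1 - \<gamma>"
  using gamma N1 by (auto simp: \<nu>_def)

lemma L_iter_comparable:
  assumes p: "0 \<le> p"
  shows "\<exists>A>0. \<exists>M. \<forall>\<sigma>\<in>\<S>. \<forall>f g. cone \<sigma> p f \<and> 0 < Lambda \<sigma> f \<and> cone \<sigma> p g \<and> 0 < Lambda \<sigma> g \<longrightarrow>
    (\<forall>n\<ge>M. \<exists>\<alpha>>0. (AE x in unit_leb. \<alpha> * L_iter \<sigma> n g x \<le> L_iter \<sigma> n f x) \<and>
      (AE x in unit_leb. L_iter \<sigma> n f x \<le> \<alpha> * (1 + A * \<nu> ^ n) * L_iter \<sigma> n g x))"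
proof -
  have "(\<lambda>k. (7 / 12 :: real) ^ k * p) \<longlonglongrightarrow> 0 * p"
    by (intro tendsto_mult_right LIMSEQ_power_zero) simp
  then have "\<forall>\<^sub>F k in sequentially. (7 / 12) ^ k * p < b"
    by (rule order_tendstoD) (use b in simp)
  then obtain k where k: "(7 / 12) ^ k * p < b" unfolding eventually_sequentially by blast
  define m where "m = n\<^sub>0 * k"
  \<comment> \<open>The exponent allows for the m steps that bring both functions into the cone of
    aperture b, for the first block, which only creates the constants, and for the incomplete last
    block. The square of \<kappa> comes from the initial gap r / \<kappa> taken relative to \<alpha>
    >= \<kappa> r.\<close>
  define A where "A = 1 / (\<kappa>\<^sup>2 * \<nu> ^ (m + 2 * N\<^sub>1))"
  have A: "0 < A" using kappa nu by (simp add: A_def)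
  have "\<exists>\<alpha>>0. (AE x in unit_leb. \<alpha> * L_iter \<sigma> n g x \<le> L_iter \<sigma> n f x) \<and>
      (AE x in unit_leb. L_iter \<sigma> n f x \<le> \<alpha> * (1 + A * \<nu> ^ n) * L_iter \<sigma> n g x)"
    if \<sigma>: "\<sigma> \<in> \<S>" and f: "cone \<sigma> p f" "0 < Lambda \<sigma> f" and g: "cone \<sigma> p g" "0 < Lambda \<sigma> g"
      and n: "m + N\<^sub>1 \<le> n" for \<sigma> f g n
  proof -
    let ?\<tau> = "shift_by m \<sigma>" and ?f = "L_iter \<sigma> m f" and ?g = "L_iter \<sigma> m g"
    have \<tau>: "?\<tau> \<in> \<S>" using \<sigma> by (rule shift_by_in_symbol_seqs)
    have cf: "cone ?\<tau> b ?f" and cg: "cone ?\<tau> b ?g"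
      using cone_L_iter_blocks[OF \<sigma> p f(1), of k] cone_L_iter_blocks[OF \<sigma> p g(1), of k] k by (simp_all add: m_def)
    have Lf: "0 < Lambda ?\<tau> ?f" and Lg: "0 < Lambda ?\<tau> ?g" using \<sigma> f g by (auto intro: Lambda_L_iter_pos)
    define j where "j = (n - m - N\<^sub>1) div N\<^sub>1"
    define l where "l = (n - m - N\<^sub>1) mod N\<^sub>1"
    have nj: "n = m + (N\<^sub>1 * Suc j + l)"
      using n mult_div_mod_eq[of N\<^sub>1 "n - m - N\<^sub>1"] by (simp add: j_def l_def)
    have l: "l < N\<^sub>1" using N1 by (simp add: l_def)
    let ?M = "N\<^sub>1 * Suc j"
    define r where "r = Lambda ?\<tau> ?f / Lambda ?\<tau> ?g"
    have r: "0 < r" using Lf Lg by (simp add: r_def)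
    obtain \<alpha> \<beta> where ab: "\<kappa> * r \<le> \<alpha>" "\<beta> - \<alpha> \<le> (1 - \<gamma>) ^ j * (r / \<kappa>)"
      "cone (shift_by ?M ?\<tau>) b (\<lambda>x. L_iter ?\<tau> ?M ?f x - \<alpha> * L_iter ?\<tau> ?M ?g x)"
      "cone (shift_by ?M ?\<tau>) b (\<lambda>x. \<beta> * L_iter ?\<tau> ?M ?g x - L_iter ?\<tau> ?M ?f x)"
      using cone_pair_iterate[OF \<tau> cf Lf cg Lg, of j] unfolding r_def by blast
    have a0: "0 < \<alpha>" using ab(1) r kappa by (meson less_le_trans mult_pos_pos)
    have L: "L_iter \<sigma> n \<phi> = L_iter (shift_by ?M ?\<tau>) l (L_iter ?\<tau> ?M (L_iter \<sigma> m \<phi>))" for \<phi>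
      unfolding nj L_iter_add shift_by_shift_by by (rule refl)
    have s: "shift_by ?M ?\<tau> \<in> \<S>" using \<tau> by (rule shift_by_in_symbol_seqs)
    have 1: "AE x in unit_leb. \<alpha> * L_iter \<sigma> n g x \<le> L_iter \<sigma> n f x"
      using AE_L_iter_nonneg[OF s coneD(2)[OF ab(3)], of l] unfolding L L_iter_diff L_iter_cmult
      by eventually_elim simp
    have 2: "AE x in unit_leb. L_iter \<sigma> n f x \<le> \<beta> * L_iter \<sigma> n g x"
      using AE_L_iter_nonneg[OF s coneD(2)[OF ab(4)], of l] unfolding L L_iter_diff L_iter_cmult
      by eventually_elim simp
    have "\<beta> \<le> \<alpha> * (1 + A * \<nu> ^ n)"
    proof -
      have "(1 - \<gamma>) ^ j = \<nu> ^ (N\<^sub>1 * j)" unfolding nu(3)[symmetric] by (simp add: power_mult)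
      also have "\<dots> \<le> \<nu> ^ n / \<nu> ^ (m + 2 * N\<^sub>1)"
      proof -
        have "\<nu> ^ (N\<^sub>1 * j) * \<nu> ^ (m + 2 * N\<^sub>1) = \<nu> ^ (N\<^sub>1 * j + (m + 2 * N\<^sub>1))" by (rule power_add[symmetric])
        also have "\<dots> \<le> \<nu> ^ n" using nu l nj by (intro power_decreasing) auto
        finally show ?thesis using nu(1) by (simp add: pos_le_divide_eq)
      qed
      finally have J: "(1 - \<gamma>) ^ j \<le> \<kappa>\<^sup>2 * (A * \<nu> ^ n)" using kappa(1) by (simp add: A_def)
      have "(1 - \<gamma>) ^ j * (r / \<kappa>) \<le> \<kappa>\<^sup>2 * (A * \<nu> ^ n) * (r / \<kappa>)"
        using J r kappa by (intro mult_right_mono) auto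
      also have "\<dots> = (\<kappa> * r) * (A * \<nu> ^ n)" using kappa by (simp add: power2_eq_square)
      also have "\<dots> \<le> \<alpha> * (A * \<nu> ^ n)" using ab(1) A nu by (intro mult_right_mono) auto
      finally show ?thesis using ab(2) by (simp add: algebra_simps)
    qed
    moreover have "AE x in unit_leb. 0 \<le> L_iter \<sigma> n g x" using \<sigma> coneD(2)[OF g(1)] by (rule AE_L_iter_nonneg)
    ultimately have "AE x in unit_leb. L_iter \<sigma> n f x \<le> \<alpha> * (1 + A * \<nu> ^ n) * L_iter \<sigma> n g x"
      using 2 by (elim eventually_rev_mp) (auto intro!: AE_I2 elim: order_trans intro: mult_right_mono)
    then show ?thesis using 1 a0 by blast
  qed
  then show ?thesis using A by blast
qed

lemma next_ratio_bounds:
  assumes "\<sigma> \<in> \<S>" "cone \<sigma> p u" "0 < Lambda \<sigma> u"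
  shows "0 \<le> next_ratio \<sigma> n u" "next_ratio \<sigma> n u \<le> 1"
  using integral_L_iter_Suc[OF assms(1) coneD(1,2)[OF assms(2)], of n]
    integral_L_iter_pos[OF assms(1) coneD(1,2)[OF assms(2)] assms(3), of n]
  by (auto simp: next_ratio_def)

lemma next_ratio_diff:
  assumes p: "0 \<le> p"
  shows "\<exists>c>0. \<forall>\<sigma>\<in>\<S>. \<forall>f g n. cone \<sigma> p f \<and> 0 < Lambda \<sigma> f \<and> cone \<sigma> p g \<and> 0 < Lambda \<sigma> g \<longrightarrow>
    \<bar>next_ratio \<sigma> n f - next_ratio \<sigma> n g\<bar> \<le> c * \<nu> ^ n"
proof -
  obtain A M where A: "0 < A" and AM: "\<And>\<sigma> f g n. \<sigma> \<in> \<S> \<Longrightarrow> cone \<sigma> p f \<Longrightarrow> 0 < Lambda \<sigma> f \<Longrightarrow> cone \<sigma> p g \<Longrightarrow>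
      0 < Lambda \<sigma> g \<Longrightarrow> M \<le> n \<Longrightarrow>
      \<exists>\<alpha>>0. (AE x in unit_leb. \<alpha> * L_iter \<sigma> n g x \<le> L_iter \<sigma> n f x) \<and>
      (AE x in unit_leb. L_iter \<sigma> n f x \<le> \<alpha> * (1 + A * \<nu> ^ n) * L_iter \<sigma> n g x)"
    using L_iter_comparable[OF p] by blast
  \<comment> \<open>The second summand covers n below M, where both ratios lie between 0 and 1 and
    so differ by at most 1.\<close>
  define c where "c = A + 1 / \<nu> ^ M"
  have nuM: "0 < \<nu> ^ M" using nu by simp
  have c: "0 < c" using A nuM by (simp add: c_def add_pos_pos)
  have "\<bar>next_ratio \<sigma> n f - next_ratio \<sigma> n g\<bar> \<le> c * \<nu> ^ n"
    if \<sigma>: "\<sigma> \<in> \<S>" and f: "cone \<sigma> p f" "0 < Lambda \<sigma> f" and g: "cone \<sigma> p g" "0 < Lambda \<sigma> g" for \<sigma> f g n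
  proof (cases "M \<le> n")
    case False
    have "\<bar>next_ratio \<sigma> n f - next_ratio \<sigma> n g\<bar> \<le> 1"
      using next_ratio_bounds[OF \<sigma> f, of n] next_ratio_bounds[OF \<sigma> g, of n] by (auto simp: abs_if)
    also have "1 \<le> 1 / \<nu> ^ M * \<nu> ^ n"
      using power_decreasing[of n M \<nu>] False nu by (simp add: pos_le_divide_eq)
    also have "\<dots> \<le> c * \<nu> ^ n" using A nu by (intro mult_right_mono) (auto simp: c_def)
    finally show ?thesis .
  next
    case True
    obtain \<alpha> where \<alpha>: "0 < \<alpha>" "AE x in unit_leb. \<alpha> * L_iter \<sigma> n g x \<le> L_iter \<sigma> n f x"
      "AE x in unit_leb. L_iter \<sigma> n f x \<le> \<alpha> * (1 + A * \<nu> ^ n) * L_iter \<sigma> n g x"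
      using AM[OF \<sigma> f g True] by blast
    let ?s = "A * \<nu> ^ n"
    have s: "0 \<le> ?s" using A nu by simp
    note bf = coneD(1)[OF f(1)] and bg = coneD(1)[OF g(1)]
    have step: "L_iter \<sigma> (Suc n) \<phi> = L_iter (shift_by n \<sigma>) (Suc 0) (L_iter \<sigma> n \<phi>)" for \<phi>
      using L_iter_add[of \<sigma> n 1 \<phi>] by simp
    have \<tau>: "shift_by n \<sigma> \<in> \<S>" using \<sigma> by (rule shift_by_in_symbol_seqs)
    have \<alpha>': "AE x in unit_leb. \<alpha> * L_iter \<sigma> (Suc n) g x \<le> L_iter \<sigma> (Suc n) f x"
      "AE x in unit_leb. L_iter \<sigma> (Suc n) f x \<le> \<alpha> * (1 + ?s) * L_iter \<sigma> (Suc n) g x"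
      using AE_L_iter_mono[OF \<tau> \<alpha>(2), of "Suc 0"] AE_L_iter_mono[OF \<tau> \<alpha>(3), of "Suc 0"]
      unfolding step L_iter_cmult by auto
    have int: "integrable unit_leb (L_iter \<sigma> k f)" "integrable unit_leb (\<lambda>x. a * L_iter \<sigma> k g x)" for k a
      using ess_bounded_integrable[OF ess_bounded_L_iter[OF \<sigma> bf]]
        ess_bounded_integrable[OF ess_bounded_cmult[OF ess_bounded_L_iter[OF \<sigma> bg]]] by auto
    have le: "a * (\<integral>x. L_iter \<sigma> k g x \<partial>unit_leb) \<le> (\<integral>x. L_iter \<sigma> k f x \<partial>unit_leb)"
      if "AE x in unit_leb. a * L_iter \<sigma> k g x \<le> L_iter \<sigma> k f x" for a k
      using integral_mono_AE[OF int(2) int(1) that] by simp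
    have ge: "(\<integral>x. L_iter \<sigma> k f x \<partial>unit_leb) \<le> a * (\<integral>x. L_iter \<sigma> k g x \<partial>unit_leb)"
      if "AE x in unit_leb. L_iter \<sigma> k f x \<le> a * L_iter \<sigma> k g x" for a k
      using integral_mono_AE[OF int(1) int(2) that] by simp
    have "\<bar>next_ratio \<sigma> n f - next_ratio \<sigma> n g\<bar> \<le> ?s"
      unfolding next_ratio_def
      by (rule ratio_diff_le[OF integral_L_iter_pos[OF \<sigma> coneD(1,2)[OF f(1)] f(2)]
          integral_L_iter_pos[OF \<sigma> coneD(1,2)[OF g(1)] g(2)] integral_L_iter_Suc[OF \<sigma> coneD(1,2)[OF g(1)]]
          \<alpha>(1) s le[OF \<alpha>(2)] ge[OF \<alpha>(3)] le[OF \<alpha>'(1)] ge[OF \<alpha>'(2)]])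
    also have "?s \<le> c * \<nu> ^ n" using nu by (intro mult_right_mono) (auto simp: c_def)
    finally show ?thesis .
  qed
  then show ?thesis using c by blast
qed

text \<open>\<open>next_ratio\<close> of h at time m + n is that of the m-th iterate of h at time n
  over the shifted sequence. So two densities are compared along one sequence, and both lie in a
  cone whose aperture does not depend on m.\<close>

theorem loss_of_memory:
  assumes h: "ess_bounded h" and low: "0 < \<delta>" "AE x in unit_leb. \<delta> \<le> h x" and v: "bvar h {0..1} V"
  shows "\<exists>c>0. \<forall>\<sigma>\<in>\<S>. \<forall>m n. \<bar>next_ratio \<sigma> (m + n) h - next_ratio (shift_by m \<sigma>) n h\<bar> \<le> c * \<nu> ^ n"
proof -
  define p where "p = V / \<delta>"
  \<comment> \<open>Here p is an aperture for h itself, \<open>P p\<close> bounds it after an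
    initial incomplete block, and b is the level below which full blocks are not asked to improve
    it.\<close>
  define q where "q = max p (max b (P p))"
  have V: "0 \<le> V" using v by (rule bvar_nonneg)
  have p: "0 \<le> p" using V low by (simp add: p_def)
  have q: "0 \<le> q" "p \<le> q" "b \<le> q" "P p \<le> q" using p by (auto simp: q_def)
  have nn: "AE x in unit_leb. 0 \<le> h x" using low(2) by eventually_elim (use low(1) in linarith)
  have L: "\<delta> \<le> Lambda \<sigma> h" if "\<sigma> \<in> \<S>" for \<sigma> using that h low(2) by (rule const_le_Lambda)
  have cone_h: "cone \<sigma> p h" if "\<sigma> \<in> \<S>" for \<sigma>
  proof -
    have "V = p * \<delta>" using low by (simp add: p_def)
    also have "\<dots> \<le> p * Lambda \<sigma> h" using L[OF that] p by (rule mult_left_mono)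
    finally have "bvar h {0..1} (p * Lambda \<sigma> h)" using v by (rule bvar_le[rotated])
    then show ?thesis by (intro coneI[where v = h] h nn) auto
  qed
  have cone_L: "cone (shift_by m \<sigma>) q (L_iter \<sigma> m h)" if \<sigma>: "\<sigma> \<in> \<S>" for \<sigma> m
  proof -
    define r where "r = m mod n\<^sub>0"
    define k where "k = m div n\<^sub>0"
    have m: "m = r + n\<^sub>0 * k" by (simp add: r_def k_def)
    have "r \<le> n\<^sub>0" using n0 by (simp add: r_def less_imp_le)
    then have "cone (shift_by r \<sigma>) (P p) (L_iter \<sigma> r h)" using \<sigma> p cone_h by (intro cone_short)
    from cone_L_iter_blocks[OF shift_by_in_symbol_seqs[OF \<sigma>] P_nonneg[OF p] this, of k]
    have "cone (shift_by m \<sigma>) (max b ((7 / 12) ^ k * P p)) (L_iter \<sigma> m h)"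
      by (simp add: m shift_by_shift_by L_iter_add)
    moreover have "(7 / 12) ^ k * P p \<le> P p" using P_nonneg[OF p] by (simp add: mult_left_le_one_le power_le_one)
    ultimately show ?thesis using q cone_mono[OF shift_by_in_symbol_seqs[OF \<sigma>]] by (meson max.boundedI order_trans)
  qed
  obtain c where c: "0 < c" "\<And>\<sigma> f g n. \<sigma> \<in> \<S> \<Longrightarrow> cone \<sigma> q f \<Longrightarrow> 0 < Lambda \<sigma> f \<Longrightarrow> cone \<sigma> q g \<Longrightarrow> 0 < Lambda \<sigma> g \<Longrightarrow>
      \<bar>next_ratio \<sigma> n f - next_ratio \<sigma> n g\<bar> \<le> c * \<nu> ^ n"
    using next_ratio_diff[OF q(1)] by blast
  have "\<bar>next_ratio \<sigma> (m + n) h - next_ratio (shift_by m \<sigma>) n h\<bar> \<le> c * \<nu> ^ n" if \<sigma>: "\<sigma> \<in> \<S>" for \<sigma> m n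
  proof -
    have \<tau>: "shift_by m \<sigma> \<in> \<S>" using \<sigma> by (rule shift_by_in_symbol_seqs)
    have "0 < Lambda (shift_by m \<sigma>) (L_iter \<sigma> m h)"
      using L[OF \<sigma>] low by (intro Lambda_L_iter_pos[OF \<sigma> cone_h[OF \<sigma>]]) linarith
    moreover have "0 < Lambda (shift_by m \<sigma>) h" using L[OF \<tau>] low by linarith
    ultimately have "\<bar>next_ratio (shift_by m \<sigma>) n (L_iter \<sigma> m h) - next_ratio (shift_by m \<sigma>) n h\<bar> \<le> c * \<nu> ^ n"
      using cone_mono[OF \<tau> cone_h[OF \<tau>] q(2)] cone_L[OF \<sigma>, of m] by (intro c(2) \<tau>)
    moreover have "next_ratio (shift_by m \<sigma>) n (L_iter \<sigma> m h) = next_ratio \<sigma> (m + n) h"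
      using L_iter_add[of \<sigma> m n h] L_iter_add[of \<sigma> m "Suc n" h] by (simp only: next_ratio_def add_Suc_right)
    ultimately show ?thesis by simp
  qed
  then show ?thesis using c(1) by blast
qed

end

section \<open>The constants\<close>

lemma power_nat_ceiling_log:
  fixes x y :: real
  assumes "1 < x" "1 < y"
  shows "1 \<le> nat \<lceil>ln y / ln x\<rceil>" "y \<le> x ^ nat \<lceil>ln y / ln x\<rceil>"
proof -
  let ?n = "nat \<lceil>ln y / ln x\<rceil>"
  have pos: "0 < ln y / ln x" using assms by simp
  then have "0 < \<lceil>ln y / ln x\<rceil>" by simp
  then show "1 \<le> ?n" by linarith
  have "ln y / ln x \<le> real ?n" using pos by linarith
  then have "ln y \<le> real ?n * ln x" by (subst (asm) pos_divide_le_eq) (use assms in auto)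
  also have "\<dots> = ln (x ^ ?n)" using assms by (simp add: ln_realpow)
  finally show "y \<le> x ^ ?n" using assms by simp
qed

context open_system
begin

abbreviation "n0 \<equiv> n_zero TT HH C K \<xi>"
abbreviation "n2 \<equiv> n_two TT HH C K \<xi>"

lemma eps_hat_eq: "eps_hat TT HH N m =
    (INF k \<in> {1..N}. INF \<sigma> \<in> \<S>. INF Z \<in> Z_good \<sigma> k. ereal (ratio_inf \<sigma> m (indicator Z)))"
  by (simp only: eps_hat_def ratio_inf_def)

lemma ess_bounded_Z_good: "\<sigma> \<in> \<S> \<Longrightarrow> Z \<in> Z_good \<sigma> k \<Longrightarrow> ess_bounded (indicator Z :: real \<Rightarrow> real)"
  using Z_good_subset by (intro ess_bounded_indicator Z_star_measurable[of \<sigma> Z k]) auto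

lemma eps_hat_le:
  assumes "1 \<le> k" "k \<le> N" "\<sigma> \<in> \<S>" "Z \<in> Z_good \<sigma> k"
  shows "eps_hat TT HH N m \<le> ereal (ratio_inf \<sigma> m (indicator Z))"
  unfolding eps_hat_eq using assms by (intro INF_lower2[of k] INF_lower2[of \<sigma>] INF_lower2[of Z]) auto

lemma eps_hat_mono:
  assumes "m \<le> m'"
  shows "eps_hat TT HH N m \<le> eps_hat TT HH N m'"
  unfolding eps_hat_eq
proof (rule INF_mono')
  fix k
  show "(INF \<sigma>\<in>\<S>. INF Z\<in>Z_good \<sigma> k. ereal (ratio_inf \<sigma> m (indicator Z)))
      \<le> (INF \<sigma>\<in>\<S>. INF Z\<in>Z_good \<sigma> k. ereal (ratio_inf \<sigma> m' (indicator Z)))"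
  proof (intro INF_greatest)
    fix \<sigma> Z assume *: "\<sigma> \<in> \<S>" "Z \<in> Z_good \<sigma> k"
    have "ratio_inf \<sigma> m (indicator Z) \<le> ratio_inf \<sigma> m' (indicator Z)"
      using incseq_ratio_inf[OF *(1) ess_bounded_Z_good[OF *]] assms by (rule incseqD)
    then show "(INF \<sigma>\<in>\<S>. INF Z\<in>Z_good \<sigma> k. ereal (ratio_inf \<sigma> m (indicator Z))) \<le> ereal (ratio_inf \<sigma> m' (indicator Z))"
      using * by (intro INF_lower2[of \<sigma>] INF_lower2[of Z]) auto
  qed
qed

text \<open>As \<open>eps_hat\<close> is nondecreasing in its second argument, the value at the
  smallest admissible m bounds the whole set from below, so the infimum cannot drop to 0.\<close>

lemma eps_star_pos:
  assumes "n \<le> m" "0 < eps_hat TT HH n m"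
  shows "0 < eps_star TT HH n"
proof -
  define m\<^sub>0 where "m\<^sub>0 = (LEAST m. n \<le> m \<and> 0 < eps_hat TT HH n m)"
  have m0: "n \<le> m\<^sub>0 \<and> 0 < eps_hat TT HH n m\<^sub>0"
    unfolding m\<^sub>0_def using LeastI[of "\<lambda>m. n \<le> m \<and> 0 < eps_hat TT HH n m" m] assms by simp
  have least: "m\<^sub>0 \<le> k" if "n \<le> k" "0 < eps_hat TT HH n k" for k
    unfolding m\<^sub>0_def using Least_le[of "\<lambda>m. n \<le> m \<and> 0 < eps_hat TT HH n m" k] that by simp
  let ?E = "{eps_hat TT HH n m | m. n \<le> m \<and> 0 < eps_hat TT HH n m}"
  have "eps_hat TT HH n m\<^sub>0 \<le> Inf ?E" using least by (intro Inf_greatest) (auto intro: eps_hat_mono)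
  moreover have ne: "?E \<noteq> {}" using assms by blast
  have "eps_star TT HH n = Inf ?E" unfolding eps_star_def Let_def by (rule if_not_P[OF ne])
  ultimately show ?thesis using m0 by (metis less_le_trans)
qed

lemma eps_star_nonneg: "0 \<le> eps_star TT HH n"
  unfolding eps_star_def Let_def by (auto intro!: Inf_greatest)

text \<open>Provides the \<epsilon> of the Lasota-Yorke inequality, uniformly over sequences and
  over all levels from 1 to n, hence for incomplete blocks as well.\<close>

lemma eps_star_le_Lambda:
  assumes nz: "eps_star TT HH n \<noteq> 0" and k: "1 \<le> k" "k \<le> n" and \<sigma>: "\<sigma> \<in> \<S>" and Z: "Z \<in> Z_good \<sigma> k"
  shows "eps_star TT HH n \<le> ereal (Lambda \<sigma> (indicator Z))"
proof -
  let ?E = "{eps_hat TT HH n m | m. n \<le> m \<and> 0 < eps_hat TT HH n m}"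
  have ne: "?E \<noteq> {}" using nz unfolding eps_star_def Let_def by (auto split: if_splits)
  then obtain m where m: "n \<le> m" "0 < eps_hat TT HH n m" by blast
  have "eps_star TT HH n = Inf ?E" unfolding eps_star_def Let_def by (rule if_not_P[OF ne])
  also have "\<dots> \<le> eps_hat TT HH n m" using m by (intro Inf_lower) auto
  also have "\<dots> \<le> ereal (ratio_inf \<sigma> m (indicator Z))" using k \<sigma> Z by (rule eps_hat_le)
  also have "\<dots> \<le> ereal (Lambda \<sigma> (indicator Z))"
    using ratio_inf_le_Lambda[OF \<sigma> ess_bounded_Z_good[OF \<sigma> Z]] by simp
  finally show ?thesis .
qed

lemma C_star_ge: "3 + 4 * K \<le> C_star C K"
  using C_nonneg K_nonneg mult_nonneg_nonneg[OF K_nonneg C_nonneg] by (simp add: C_star_def algebra_simps)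

lemma rho_div_theta: "1 < \<rho> / \<theta>"
  using theta_less theta_pos by simp

lemma n_zero: "1 \<le> n0" "4 * (C_star C K)\<^sup>2 * \<theta> ^ n0 \<le> \<rho> ^ n0"
proof -
  have "1 * 1 < 4 * (C_star C K)\<^sup>2"
    using C_star_ge K_nonneg one_le_power[of "C_star C K" 2] by linarith
  then have "1 < 4 * (C_star C K)\<^sup>2" by simp
  from power_nat_ceiling_log[OF rho_div_theta this]
  show "1 \<le> n0" "4 * (C_star C K)\<^sup>2 * \<theta> ^ n0 \<le> \<rho> ^ n0"
    using theta_pos unfolding n_zero_def power_divide by (simp_all add: pos_le_divide_eq)
qed

definition c\<^sub>0 :: real where "c\<^sub>0 = real_of_ereal (C_n TT HH C K \<xi> n0)"

text \<open>The solution of \<rho>^n (b - 1) / 2 = \<open>c\<^sub>0\<close> at n =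
  \<open>n_zero\<close>, so that the Lasota-Yorke remainder fits into the cone. It is also a factor
  of the argument of the logarithm in \<open>n_two\<close>.\<close>

definition b\<^sub>0 :: real where "b\<^sub>0 = 1 + 2 * c\<^sub>0 * inverse \<rho> ^ n0"

lemma C_n_num_pos: "0 < (3 * C + 2) * (2 * K * \<xi> + 1) * \<Theta>"
  using C_nonneg K_nonneg xi_ge_1 Theta_pos by (intro mult_pos_pos add_nonneg_pos mult_nonneg_nonneg) auto

text \<open>If \<open>eps_star\<close> is 0 or infinite, the conventions for division and for the
  conversion to a real number give the value 0.\<close>

lemma c0_nonneg: "0 \<le> c\<^sub>0"
proof (cases "eps_star TT HH n0")
  case (real r)
  then have "0 \<le> r" using eps_star_nonneg[of n0] by simp
  then show ?thesis using C_n_num_pos real by (cases "r = 0") (simp_all add: c\<^sub>0_def C_n_def)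
qed (use eps_star_nonneg[of n0] in \<open>simp_all add: c\<^sub>0_def C_n_def\<close>)

lemma b0_ge: "1 \<le> b\<^sub>0"
  using c0_nonneg rho_pos by (simp add: b\<^sub>0_def)

text \<open>From a >= 1 and \<open>C_star\<close> >= 3 + 4 K follows B >= 7 + 8 K, so the argument
  of the logarithm in \<open>n_two\<close> is at least 4 (7 + 8 K) \<open>b\<^sub>0\<close>.\<close>

lemma n_two_ge:
  assumes nz: "eps_star TT HH n0 \<noteq> 0"
  shows "1 \<le> n2" "4 * (7 + 8 * K) * b\<^sub>0 * \<theta> ^ n2 \<le> \<rho> ^ n2"
proof -
  define a where "a = max 1 (15 / 11 * Max ((\<lambda>i. real_of_ereal (C_n TT HH C K \<xi> i) / (C_star C K * \<theta> ^ i)) ` {1..n0}))"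
  define B where "B = 1 + 2 * a * C_star C K"
  have n2: "n2 = nat \<lceil>ln (4 * a * B * b\<^sub>0) / ln (\<rho> / \<theta>)\<rceil>"
    using nz unfolding n_two_def Let_def by (simp add: a_def B_def b\<^sub>0_def c\<^sub>0_def)
  have a: "1 \<le> a" by (simp add: a_def)
  have "1 * C_star C K \<le> a * C_star C K" using a C_star_ge K_nonneg by (intro mult_right_mono) auto
  then have B: "7 + 8 * K \<le> B" using C_star_ge by (simp add: B_def)
  have "1 * (7 + 8 * K) \<le> a * B" using a B K_nonneg by (intro mult_mono) auto
  then have "4 * (1 * (7 + 8 * K)) * b\<^sub>0 \<le> 4 * (a * B) * b\<^sub>0" using b0_ge by (intro mult_right_mono mult_left_mono) auto
  then have le: "4 * (7 + 8 * K) * b\<^sub>0 \<le> 4 * a * B * b\<^sub>0" by (simp add: mult.assoc)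
  have "28 * 1 \<le> 4 * (7 + 8 * K) * b\<^sub>0" using K_nonneg b0_ge by (intro mult_mono) auto
  then have "1 < 4 * a * B * b\<^sub>0" using le by linarith
  from power_nat_ceiling_log[OF rho_div_theta this]
  have *: "1 \<le> n2" "4 * a * B * b\<^sub>0 \<le> (\<rho> / \<theta>) ^ n2" unfolding n2 by auto
  show "1 \<le> n2" by (rule *)
  have "4 * (7 + 8 * K) * b\<^sub>0 \<le> \<rho> ^ n2 / \<theta> ^ n2" using le *(2) by (simp add: power_divide)
  then show "4 * (7 + 8 * K) * b\<^sub>0 * \<theta> ^ n2 \<le> \<rho> ^ n2" using theta_pos by (simp add: pos_le_divide_eq)
qed

lemma n_two_ge_1: "1 \<le> n2"
proof (cases "eps_star TT HH n0 = 0")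
  case True
  then have "n2 = n0" unfolding n_two_def Let_def by simp
  then show ?thesis using n_zero(1) by simp
qed (rule n_two_ge(1))

theorem contracting:
  assumes n3: "n2 \<le> n\<^sub>3" and C3: "cond_C3 TT HH n2 n\<^sub>3"
  shows "\<exists>\<eta> P. contracting_open_system TT HH lam C K \<xi> n0 n\<^sub>3 b\<^sub>0 \<eta> P"
proof -
  have hat: "0 < eps_hat TT HH n2 n\<^sub>3" using C3 by (simp add: cond_C3_def)
  \<comment> \<open>Otherwise \<open>n_two\<close> would equal \<open>n_zero\<close>, and (C3)
    itself would exhibit a positive \<open>eps_hat\<close> at that level.\<close>
  have nz: "eps_star TT HH n0 \<noteq> 0"
  proof
    assume "eps_star TT HH n0 = 0"
    moreover from this have "n2 = n0" unfolding n_two_def Let_def by simp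
    ultimately show False using eps_star_pos[of n0 n\<^sub>3] n3 hat by simp
  qed
  note n2 = n_two_ge[OF nz]
  have Cs: "3 \<le> C_star C K" using C_star_ge K_nonneg by linarith
  have thp: "0 < \<theta> ^ n" "0 < \<rho> ^ n" for n using theta_pos rho_pos by simp_all
  \<comment> \<open>One of the two factors \<open>C_star\<close> is at least 3, which turns the 4
    into 12.\<close>
  have contr: "12 * C_star C K * \<theta> ^ n0 \<le> \<rho> ^ n0"
  proof -
    have "12 * C_star C K \<le> 4 * C_star C K * C_star C K" by (rule mult_right_mono) (use Cs in auto)
    then have "12 * C_star C K * \<theta> ^ n0 \<le> 4 * C_star C K * C_star C K * \<theta> ^ n0"
      by (rule mult_right_mono) (use thp(1)[of n0] in auto)
    then show ?thesis using n_zero(2) by (simp add: power2_eq_square mult.assoc)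
  qed
  have good0: "Z_good \<sigma> n0 \<noteq> {}" if "\<sigma> \<in> \<S>" for \<sigma>
  proof (rule ex_good[OF that])
    have "K < 12 * C_star C K" using C_star_ge K_nonneg by linarith
    then have "K * \<theta> ^ n0 < 12 * C_star C K * \<theta> ^ n0" using thp(1)[of n0] by (rule mult_strict_right_mono)
    then show "K * \<theta> ^ n0 < \<rho> ^ n0" using contr by linarith
  qed
  have good2: "Z_good \<sigma> n2 \<noteq> {}" if "\<sigma> \<in> \<S>" for \<sigma>
  proof (rule ex_good[OF that])
    have "K < 28 + 32 * K" using K_nonneg by linarith
    also have "\<dots> = 4 * (7 + 8 * K) * 1" by simp
    also have "\<dots> \<le> 4 * (7 + 8 * K) * b\<^sub>0" using b0_ge K_nonneg by (intro mult_left_mono) auto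
    finally have "K * \<theta> ^ n2 < 4 * (7 + 8 * K) * b\<^sub>0 * \<theta> ^ n2" using thp(1)[of n2] by (rule mult_strict_right_mono)
    then show "K * \<theta> ^ n2 < \<rho> ^ n2" using n2(2) by linarith
  qed
  \<comment> \<open>\<open>eps_star\<close> is finite because good intervals exist: it is at most a
    value of \<open>Lambda\<close> on an indicator, hence at most 1. An infimum over nothing would
    be infinite.\<close>
  define \<epsilon> where "\<epsilon> = real_of_ereal (eps_star TT HH n0)"
  obtain \<sigma>' where \<sigma>': "\<sigma>' \<in> \<S>" using symbols_ne by blast
  obtain Z' where Z': "Z' \<in> Z_good \<sigma>' n0" using good0[OF \<sigma>'] by blast
  have "eps_star TT HH n0 \<le> ereal (Lambda \<sigma>' (indicator Z'))"
    using nz n_zero(1) order_refl \<sigma>' Z' by (rule eps_star_le_Lambda)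
  also have "\<dots> \<le> 1"
  proof -
    have "Lambda \<sigma>' (indicator Z') \<le> 1"
      using \<sigma>' ess_bounded_Z_good[OF \<sigma>' Z'] by (rule Lambda_le_const) (auto simp: indicator_def)
    then show ?thesis by simp
  qed
  finally have e1: "eps_star TT HH n0 \<le> 1" .
  have e0: "0 < eps_star TT HH n0" using nz eps_star_nonneg[of n0] by (simp add: order_less_le)
  have eps_eq: "eps_star TT HH n0 = ereal \<epsilon>" using e0 e1 unfolding \<epsilon>_def by (cases "eps_star TT HH n0") auto
  have eps: "0 < \<epsilon>" "\<epsilon> \<le> 1" using e0 e1 unfolding eps_eq by auto
  have epsL: "\<epsilon> \<le> Lambda \<sigma> (indicator Z)" if "1 \<le> k" "k \<le> n0" "\<sigma> \<in> \<S>" "Z \<in> Z_good \<sigma> k" for \<sigma> k Z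
    using eps_star_le_Lambda[OF nz that] unfolding eps_eq by simp
  have c0: "c\<^sub>0 = (3 * C + 2) * (2 * K * \<xi> + 1) * \<Theta> / \<epsilon>"
    unfolding c\<^sub>0_def C_n_def eps_eq using eps by simp
  have LY: "\<exists>w. (AE y in unit_leb. L_iter \<sigma> k u y = w y) \<and>
      bvar w {0..1} (C_star C K * \<theta> ^ k * (p * Lambda \<sigma> u) + c\<^sub>0 * Lambda \<sigma> u)"
    if k: "1 \<le> k" "k \<le> n0" and \<sigma>: "\<sigma> \<in> \<S>" and u: "cone \<sigma> p u" for k \<sigma> p u
  proof -
    obtain v where v: "AE x in unit_leb. u x = v x" "bvar v {0..1} (p * Lambda \<sigma> u)" using coneD(3)[OF u] by blast
    show ?thesis unfolding c0
      using Lasota_Yorke[OF \<sigma> coneD(1)[OF u] v(1) coneD(2)[OF u] v(2) k(1) eps epsL[OF k \<sigma>]] .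
  qed
  \<comment> \<open>The Lasota-Yorke bound is relative to \<open>Lambda\<close> of u. Expressing it
    by \<open>Lambda\<close> of the image costs the factor \<rho>^k.\<close>
  have cone_LY: "cone (shift_by k \<sigma>) q (L_iter \<sigma> k u)"
    if k: "1 \<le> k" "k \<le> n0" and \<sigma>: "\<sigma> \<in> \<S>" and u: "cone \<sigma> p u"
      and q: "0 \<le> q" "C_star C K * \<theta> ^ k * p + c\<^sub>0 \<le> q * \<rho> ^ k" for k \<sigma> p q u
  proof -
    obtain w where w: "AE y in unit_leb. L_iter \<sigma> k u y = w y"
        "bvar w {0..1} (C_star C K * \<theta> ^ k * (p * Lambda \<sigma> u) + c\<^sub>0 * Lambda \<sigma> u)"
      using LY[OF k \<sigma> u] by blast
    have "C_star C K * \<theta> ^ k * (p * Lambda \<sigma> u) + c\<^sub>0 * Lambda \<sigma> u = (C_star C K * \<theta> ^ k * p + c\<^sub>0) * Lambda \<sigma> u"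
      by (simp add: algebra_simps)
    also have "\<dots> \<le> q * \<rho> ^ k * Lambda \<sigma> u"
      using q(2) cone_Lambda_nonneg[OF \<sigma> u] by (rule mult_right_mono)
    also have "\<dots> \<le> q * Lambda (shift_by k \<sigma>) (L_iter \<sigma> k u)"
      using mult_left_mono[OF Lambda_L_iter_ge[OF \<sigma> coneD(1,2)[OF u]] q(1)] by (simp add: mult.assoc)
    finally have "bvar w {0..1} (q * Lambda (shift_by k \<sigma>) (L_iter \<sigma> k u))" using w(2) by (rule bvar_le[rotated])
    with ess_bounded_L_iter[OF \<sigma> coneD(1)[OF u]] AE_L_iter_nonneg[OF \<sigma> coneD(2)[OF u]] w(1)
    show ?thesis by (rule coneI)
  qed
  \<comment> \<open>\<open>eps_hat\<close> may exceed 1 or be infinite; truncation gives a real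
    number that can serve for \<eta>.\<close>
  obtain \<epsilon>\<^sub>3 where e3: "0 < \<epsilon>\<^sub>3" "\<epsilon>\<^sub>3 \<le> 1" "ereal \<epsilon>\<^sub>3 \<le> eps_hat TT HH n2 n\<^sub>3"
  proof (cases "1 \<le> eps_hat TT HH n2 n\<^sub>3")
    case True
    then show ?thesis using that[of 1] by (simp add: one_ereal_def)
  next
    case False
    then show ?thesis using that[of "real_of_ereal (eps_hat TT HH n2 n\<^sub>3)"] hat
      by (cases "eps_hat TT HH n2 n\<^sub>3") auto
  qed
  \<comment> \<open>The power of 1 + 1/\<rho> dominates 1/\<rho>^r for every r up to
    \<open>n_zero\<close>, whether \<rho> is below or above 1.\<close>
  define P where "P p = (C_star C K * p + c\<^sub>0) * (1 + 1 / \<rho>) ^ n0" for p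
  have P0: "0 \<le> P p" if "0 \<le> p" for p
    using that Cs c0_nonneg rho_pos by (simp add: P_def)
  have "contracting_open_system TT HH lam C K \<xi> n0 n\<^sub>3 b\<^sub>0 (\<epsilon>\<^sub>3 / 2) P"
  proof (intro contracting_open_system.intro contracting_open_system_axioms.intro)
    show "open_system TT HH lam C K \<xi>" by (rule open_system_axioms)
    show "1 \<le> n0" by (rule n_zero)
    show "1 \<le> n\<^sub>3" using n2(1) n3 by linarith
    show "1 \<le> b\<^sub>0" by (rule b0_ge)
    show "0 < \<epsilon>\<^sub>3 / 2" "\<epsilon>\<^sub>3 / 2 \<le> 1" using e3 by auto
    show "0 \<le> P p" if "0 \<le> p" for p using that by (rule P0)
    show "cone (shift_by n0 \<sigma>) (p / 12 + (b\<^sub>0 - 1) / 2) (L_iter \<sigma> n0 u)"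
      if \<sigma>: "\<sigma> \<in> \<S>" and p: "0 \<le> p" and u: "cone \<sigma> p u" for \<sigma> p u
    proof (rule cone_LY[OF n_zero(1) order_refl \<sigma> u])
      show "0 \<le> p / 12 + (b\<^sub>0 - 1) / 2" using p b0_ge by simp
      have "C_star C K * \<theta> ^ n0 * p \<le> \<rho> ^ n0 / 12 * p" using contr p by (intro mult_right_mono) auto
      moreover have "(b\<^sub>0 - 1) / 2 * \<rho> ^ n0 = c\<^sub>0" using rho_pos by (simp add: b\<^sub>0_def power_inverse)
      moreover have "(p / 12 + (b\<^sub>0 - 1) / 2) * \<rho> ^ n0 = \<rho> ^ n0 / 12 * p + (b\<^sub>0 - 1) / 2 * \<rho> ^ n0"
        by (simp only: distrib_right) simp
      ultimately show "C_star C K * \<theta> ^ n0 * p + c\<^sub>0 \<le> (p / 12 + (b\<^sub>0 - 1) / 2) * \<rho> ^ n0" by linarith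
    qed
    show "cone (shift_by r \<sigma>) (P p) (L_iter \<sigma> r u)"
      if \<sigma>: "\<sigma> \<in> \<S>" and p: "0 \<le> p" and u: "cone \<sigma> p u" and r: "r \<le> n0" for \<sigma> p u r
    proof (cases "r = 0")
      case True
      have "p * 1 \<le> (C_star C K * p + c\<^sub>0) * (1 + 1 / \<rho>) ^ n0"
      proof (rule mult_mono)
        have "1 * p \<le> C_star C K * p" using Cs p by (intro mult_right_mono) auto
        then show "p \<le> C_star C K * p + c\<^sub>0" using c0_nonneg by linarith
        show "0 \<le> C_star C K * p + c\<^sub>0" using Cs p c0_nonneg by simp
        show "1 \<le> (1 + 1 / \<rho>) ^ n0" using rho_pos by (intro one_le_power) simp
      qed simp
      then have "cone \<sigma> (P p) u" by (intro cone_mono[OF \<sigma> u]) (simp add: P_def)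
      then show ?thesis using True by simp
    next
      case False
      then have r1: "1 \<le> r" by simp
      show ?thesis
      proof (rule cone_LY[OF r1 r \<sigma> u P0[OF p]])
        have "1 = (1 / \<rho>) ^ r * \<rho> ^ r" using rho_pos by (simp add: power_divide)
        also have "\<dots> \<le> (1 + 1 / \<rho>) ^ r * \<rho> ^ r" using rho_pos by (intro mult_right_mono power_mono) auto
        also have "\<dots> \<le> (1 + 1 / \<rho>) ^ n0 * \<rho> ^ r" using rho_pos r by (intro mult_right_mono power_increasing) auto
        finally have Q: "1 \<le> (1 + 1 / \<rho>) ^ n0 * \<rho> ^ r" .
        have "C_star C K * \<theta> ^ r * p \<le> C_star C K * 1 * p"
          using Cs p theta_pos theta_less power_le_one[of \<theta> r] by (intro mult_right_mono mult_left_mono) auto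
        then have "C_star C K * \<theta> ^ r * p + c\<^sub>0 \<le> (C_star C K * p + c\<^sub>0) * 1" by simp
        also have "\<dots> \<le> (C_star C K * p + c\<^sub>0) * ((1 + 1 / \<rho>) ^ n0 * \<rho> ^ r)"
          using Q Cs p c0_nonneg by (intro mult_left_mono) auto
        finally show "C_star C K * \<theta> ^ r * p + c\<^sub>0 \<le> P p * \<rho> ^ r" by (simp add: P_def mult.assoc)
      qed
    qed
    show "AE x in unit_leb. \<epsilon>\<^sub>3 / 2 * Lambda \<sigma> u * L_iter \<sigma> n\<^sub>3 (\<lambda>_. 1) x \<le> L_iter \<sigma> n\<^sub>3 u x"
      if \<sigma>: "\<sigma> \<in> \<S>" and u: "cone \<sigma> b\<^sub>0 u" for \<sigma> u
    proof (cases "Lambda \<sigma> u = 0")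
      case True
      then show ?thesis using AE_L_iter_nonneg[OF \<sigma> coneD(2)[OF u], of n\<^sub>3] by simp
    next
      case False
      then have L: "0 < Lambda \<sigma> u" using cone_Lambda_nonneg[OF \<sigma> u] by simp
      obtain v where v: "AE x in unit_leb. u x = v x" "bvar v {0..1} (b\<^sub>0 * Lambda \<sigma> u)" using coneD(3)[OF u] by blast
      \<comment> \<open>If the infimum of \<bar>v\<bar> were at most half of \<open>Lambda\<close>
        on every good interval, the choice of \<open>n_two\<close> would bound \<open>Lambda\<close>
        by 3/4 of itself.\<close>
      have "\<exists>Z\<in>Z_good \<sigma> n2. Lambda \<sigma> u / 2 < abs_inf v Z"
      proof (rule ccontr)
        assume "\<not> ?thesis"
        then have "Lambda \<sigma> u \<le> Lambda \<sigma> u / 2 + (2 * K + 1) * (b\<^sub>0 * Lambda \<sigma> u) * (\<theta> / \<rho>) ^ n2"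
          using L by (intro Lambda_le_max_good[OF \<sigma> coneD(1)[OF u] v good2[OF \<sigma>]]) (auto simp: not_less)
        moreover have "(2 * K + 1) * (b\<^sub>0 * Lambda \<sigma> u) * (\<theta> / \<rho>) ^ n2 \<le> Lambda \<sigma> u / 4"
        proof -
          have "4 * (2 * K + 1) * b\<^sub>0 * \<theta> ^ n2 \<le> 4 * (7 + 8 * K) * b\<^sub>0 * \<theta> ^ n2"
            using K_nonneg b0_ge thp(1)[of n2] by (intro mult_right_mono) auto
          then have "4 * (2 * K + 1) * b\<^sub>0 * \<theta> ^ n2 \<le> \<rho> ^ n2" using n2(2) by linarith
          then have "(2 * K + 1) * b\<^sub>0 * \<theta> ^ n2 \<le> 1 / 4 * \<rho> ^ n2" by linarith
          then have "(2 * K + 1) * b\<^sub>0 * \<theta> ^ n2 / \<rho> ^ n2 \<le> 1 / 4"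
            by (simp only: pos_divide_le_eq[OF thp(2)])
          then have "(2 * K + 1) * b\<^sub>0 * (\<theta> / \<rho>) ^ n2 \<le> 1 / 4" by (simp add: power_divide)
          then have "(2 * K + 1) * b\<^sub>0 * (\<theta> / \<rho>) ^ n2 * Lambda \<sigma> u \<le> 1 / 4 * Lambda \<sigma> u"
            using L by (intro mult_right_mono) auto
          then show ?thesis by (simp add: mult_ac)
        qed
        ultimately show False using L by linarith
      qed
      then obtain Z where Z: "Z \<in> Z_good \<sigma> n2" "Lambda \<sigma> u / 2 < abs_inf v Z" by blast
      \<comment> \<open>Now u dominates a multiple of the indicator of Z, to which (C3) applies. The
        selection of Z costs one half and (C3) the factor \<open>\<epsilon>\<^sub>3\<close>.\<close>
      have "AE x in unit_leb. (\<Sum>Z\<in>{Z}. abs_inf v Z * indicator Z x) \<le> u x"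
        using Z(1) Z_good_subset by (intro AE_abs_inf_step_le[OF \<sigma> v(1) coneD(2)[OF u]]) auto
      then have "AE x in unit_leb. abs_inf v Z * indicator Z x \<le> u x"
        by (simp only: sum.insert finite.emptyI empty_iff not_False_eq_True sum.empty add_0_right)
      from AE_L_iter_mono[OF \<sigma> this, of n\<^sub>3]
      have 1: "AE x in unit_leb. abs_inf v Z * L_iter \<sigma> n\<^sub>3 (indicator Z) x \<le> L_iter \<sigma> n\<^sub>3 u x"
        by (simp only: L_iter_cmult)
      have "ereal \<epsilon>\<^sub>3 \<le> ereal (ratio_inf \<sigma> n\<^sub>3 (indicator Z))"
        using e3(3) eps_hat_le[OF n2(1) order_refl \<sigma> Z(1), of n\<^sub>3] by (rule order_trans)
      then have "\<epsilon>\<^sub>3 \<le> ratio_inf \<sigma> n\<^sub>3 (indicator Z)" by simp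
      then have 2: "AE x in unit_leb. \<epsilon>\<^sub>3 * L_iter \<sigma> n\<^sub>3 (\<lambda>_. 1) x \<le> L_iter \<sigma> n\<^sub>3 (indicator Z) x"
        using le_ratio_inf_iff[OF \<sigma> ess_bounded_Z_good[OF \<sigma> Z(1)]] by blast
      show ?thesis using 1 2 AE_L_iter_one_pos[OF \<sigma>, of n\<^sub>3]
      proof eventually_elim
        case (elim x)
        have "Lambda \<sigma> u / 2 * (\<epsilon>\<^sub>3 * L_iter \<sigma> n\<^sub>3 (\<lambda>_. 1) x) \<le> abs_inf v Z * (\<epsilon>\<^sub>3 * L_iter \<sigma> n\<^sub>3 (\<lambda>_. 1) x)"
          using Z(2) e3 elim(3) by (intro mult_right_mono) auto
        also have "\<dots> \<le> abs_inf v Z * L_iter \<sigma> n\<^sub>3 (indicator Z) x"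
          using elim(2) Z(2) L by (intro mult_left_mono) auto
        finally show ?case using elim(1) by (simp add: mult_ac)
      qed
    qed
  qed
  then show ?thesis by blast
qed

end

section \<open>The walk\<close>

lemma T_iter_Suc_shift: "T_iter \<sigma> (Suc n) x = T_iter (shift_by 1 \<sigma>) n (fst (\<sigma> 0) x)"
  by (induction n) (simp_all add: shift_by_def)

lemma L_iter_symbols_cong: "(\<And>k. k < n \<Longrightarrow> \<sigma> k = \<tau> k) \<Longrightarrow> L_iter \<sigma> n \<phi> = L_iter \<tau> n \<phi>"
  by (induction n) simp_all

lemma position_0 [simp]: "position w 0 = 0"
  by (simp add: position_def)

lemma position_Suc: "position w (Suc n) = position w n + w n"
  by (simp add: position_def)

lemma position_add: "position w (m + k) = position w m + position (\<lambda>k. w (m + k)) k"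
  by (induction k) (simp_all add: position_Suc add.assoc)

lemma position_cong: "(\<And>k. k < n \<Longrightarrow> v k = w k) \<Longrightarrow> position v n = position w n"
  by (simp add: position_def)

section \<open>The mass of the initial points that survive n steps\<close>

context open_system
begin

lemma H_iter_Suc_shift:
  assumes \<sigma>: "\<sigma> \<in> \<S>"
  shows "H_iter \<sigma> (Suc n) = snd (\<sigma> 0) \<inter> {x \<in> {0..1}. fst (\<sigma> 0) x \<in> H_iter (shift_by 1 \<sigma>) n}"
proof (intro set_eqI iffI)
  fix x
  assume x: "x \<in> H_iter \<sigma> (Suc n)"
  then have x01: "x \<in> {0..1}" and x': "\<And>j. j < Suc n \<Longrightarrow> T_iter \<sigma> j x \<in> snd (\<sigma> j)" by (auto simp: H_iter_def)
  have "fst (\<sigma> 0) x \<in> {0..1}" using T_iter_in[OF \<sigma> x01, of "Suc 0"] by simp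
  moreover have "T_iter (shift_by 1 \<sigma>) j (fst (\<sigma> 0) x) \<in> snd (shift_by 1 \<sigma> j)" if "j < n" for j
    using x'[of "Suc j"] that by (simp only: T_iter_Suc_shift) (simp add: shift_by_def)
  ultimately show "x \<in> snd (\<sigma> 0) \<inter> {x \<in> {0..1}. fst (\<sigma> 0) x \<in> H_iter (shift_by 1 \<sigma>) n}"
    using x01 x'[of 0] by (simp add: H_iter_def)
next
  fix x assume x: "x \<in> snd (\<sigma> 0) \<inter> {x \<in> {0..1}. fst (\<sigma> 0) x \<in> H_iter (shift_by 1 \<sigma>) n}"
  have "T_iter \<sigma> j x \<in> snd (\<sigma> j)" if j: "j < Suc n" for j
  proof (cases j)
    case 0
    then show ?thesis using x by simp
  next
    case (Suc i)
    then have "T_iter (shift_by 1 \<sigma>) i (fst (\<sigma> 0) x) \<in> snd (shift_by 1 \<sigma> i)"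
      using x j by (simp add: H_iter_def)
    then show ?thesis unfolding Suc T_iter_Suc_shift by (simp add: shift_by_def)
  qed
  then show "x \<in> H_iter \<sigma> (Suc n)" using x by (simp add: H_iter_def)
qed

text \<open>Peeling off the first symbol leaves a hole intersected with a preimage under a single
  map.\<close>

lemma H_iter_measurable: "\<sigma> \<in> \<S> \<Longrightarrow> H_iter \<sigma> n \<in> sets lebesgue"
proof (induction n arbitrary: \<sigma>)
  case 0
  have "H_iter \<sigma> 0 = {0..1}" by (auto simp: H_iter_def)
  then show ?case by simp
next
  case (Suc n)
  have "snd (\<sigma> 0) \<in> HH" using symbol_seqs_in[OF Suc.prems, of 0] by auto
  then have "snd (\<sigma> 0) \<in> sets lebesgue" by (rule hole_measurable)
  moreover have "{x \<in> {0..1}. fst (\<sigma> 0) x \<in> H_iter (shift_by 1 \<sigma>) n} \<in> sets lebesgue"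
    using expanding_map.measurable_vimage[OF expanding_map_at[OF Suc.prems] Suc.IH[OF shift_by_in_symbol_seqs[OF Suc.prems]]] .
  ultimately show ?case unfolding H_iter_Suc_shift[OF Suc.prems] by (rule sets.Int)
qed

text \<open>The induction peels off the operator that acts first: the indicator of the points
  surviving the later steps is pulled inside \<open>transfer\<close> by composition with the first
  map, and integral preservation removes the operator.\<close>

lemma integral_L_iter:
  "\<sigma> \<in> \<S> \<Longrightarrow> ess_bounded u \<Longrightarrow>
    (\<integral>x. L_iter \<sigma> n u x \<partial>unit_leb) = (\<integral>x. u x * indicator (H_iter \<sigma> n) x \<partial>unit_leb)"
proof (induction n arbitrary: \<sigma> u)
  case 0
  have "H_iter \<sigma> 0 = {0..1}" by (auto simp: H_iter_def)
  then show ?case by (auto intro!: Bochner_Integration.integral_cong simp: space_restrict_space)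
next
  case (Suc n)
  interpret expanding_map "fst (\<sigma> 0)" lam using Suc.prems(1) by (rule expanding_map_at)
  let ?\<tau> = "shift_by 1 \<sigma>"
  let ?\<phi> = "\<lambda>x. u x * indicator (H_iter \<sigma> (Suc n)) x"
  have \<tau>: "?\<tau> \<in> \<S>" using Suc.prems(1) by (rule shift_by_in_symbol_seqs)
  have s: "\<sigma> 0 \<in> TT \<times> HH" using Suc.prems(1) by (rule symbol_seqs_in)
  have "(\<integral>x. L_iter \<sigma> (Suc n) u x \<partial>unit_leb) = (\<integral>x. L_iter ?\<tau> n (open_transfer (\<sigma> 0) u) x \<partial>unit_leb)"
    using L_iter_add[of \<sigma> 1 n u] by simp
  also have "\<dots> = (\<integral>x. open_transfer (\<sigma> 0) u x * indicator (H_iter ?\<tau> n) x \<partial>unit_leb)"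
    using \<tau> ess_bounded_open_transfer[OF s Suc.prems(2)] by (rule Suc.IH)
  also have "\<dots> = (\<integral>y. transfer (fst (\<sigma> 0)) ?\<phi> y \<partial>unit_leb)"
  proof (rule Bochner_Integration.integral_cong[OF refl])
    fix y
    show "open_transfer (\<sigma> 0) u y * indicator (H_iter ?\<tau> n) y = transfer (fst (\<sigma> 0)) ?\<phi> y"
      unfolding open_transfer_def transfer_def sum_distrib_right
    proof (rule sum.cong[OF refl])
      fix x assume x: "x \<in> {x \<in> smooth_set (fst (\<sigma> 0)). fst (\<sigma> 0) x = y}"
      then have "x \<in> {0..1}" using smooth_subset by force
      then show "u x * indicator (snd (\<sigma> 0)) x / \<bar>deriv (fst (\<sigma> 0)) x\<bar> * indicator (H_iter ?\<tau> n) y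
          = ?\<phi> x / \<bar>deriv (fst (\<sigma> 0)) x\<bar>"
        using x unfolding H_iter_Suc_shift[OF Suc.prems(1)] by (auto simp: indicator_def)
    qed
  qed
  also have "\<dots> = (\<integral>x. ?\<phi> x \<partial>unit_leb)"
    by (intro integrable_transfer(2) ess_bounded_integrable ess_bounded_mult ess_bounded_indicator
        H_iter_measurable Suc.prems)
  finally show ?case .
qed

end

text \<open>The hole belongs to the site that is left and the map to the site that is entered, hence
  two different positions in one symbol.\<close>

definition walk_symbols :: "('a \<Rightarrow> real \<Rightarrow> real) \<Rightarrow> ('a \<Rightarrow> int ^ 'd \<Rightarrow> real set) \<Rightarrow>
    ('a, 'd) env \<Rightarrow> (nat \<Rightarrow> int ^ 'd) \<Rightarrow> nat \<Rightarrow> symb"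
  where "walk_symbols f G \<omega> w k = (f (\<omega> (position w (Suc k))), G (\<omega> (position w k)) (w k))"

lemma word_transfer_eq_L_iter: "word_transfer f G \<omega> w n \<phi> = L_iter (walk_symbols f G \<omega> w) n \<phi>"
  by (induction n)
    (simp_all add: walk_transfer_def open_transfer_def walk_symbols_def position_Suc mult.commute)

text \<open>Moving the origin to the m-th position and dropping m jumps is the shift of symbols.
  This reduces (Exp) to \<open>loss_of_memory\<close>.\<close>

lemma walk_symbols_translate:
  "walk_symbols f G (translate (position w m) \<omega>) (\<lambda>k. w (m + k)) = shift_by m (walk_symbols f G \<omega> w)"
proof
  fix k
  have "position (\<lambda>k. w (m + k)) j + position w m = position w (m + j)" for j
    unfolding position_add[of w m j] by (rule add.commute)
  then show "walk_symbols f G (translate (position w m) \<omega>) (\<lambda>k. w (m + k)) k = shift_by m (walk_symbols f G \<omega> w) k"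
    by (simp only: walk_symbols_def translate_def shift_by_def add_Suc_right)
qed

lemma walk_symbols_in:
  "w \<in> UNIV \<rightarrow> W \<Longrightarrow> walk_symbols f G \<omega> w \<in> symbol_seqs (range f) (holes G W)"
  by (fastforce simp: symbol_seqs_def walk_symbols_def holes_def)

lemma word_prob_cong:
  assumes "\<And>k. k < n \<Longrightarrow> v k = w k"
  shows "word_prob f G h \<omega> n v = word_prob f G h \<omega> n w"
proof -
  have "L_iter (walk_symbols f G \<omega> v) n h = L_iter (walk_symbols f G \<omega> w) n h"
  proof (rule L_iter_symbols_cong)
    fix k assume k: "k < n"
    then have "position v k = position w k" "position v (Suc k) = position w (Suc k)" "v k = w k"
      using assms by (auto intro!: position_cong)
    then show "walk_symbols f G \<omega> v k = walk_symbols f G \<omega> w k" by (simp only: walk_symbols_def)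
  qed
  then show ?thesis by (simp add: word_prob_def word_transfer_eq_L_iter)
qed

lemma next_prob_cong:
  assumes "\<And>k. k \<le> n \<Longrightarrow> v k = w k"
  shows "next_prob f G h \<omega> n v = next_prob f G h \<omega> n w"
  unfolding next_prob_def using assms by (intro arg_cong2[where f = divide] word_prob_cong) auto

lemma next_prob_eq_next_ratio: "next_prob f G h \<omega> n w = next_ratio (walk_symbols f G \<omega> w) n h"
  by (simp only: next_prob_def word_prob_def word_transfer_eq_L_iter next_ratio_def)

locale walk_system = open_system "range f" "holes G W" lam C K \<xi>
  for f :: "'a::finite \<Rightarrow> real \<Rightarrow> real" and G :: "'a \<Rightarrow> int ^ 'd \<Rightarrow> real set" and W lam C K \<xi> +
  fixes h :: "real \<Rightarrow> real" and P :: "('a, 'd) env measure"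
  assumes finite_W: "finite W"
    and G_disjoint: "\<And>\<alpha>. disjoint_family_on (G \<alpha>) W" and G_cover: "\<And>\<alpha>. (\<Union>w\<in>W. G \<alpha> w) = {0..1}"
    and h_var: "total_variation h {0..1} < \<infinity>" and h_inf: "ess_inf h > 0"
    and h_int: "(\<integral>x. h x \<partial>unit_leb) = 1"
    and prob_P: "prob_space P" and sets_P: "sets P = sets env_space"
begin

lemma h_bvar: "\<exists>V. bvar h {0..1} V"
proof (cases "total_variation h {0..1}")
  case (real r)
  then show ?thesis using total_variation_le_iff[of h "{0..1}" r] by auto
next
  case MInf
  then show ?thesis using total_variation_le_iff[of h "{0..1}" 0] by auto
qed (use h_var in simp)

lemma h_measurable: "h \<in> borel_measurable unit_leb" and h_lower: "AE x in unit_leb. ess_inf h \<le> h x"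
  using ess_inf_pos_imp[OF h_inf] by auto

lemma h_nonneg: "AE x in unit_leb. 0 \<le> h x"
  using h_lower by eventually_elim (use h_inf in linarith)

lemma h_ess_bounded: "ess_bounded h"
proof -
  obtain V where V: "bvar h {0..1} V" using h_bvar by blast
  have "AE x in unit_leb. \<bar>h x\<bar> \<le> \<bar>h 0\<bar> + V"
  proof (rule AE_unit_leb_finiteI[of "{}"])
    fix x :: real assume "x \<in> {0..1}"
    then have "\<bar>h x - h 0\<bar> \<le> V" using V by (intro bvar_abs_diff[OF V]) auto
    then show "\<bar>h x\<bar> \<le> \<bar>h 0\<bar> + V" by linarith
  qed simp
  then show ?thesis using h_measurable by (rule ess_boundedI[rotated])
qed

lemma symbols_in: "w \<in> UNIV \<rightarrow> W \<Longrightarrow> walk_symbols f G \<omega> w \<in> \<S>"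
  by (rule walk_symbols_in)

lemma word_prob_eq:
  assumes "w \<in> UNIV \<rightarrow> W"
  shows "word_prob f G h \<omega> n w = (\<integral>x. h x * indicator (H_iter (walk_symbols f G \<omega> w) n) x \<partial>unit_leb)"
  unfolding word_prob_def word_transfer_eq_L_iter
  by (rule integral_L_iter[OF symbols_in[OF assms] h_ess_bounded])

text \<open>\<open>Lambda\<close> of the density is at least its essential infimum, hence positive.
  Consequently the conditional probabilities below have positive denominators.\<close>

lemma word_prob_pos:
  assumes "w \<in> UNIV \<rightarrow> W"
  shows "0 < word_prob f G h \<omega> n w"
  unfolding word_prob_def word_transfer_eq_L_iter
proof (rule integral_L_iter_pos[OF symbols_in[OF assms] h_ess_bounded h_nonneg])
  show "0 < Lambda (walk_symbols f G \<omega> w) h"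
    using const_le_Lambda[OF symbols_in[OF assms] h_ess_bounded h_lower] h_inf by (rule less_le_trans[rotated])
qed

text \<open>Stated for every environment, and including m = n, which a conditioning window of a
  single position requires later.\<close>

theorem cond_Exp_of_C3:
  assumes "n2 \<le> n\<^sub>3" "cond_C3 (range f) (holes G W) n2 n\<^sub>3"
  shows "\<exists>c \<nu>. 0 < c \<and> 0 < \<nu> \<and> \<nu> < 1 \<and> (\<forall>\<omega> n m. \<forall>w\<in>UNIV \<rightarrow> W. m \<le> n \<longrightarrow>
       \<bar>next_prob f G h \<omega> n w
         - next_prob f G h (translate (position w m) \<omega>) (n - m) (\<lambda>k. w (m + k))\<bar> \<le> c * \<nu> ^ (n - m))"
proof -
  obtain \<eta> Q where "contracting_open_system (range f) (holes G W) lam C K \<xi> n0 n\<^sub>3 b\<^sub>0 \<eta> Q"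
    using contracting[OF assms] by blast
  then interpret c: contracting_open_system "range f" "holes G W" lam C K \<xi> n0 n\<^sub>3 b\<^sub>0 \<eta> Q .
  obtain V where V: "bvar h {0..1} V" using h_bvar by blast
  obtain c where c: "0 < c" "\<And>\<sigma> m n. \<sigma> \<in> \<S> \<Longrightarrow>
      \<bar>next_ratio \<sigma> (m + n) h - next_ratio (shift_by m \<sigma>) n h\<bar> \<le> c * c.\<nu> ^ n"
    using c.loss_of_memory[OF h_ess_bounded h_inf h_lower V] by blast
  have "\<bar>next_prob f G h \<omega> n w
      - next_prob f G h (translate (position w m) \<omega>) (n - m) (\<lambda>k. w (m + k))\<bar> \<le> c * c.\<nu> ^ (n - m)"
    if "w \<in> UNIV \<rightarrow> W" "m \<le> n" for \<omega> n m w
    using c(2)[OF symbols_in[OF that(1), of \<omega>], of m "n - m"] that(2)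
    by (simp add: next_prob_eq_next_ratio walk_symbols_translate)
  then show ?thesis using c(1) c.nu(1,2) by blast
qed

end

section \<open>Conditional laws of the path\<close>

lemma space_path_space: "space (path_space :: (nat \<Rightarrow> int ^ 'd) measure) = UNIV"
  by (simp add: space_PiM)

lemma path_coordinate_sets: "{y :: nat \<Rightarrow> int ^ 'd. y k \<in> A} \<in> sets path_space"
proof -
  have "(\<lambda>y. y k) \<in> path_space \<rightarrow>\<^sub>M (count_space UNIV :: (int ^ 'd) measure)"
    by (rule measurable_component_singleton) simp
  from measurable_sets[OF this, of A] show ?thesis by (simp add: space_path_space vimage_def)
qed

lemma path_cylinder_sets:
  assumes "finite I"
  shows "{y :: nat \<Rightarrow> int ^ 'd. \<forall>k\<in>I. y k = z k} \<in> sets path_space"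
proof (cases "I = {}")
  case True
  then show ?thesis using sets.top[of "path_space :: (nat \<Rightarrow> int ^ 'd) measure"] by (simp add: space_path_space)
next
  case False
  have "(\<Inter>k\<in>I. {y :: nat \<Rightarrow> int ^ 'd. y k \<in> {z k}}) \<in> sets path_space"
    using assms False by (intro sets.finite_INT path_coordinate_sets) auto
  moreover have "(\<Inter>k\<in>I. {y :: nat \<Rightarrow> int ^ 'd. y k \<in> {z k}}) = {y. \<forall>k\<in>I. y k = z k}" by auto
  ultimately show ?thesis by simp
qed

text \<open>The lattice is countable, so a condition on an increment is a countable union of
  conditions on two coordinates.\<close>

lemma admissible_path_sets: "{y :: nat \<Rightarrow> int ^ 'd. admissible_path W y} \<in> sets path_space"
proof -
  have "{y :: nat \<Rightarrow> int ^ 'd. y (Suc k) - y k \<in> W} \<in> sets path_space" for k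
  proof -
    have "{y :: nat \<Rightarrow> int ^ 'd. y k \<in> {a}} \<inter> {y. y (Suc k) \<in> {c. c - a \<in> W}} \<in> sets path_space" for a
      by (intro sets.Int path_coordinate_sets)
    then have "(\<Union>a. {y :: nat \<Rightarrow> int ^ 'd. y k \<in> {a}} \<inter> {y. y (Suc k) \<in> {c. c - a \<in> W}}) \<in> sets path_space"
      by (intro sets.countable_UN' countableI_type image_subsetI)
    moreover have "(\<Union>a. {y :: nat \<Rightarrow> int ^ 'd. y k \<in> {a}} \<inter> {y. y (Suc k) \<in> {c. c - a \<in> W}}) = {y. y (Suc k) - y k \<in> W}"
      by auto
    ultimately show ?thesis by simp
  qed
  then have "{y :: nat \<Rightarrow> int ^ 'd. y 0 \<in> {0}} \<inter> (\<Inter>k. {y. y (Suc k) - y k \<in> W}) \<in> sets path_space"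
    by (intro sets.Int sets.countable_INT' path_coordinate_sets countableI_type image_subsetI) auto
  moreover have "{y :: nat \<Rightarrow> int ^ 'd. y 0 \<in> {0}} \<inter> (\<Inter>k. {y. y (Suc k) - y k \<in> W}) = {y. admissible_path W y}"
    by (auto simp: admissible_path_def)
  ultimately show ?thesis by simp
qed

lemma walk_symbols_simps:
  "fst (walk_symbols f G \<omega> w k) = f (\<omega> (position w (Suc k)))"
  "snd (walk_symbols f G \<omega> w k) = G (\<omega> (position w k)) (w k)"
  by (simp_all add: walk_symbols_def)

section \<open>The law of the walk in a fixed environment and its relation to conditional
  laws\<close>

context walk_system
begin

abbreviation "D \<equiv> density unit_leb (\<lambda>x. ennreal (h x))"

lemma emeasure_D:
  assumes "S \<in> sets unit_leb"
  shows "emeasure D S = ennreal (\<integral>x. h x * indicator S x \<partial>unit_leb)"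
proof -
  have "S \<in> sets lebesgue" using assms by (auto simp: sets_restrict_space)
  then have b: "ess_bounded (\<lambda>x. h x * indicator S x)"
    by (intro ess_bounded_mult h_ess_bounded ess_bounded_indicator)
  have "emeasure D S = (\<integral>\<^sup>+x. ennreal (h x) * indicator S x \<partial>unit_leb)"
    using h_measurable assms by (intro emeasure_density) auto
  also have "\<dots> = (\<integral>\<^sup>+x. ennreal (h x * indicator S x) \<partial>unit_leb)"
    by (intro nn_integral_cong) (simp add: indicator_def)
  also have "\<dots> = ennreal (\<integral>x. h x * indicator S x \<partial>unit_leb)"
    using h_nonneg by (intro nn_integral_eq_integral ess_bounded_integrable b)
      (auto elim!: eventually_mono simp: indicator_def)
  finally show ?thesis .
qed

lemma prob_D: "prob_space D"
proof
  have "(\<integral>x. h x * indicator (space unit_leb) x \<partial>unit_leb) = (\<integral>x. h x \<partial>unit_leb)"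
    by (rule Bochner_Integration.integral_cong) auto
  then show "emeasure D (space D) = 1" using emeasure_D[of "space unit_leb"] h_int by simp
qed

lemma space_P: "space P = UNIV"
  using sets_eq_imp_space_eq[OF sets_P] by (simp add: space_PiM)

lemma jump_eq:
  assumes "w \<in> W" "x \<in> G \<alpha> w"
  shows "jump W G \<alpha> x = w"
proof -
  have "x \<notin> G \<alpha> v" if "v \<in> W" "v \<noteq> w" for v
    using G_disjoint[of \<alpha>] assms that unfolding disjoint_family_on_def by blast
  then have "jump W G \<alpha> x = (\<Sum>v\<in>W. if v = w then w else 0)"
    unfolding jump_def using assms by (intro sum.cong) auto
  then show ?thesis using finite_W assms by simp
qed

lemma ex_jump: "x \<in> {0..1} \<Longrightarrow> \<exists>w\<in>W. x \<in> G \<alpha> w \<and> jump W G \<alpha> x = w"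
  using G_cover[of \<alpha>] jump_eq by blast

lemma maps_unit: "x \<in> {0..1} \<Longrightarrow> f \<alpha> x \<in> {0..1}"
  using expanding_map.maps[OF expanding[of "f \<alpha>"]] by (auto simp: Pi_iff)

lemma walk_0: "walk f G W \<omega> x 0 = 0"
  by (simp add: walk_def)

lemma walk_state_in: "x \<in> {0..1} \<Longrightarrow> fst ((walk_step f G W \<omega> ^^ n) (x, 0)) \<in> {0..1}"
  by (induction n) (auto simp: walk_step_def split_beta intro!: maps_unit[simplified])

lemma walk_Suc:
  "walk f G W \<omega> x (Suc n) = walk f G W \<omega> x n +
    jump W G (\<omega> (walk f G W \<omega> x n)) (fst ((walk_step f G W \<omega> ^^ n) (x, 0)))"
  by (simp add: walk_def walk_step_def split_beta)

lemma walk_admissible: "x \<in> {0..1} \<Longrightarrow> admissible_path W (walk f G W \<omega> x)"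
  unfolding admissible_path_def using ex_jump[OF walk_state_in] by (auto simp: walk_0 walk_Suc)

lemma walk_state_eq:
  assumes w: "w \<in> UNIV \<rightarrow> W"
  shows "x \<in> H_iter (walk_symbols f G \<omega> w) n \<Longrightarrow>
    (walk_step f G W \<omega> ^^ n) (x, 0) = (T_iter (walk_symbols f G \<omega> w) n x, position w n)"
proof (induction n)
  case (Suc n)
  let ?\<sigma> = "walk_symbols f G \<omega> w"
  have x: "x \<in> H_iter ?\<sigma> n" "T_iter ?\<sigma> n x \<in> G (\<omega> (position w n)) (w n)"
    using Suc.prems by (auto simp: H_iter_Suc walk_symbols_simps)
  have "jump W G (\<omega> (position w n)) (T_iter ?\<sigma> n x) = w n"
    using w x(2) by (intro jump_eq) auto
  then show ?case using Suc.IH[OF x(1)] by (simp add: walk_step_def position_Suc walk_symbols_simps)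
qed simp

text \<open>From the positions back to the point: the positions at times n and n + 1 determine the
  jump, and the jump determines the element of the partition that contains the current
  point.\<close>

lemma walk_eq_iff:
  assumes w: "w \<in> UNIV \<rightarrow> W" and x: "x \<in> {0..1}"
  shows "(\<forall>k\<le>n. walk f G W \<omega> x k = position w k) \<longleftrightarrow> x \<in> H_iter (walk_symbols f G \<omega> w) n"
proof
  let ?\<sigma> = "walk_symbols f G \<omega> w"
  assume "x \<in> H_iter ?\<sigma> n"
  then have "x \<in> H_iter ?\<sigma> k" if "k \<le> n" for k using that by (auto simp: H_iter_def)
  then show "\<forall>k\<le>n. walk f G W \<omega> x k = position w k" using walk_state_eq[OF w] by (simp add: walk_def)
next
  let ?\<sigma> = "walk_symbols f G \<omega> w"
  show "\<forall>k\<le>n. walk f G W \<omega> x k = position w k \<Longrightarrow> x \<in> H_iter ?\<sigma> n"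
  proof (induction n)
    case 0
    then show ?case using x by (simp add: H_iter_def)
  next
    case (Suc n)
    then have xn: "x \<in> H_iter ?\<sigma> n" by simp
    let ?t = "T_iter ?\<sigma> n x"
    have t: "?t \<in> {0..1}" using symbols_in[OF w] x by (rule T_iter_in)
    obtain v where v: "v \<in> W" "?t \<in> G (\<omega> (position w n)) v" "jump W G (\<omega> (position w n)) ?t = v"
      using ex_jump[OF t] by blast
    have "walk f G W \<omega> x (Suc n) = position w n + v"
      using Suc.prems v(3) walk_state_eq[OF w xn] by (simp add: walk_Suc)
    then have "v = w n" using Suc.prems by (simp add: position_Suc)
    then show ?case using xn v(2) by (simp add: H_iter_Suc walk_symbols_simps)
  qed
qed

lemma jump_measurable: "jump W G \<alpha> \<in> unit_leb \<rightarrow>\<^sub>M count_space UNIV"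
proof -
  have "jump W G \<alpha> -` {w} \<inter> space unit_leb \<in> sets unit_leb" for w
  proof (cases "w \<in> W")
    case True
    have "jump W G \<alpha> -` {w} \<inter> space unit_leb = G \<alpha> w \<inter> {0..1}"
    proof
      show "jump W G \<alpha> -` {w} \<inter> space unit_leb \<subseteq> G \<alpha> w \<inter> {0..1}"
        using ex_jump[of _ \<alpha>] by (fastforce simp: space_restrict_space)
      show "G \<alpha> w \<inter> {0..1} \<subseteq> jump W G \<alpha> -` {w} \<inter> space unit_leb"
        using jump_eq[OF True] by (auto simp: space_restrict_space)
    qed
    moreover have "G \<alpha> w \<in> sets lebesgue" using True by (intro hole_measurable) (auto simp: holes_def)
    ultimately show ?thesis by (auto simp: sets_restrict_space)
  next
    case False
    then have "jump W G \<alpha> -` {w} \<inter> space unit_leb = {}"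
      using ex_jump[of _ \<alpha>] by (fastforce simp: space_restrict_space)
    then show ?thesis by simp
  qed
  then show ?thesis by (subst measurable_count_space_eq2_countable) blast
qed

abbreviation "X \<equiv> P \<Otimes>\<^sub>M D"

text \<open>The site depends on the sample point; since there are countably many sites, it is enough
  to treat a fixed one.\<close>

lemma env_at_measurable:
  assumes "z \<in> X \<rightarrow>\<^sub>M count_space UNIV"
  shows "(\<lambda>p. fst p (z p)) \<in> X \<rightarrow>\<^sub>M count_space UNIV"
proof (rule measurable_compose_countable[OF _ assms])
  fix i :: "int ^ 'd"
  have "(\<lambda>\<omega>. \<omega> i) \<in> env_space \<rightarrow>\<^sub>M (count_space UNIV :: 'a measure)"
    by (rule measurable_component_singleton) simp
  then have "(\<lambda>\<omega>. \<omega> i) \<in> P \<rightarrow>\<^sub>M (count_space UNIV :: 'a measure)"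
    using measurable_cong_sets[OF sets_P refl] by blast
  with measurable_fst show "(\<lambda>p. fst p i) \<in> X \<rightarrow>\<^sub>M count_space UNIV" by (rule measurable_compose)
qed

text \<open>State and position are treated in one induction, since each step of either involves
  both.\<close>

lemma walk_state_measurable:
  "(\<lambda>p. fst ((walk_step f G W (fst p) ^^ n) (snd p, 0))) \<in> X \<rightarrow>\<^sub>M unit_leb \<and>
   (\<lambda>p. walk f G W (fst p) (snd p) n) \<in> X \<rightarrow>\<^sub>M count_space UNIV"
proof (induction n)
  case 0
  have "snd \<in> X \<rightarrow>\<^sub>M D" by (rule measurable_snd)
  moreover have "measurable X D = measurable X unit_leb" by (rule measurable_cong_sets) simp_all
  ultimately have "snd \<in> X \<rightarrow>\<^sub>M unit_leb" by blast
  then show ?case by (simp add: walk_0)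
next
  case (Suc n)
  let ?x = "\<lambda>p. fst ((walk_step f G W (fst p) ^^ n) (snd p, 0))" and ?z = "\<lambda>p. walk f G W (fst p) (snd p) n"
  have x: "?x \<in> X \<rightarrow>\<^sub>M unit_leb" and z: "?z \<in> X \<rightarrow>\<^sub>M count_space UNIV" using Suc by auto
  let ?j = "\<lambda>p. jump W G (fst p (?z p)) (?x p)"
  have j: "?j \<in> X \<rightarrow>\<^sub>M count_space UNIV"
    by (rule measurable_compose_countable'[OF measurable_compose[OF x jump_measurable] env_at_measurable[OF z]])
      (simp add: countable_finite)
  have z': "(\<lambda>p. walk f G W (fst p) (snd p) (Suc n)) \<in> X \<rightarrow>\<^sub>M count_space UNIV"
    unfolding walk_Suc
    by (rule measurable_compose_countable[where f = "\<lambda>i p. i + ?j p", OF measurable_compose[OF j] z]) simp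
  have "(\<lambda>p. f (fst p (walk f G W (fst p) (snd p) (Suc n))) (?x p)) \<in> X \<rightarrow>\<^sub>M unit_leb"
  proof (rule measurable_compose_countable'[OF _ env_at_measurable[OF z']])
    show "(\<lambda>p. f \<alpha> (?x p)) \<in> X \<rightarrow>\<^sub>M unit_leb" for \<alpha>
      using x expanding_map.measurable_map[OF expanding[of "f \<alpha>"]] by (intro measurable_compose[OF x]) auto
  qed (simp add: countable_finite)
  moreover have "fst ((walk_step f G W \<omega> ^^ Suc n) (y, 0)) =
      f (\<omega> (walk f G W \<omega> y (Suc n))) (fst ((walk_step f G W \<omega> ^^ n) (y, 0)))" for \<omega> y
    by (simp add: walk_def walk_step_def split_beta)
  ultimately show ?case using z' by simp
qed

lemma walk_measurable: "(\<lambda>(\<omega>, x). (\<omega>, walk f G W \<omega> x)) \<in> X \<rightarrow>\<^sub>M P \<Otimes>\<^sub>M path_space"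
proof -
  have "(\<lambda>p n. walk f G W (fst p) (snd p) n) \<in> X \<rightarrow>\<^sub>M path_space"
    by (rule measurable_abs_UNIV) (use walk_state_measurable in blast)
  then have "(\<lambda>p. (fst p, walk f G W (fst p) (snd p))) \<in> X \<rightarrow>\<^sub>M P \<Otimes>\<^sub>M path_space"
    by (intro measurable_Pair measurable_fst) simp
  then show ?thesis by (simp add: split_beta')
qed

text \<open>Fubini: the joint law is integrated over the environment with the law of the path in
  that environment as kernel, the form used in \<open>cond_law\<close>.\<close>

lemma emeasure_joint_law:
  assumes A: "A \<in> sets P" and B: "B \<in> sets path_space"
  defines "E \<equiv> {p \<in> space X. walk f G W (fst p) (snd p) \<in> B}"
  shows "(\<lambda>\<omega>. emeasure D (Pair \<omega> -` E)) \<in> borel_measurable P"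
    "emeasure (joint_law f G W h P) (A \<times> B) = (\<integral>\<^sup>+\<omega>\<in>A. emeasure D (Pair \<omega> -` E) \<partial>P)"
proof -
  interpret D: prob_space D by (rule prob_D)
  let ?F = "\<lambda>(\<omega>, x). (\<omega>, walk f G W \<omega> x)"
  have "space P \<times> B \<in> sets (P \<Otimes>\<^sub>M path_space)" using B by auto
  from measurable_sets[OF walk_measurable this]
  have "?F -` (space P \<times> B) \<inter> space X \<in> sets X" .
  moreover have "?F -` (space P \<times> B) \<inter> space X = E"
    by (auto simp: E_def space_pair_measure)
  ultimately have E: "E \<in> sets X" by simp
  show m: "(\<lambda>\<omega>. emeasure D (Pair \<omega> -` E)) \<in> borel_measurable P"
    using E by (rule D.measurable_emeasure_Pair)
  have AX: "A \<times> space D \<in> sets X" using A by auto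
  have "A \<times> B \<in> sets (P \<Otimes>\<^sub>M path_space)" using A B by auto
  then have "emeasure (joint_law f G W h P) (A \<times> B) = emeasure X (?F -` (A \<times> B) \<inter> space X)"
    unfolding joint_law_def by (rule emeasure_distr[OF walk_measurable])
  also have "?F -` (A \<times> B) \<inter> space X = (A \<times> space D) \<inter> E"
    using sets.sets_into_space[OF A] by (auto simp: E_def space_pair_measure)
  also have "emeasure X ((A \<times> space D) \<inter> E) = (\<integral>\<^sup>+\<omega>. emeasure D (Pair \<omega> -` ((A \<times> space D) \<inter> E)) \<partial>P)"
    using AX E by (intro D.emeasure_pair_measure_alt) auto
  also have "\<dots> = (\<integral>\<^sup>+\<omega>\<in>A. emeasure D (Pair \<omega> -` E) \<partial>P)"
  proof (rule nn_integral_cong)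
    fix \<omega> assume "\<omega> \<in> space P"
    have "Pair \<omega> -` ((A \<times> space D) \<inter> E) = (if \<omega> \<in> A then Pair \<omega> -` E else {})"
      by (auto simp: E_def space_pair_measure)
    then show "emeasure D (Pair \<omega> -` ((A \<times> space D) \<inter> E)) = emeasure D (Pair \<omega> -` E) * indicator A \<omega>"
      by (simp add: indicator_def)
  qed
  finally show "emeasure (joint_law f G W h P) (A \<times> B) = (\<integral>\<^sup>+\<omega>\<in>A. emeasure D (Pair \<omega> -` E) \<partial>P)" .
qed

text \<open>As functions of the environment both sides are densities of the same measure with
  respect to P, so they agree almost everywhere; the null set may depend on B.\<close>

lemma AE_kernel_eq:
  assumes \<kappa>: "cond_law (joint_law f G W h P) P \<kappa>" and B: "B \<in> sets path_space"
  shows "AE \<omega> in P. emeasure (\<kappa> \<omega>) B = emeasure D {x \<in> {0..1}. walk f G W \<omega> x \<in> B}"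
proof -
  interpret P: prob_space P by (rule prob_P)
  define E where "E = {p \<in> space X. walk f G W (fst p) (snd p) \<in> B}"
  have km: "\<kappa> \<in> P \<rightarrow>\<^sub>M prob_algebra path_space"
    and ke: "\<And>A. A \<in> sets P \<Longrightarrow> emeasure (joint_law f G W h P) (A \<times> B) = (\<integral>\<^sup>+\<omega>\<in>A. emeasure (\<kappa> \<omega>) B \<partial>P)"
    using \<kappa> B unfolding cond_law_def by auto
  have m1: "(\<lambda>\<omega>. emeasure (\<kappa> \<omega>) B) \<in> borel_measurable P"
    using measurable_emeasure_kernel[OF measurable_prob_algebraD[OF km] B] .
  have m2: "(\<lambda>\<omega>. emeasure D (Pair \<omega> -` E)) \<in> borel_measurable P"
    unfolding E_def by (rule emeasure_joint_law(1)[OF sets.top B])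
  have "density P (\<lambda>\<omega>. emeasure (\<kappa> \<omega>) B) = density P (\<lambda>\<omega>. emeasure D (Pair \<omega> -` E))"
  proof (rule measure_eqI)
    fix A assume "A \<in> sets (density P (\<lambda>\<omega>. emeasure (\<kappa> \<omega>) B))"
    then have A: "A \<in> sets P" by simp
    have "(\<integral>\<^sup>+\<omega>\<in>A. emeasure (\<kappa> \<omega>) B \<partial>P) = (\<integral>\<^sup>+\<omega>\<in>A. emeasure D (Pair \<omega> -` E) \<partial>P)"
      unfolding ke[OF A, symmetric] E_def by (rule emeasure_joint_law(2)[OF A B])
    then show "emeasure (density P (\<lambda>\<omega>. emeasure (\<kappa> \<omega>) B)) A = emeasure (density P (\<lambda>\<omega>. emeasure D (Pair \<omega> -` E))) A"
      by (simp only: emeasure_density[OF m1 A] emeasure_density[OF m2 A])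
  qed simp
  then have "AE \<omega> in P. emeasure (\<kappa> \<omega>) B = emeasure D (Pair \<omega> -` E)"
    using P.density_unique[OF m1 m2] by blast
  moreover have "Pair \<omega> -` E = {x \<in> {0..1}. walk f G W \<omega> x \<in> B}" for \<omega>
    by (auto simp: E_def space_pair_measure space_P space_restrict_space)
  ultimately show ?thesis by simp
qed

lemma AE_kernel_cylinder:
  assumes \<kappa>: "cond_law (joint_law f G W h P) P \<kappa>" and w: "w \<in> UNIV \<rightarrow> W"
  shows "AE \<omega> in P. emeasure (\<kappa> \<omega>) {y. \<forall>k\<in>{..n}. y k = position w k} = ennreal (word_prob f G h \<omega> n w)"
  using AE_kernel_eq[OF \<kappa> path_cylinder_sets[of "{..n}" "position w"]]
proof (rule eventually_mono)
  fix \<omega>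
  let ?H = "H_iter (walk_symbols f G \<omega> w) n"
  have "{x \<in> {0..1}. walk f G W \<omega> x \<in> {y. \<forall>k\<in>{..n}. y k = position w k}} = ?H"
  proof (intro set_eqI iffI)
    fix x assume "x \<in> {x \<in> {0..1}. walk f G W \<omega> x \<in> {y. \<forall>k\<in>{..n}. y k = position w k}}"
    then have "x \<in> {0..1}" "\<forall>k\<le>n. walk f G W \<omega> x k = position w k" by auto
    then show "x \<in> ?H" using walk_eq_iff[OF w] by blast
  next
    fix x assume x: "x \<in> ?H"
    then have "x \<in> {0..1}" using H_iter_subset by blast
    moreover from walk_eq_iff[OF w this] x have "\<forall>k\<le>n. walk f G W \<omega> x k = position w k" by blast
    ultimately show "x \<in> {x \<in> {0..1}. walk f G W \<omega> x \<in> {y. \<forall>k\<in>{..n}. y k = position w k}}" by auto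
  qed
  moreover have "?H \<in> sets unit_leb"
    using H_iter_measurable[OF symbols_in[OF w]] H_iter_subset by (simp add: sets_restrict_space_iff)
  ultimately show "emeasure (\<kappa> \<omega>) {y. \<forall>k\<in>{..n}. y k = position w k} = ennreal (word_prob f G h \<omega> n w)"
    if "emeasure (\<kappa> \<omega>) {y. \<forall>k\<in>{..n}. y k = position w k} =
      emeasure D {x \<in> {0..1}. walk f G W \<omega> x \<in> {y. \<forall>k\<in>{..n}. y k = position w k}}"
    using that emeasure_D word_prob_eq[OF w] by simp
qed simp

lemma AE_kernel_admissible:
  assumes \<kappa>: "cond_law (joint_law f G W h P) P \<kappa>"
  shows "AE \<omega> in P. emeasure (\<kappa> \<omega>) {y. \<not> admissible_path W y} = 0"
proof -
  have "UNIV - {y :: nat \<Rightarrow> int ^ 'd. admissible_path W y} \<in> sets path_space"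
    using sets.compl_sets[OF admissible_path_sets] by (simp add: space_path_space)
  moreover have "UNIV - {y. admissible_path W y} = {y. \<not> admissible_path W y}" by auto
  ultimately have B: "{y :: nat \<Rightarrow> int ^ 'd. \<not> admissible_path W y} \<in> sets path_space" by simp
  show ?thesis
    using AE_kernel_eq[OF \<kappa> B]
  proof (rule eventually_mono)
    fix \<omega>
    have "{x \<in> {0..1}. walk f G W \<omega> x \<in> {y. \<not> admissible_path W y}} = {}" using walk_admissible by auto
    then show "emeasure (\<kappa> \<omega>) {y. \<not> admissible_path W y} = 0"
      if "emeasure (\<kappa> \<omega>) {y. \<not> admissible_path W y} = emeasure D {x \<in> {0..1}. walk f G W \<omega> x \<in> {y. \<not> admissible_path W y}}"
      using that by (simp del: Collect_empty_eq)
  qed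
qed

lemma W_ne: "W \<noteq> {}"
  using G_cover by fastforce

text \<open>There may be uncountably many words, but each event depends on finitely many jumps.
  Finite lists are countable, so one null set serves for all words.\<close>

lemma AE_kernel:
  assumes \<kappa>: "cond_law (joint_law f G W h P) P \<kappa>"
  shows "AE \<omega> in P. prob_space (\<kappa> \<omega>) \<and> sets (\<kappa> \<omega>) = sets path_space \<and>
    (AE y in \<kappa> \<omega>. admissible_path W y) \<and>
    (\<forall>n. \<forall>w\<in>UNIV \<rightarrow> W. measure (\<kappa> \<omega>) {y. \<forall>k\<in>{..n}. y k = position w k} = word_prob f G h \<omega> n w)"
proof -
  obtain w\<^sub>0 where w0: "w\<^sub>0 \<in> W" using W_ne by blast
  \<comment> \<open>Completes a list to a word; entries outside \<open>W\<close> are replaced as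
    well, so that arbitrary lists can be used.\<close>
  define ext where "ext l k = (if k < length l \<and> l ! k \<in> W then l ! k else w\<^sub>0)" for l k
  have ext: "ext l \<in> UNIV \<rightarrow> W" for l using w0 by (auto simp: ext_def)
  have "AE \<omega> in P. \<forall>l :: (int ^ 'd) list. emeasure (\<kappa> \<omega>) {y. \<forall>k\<in>{..length l}. y k = position (ext l) k}
      = ennreal (word_prob f G h \<omega> (length l) (ext l))"
    unfolding AE_all_countable using AE_kernel_cylinder[OF \<kappa> ext] by blast
  with AE_kernel_admissible[OF \<kappa>] AE_space[of P] show ?thesis
  proof eventually_elim
    case (elim \<omega>)
    have "\<kappa> \<omega> \<in> space (prob_algebra path_space)"
      using \<kappa> elim(2) unfolding cond_law_def by (blast dest: measurable_space)
    then have p: "prob_space (\<kappa> \<omega>)" and s: "sets (\<kappa> \<omega>) = sets path_space"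
      by (auto simp: space_prob_algebra)
    have sp: "space (\<kappa> \<omega>) = UNIV" using sets_eq_imp_space_eq[OF s] by (simp add: space_path_space)
    have "{y. \<not> admissible_path W y} \<in> null_sets (\<kappa> \<omega>)"
    proof (rule null_setsI[OF elim(1)])
      have "UNIV - {y :: nat \<Rightarrow> int ^ 'd. admissible_path W y} \<in> sets path_space"
        using sets.compl_sets[OF admissible_path_sets] by (simp add: space_path_space)
      moreover have "UNIV - {y. admissible_path W y} = {y. \<not> admissible_path W y}" by auto
      ultimately show "{y. \<not> admissible_path W y} \<in> sets (\<kappa> \<omega>)" using s by simp
    qed
    then have ad: "AE y in \<kappa> \<omega>. admissible_path W y" by (rule AE_I') (auto simp: sp)
    have "measure (\<kappa> \<omega>) {y. \<forall>k\<in>{..n}. y k = position w k} = word_prob f G h \<omega> n w" if w: "w \<in> UNIV \<rightarrow> W" for n w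
    proof -
      define l where "l = map w [0..<n]"
      have len: "length l = n" by (simp add: l_def)
      have e: "ext l k = w k" if "k < n" for k using that w by (auto simp: ext_def l_def)
      have "position (ext l) k = position w k" if "k \<le> n" for k
        using e that by (intro position_cong) auto
      then have eq: "{y. \<forall>k\<in>{..length l}. y k = position (ext l) k} = {y. \<forall>k\<in>{..n}. y k = position w k}"
        unfolding len by auto
      have "word_prob f G h \<omega> (length l) (ext l) = word_prob f G h \<omega> n w"
        unfolding len by (rule word_prob_cong) (rule e)
      with spec[OF elim(3), of l] have "emeasure (\<kappa> \<omega>) {y. \<forall>k\<in>{..n}. y k = position w k} = ennreal (word_prob f G h \<omega> n w)"
        unfolding eq by (rule trans[OF _ arg_cong])
      then show ?thesis using word_prob_pos[OF w, of \<omega> n] by (simp add: measure_def)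
    qed
    then show ?case using p s ad by blast
  qed
qed


text \<open>Conditioning on the window from a to n averages, with positive weights, the next-jump
  probabilities over all words whose path agrees with z there. By loss of memory each of them is
  close to the same number, which involves z only from time b on.\<close>

lemma cond_prob_near:
  assumes \<mu>: "prob_space \<mu>" "sets \<mu> = sets path_space" "AE y in \<mu>. admissible_path W y"
    and cyl: "\<And>n w. w \<in> UNIV \<rightarrow> W \<Longrightarrow> measure \<mu> {y. \<forall>k\<in>{..n}. y k = position w k} = word_prob f G h \<omega> n w"
    and near: "\<And>n m w. w \<in> UNIV \<rightarrow> W \<Longrightarrow> m \<le> n \<Longrightarrow>
       \<bar>next_prob f G h \<omega> n w
         - next_prob f G h (translate (position w m) \<omega>) (n - m) (\<lambda>k. w (m + k))\<bar> \<le> c * \<nu> ^ (n - m)"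
    and z: "admissible_path W z" and ab: "a \<le> b" "b \<le> n"
  shows "\<bar>\<P>(y in \<mu>. y (n + 1) = z (n + 1) \<bar> \<forall>k\<in>{a..n}. y k = z k)
      - next_prob f G h (translate (z b) \<omega>) (n - b) (\<lambda>k. z (Suc (b + k)) - z (b + k))\<bar> \<le> c * \<nu> ^ (n - b)"
proof -
  interpret prob_space \<mu> by (rule \<mu>(1))
  define w where "w k = z (Suc k) - z k" for k
  have w: "w k \<in> W" for k using z by (simp add: w_def admissible_path_def)
  have zpos: "position w k = z k" for k
    by (induction k) (use z in \<open>simp_all add: position_Suc w_def admissible_path_def\<close>)
  define q where "q = next_prob f G h (translate (z b) \<omega>) (n - b) (\<lambda>k. w (b + k))"
  define e where "e = c * \<nu> ^ (n - b)"
  \<comment> \<open>From time n on the word follows the jumps of z, so that its jump number n leads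
    to z (n + 1), the position whose probability is sought.\<close>
  define ext where "ext l k = (if k < n then l ! k else w k)" for l k
  define Ws where "Ws = {l. set l \<subseteq> W \<and> length l = n \<and> (\<forall>k\<in>{a..n}. position (ext l) k = z k)}"
  have ext: "ext l \<in> UNIV \<rightarrow> W" if "l \<in> Ws" for l
    using that w by (auto simp: ext_def Ws_def subset_iff)
  have fin: "finite Ws"
    by (rule finite_subset[OF _ finite_lists_length_eq[OF finite_W, of n]]) (auto simp: Ws_def)
  have "map w [0..<n] \<in> Ws"
  proof -
    have "position (ext (map w [0..<n])) k = position w k" for k by (rule position_cong) (simp add: ext_def)
    then show ?thesis using w by (auto simp: Ws_def zpos)
  qed
  then have ne: "Ws \<noteq> {}" by blast
  define Cy where "Cy l j = {y :: nat \<Rightarrow> int ^ 'd. \<forall>k\<in>{..j}. y k = position (ext l) k}" for l j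
  have Cy_sets: "Cy l j \<in> sets \<mu>" for l j unfolding Cy_def \<mu>(2) by (rule path_cylinder_sets) simp
  have disj: "disjoint_family_on (\<lambda>l. Cy l j) Ws" if "n \<le> j" for j
    unfolding disjoint_family_on_def
  proof (intro ballI impI, rule ccontr)
    fix l l' assume l: "l \<in> Ws" "l' \<in> Ws" "l \<noteq> l'" and "Cy l j \<inter> Cy l' j \<noteq> {}"
    then obtain y where y: "y \<in> Cy l j" "y \<in> Cy l' j" by blast
    have "l ! k = l' ! k" if "k < n" for k
    proof -
      have "position (ext l) k = position (ext l') k" "position (ext l) (Suc k) = position (ext l') (Suc k)"
        using y \<open>n \<le> j\<close> that by (auto simp: Cy_def)
      then show ?thesis using that by (simp add: position_Suc ext_def)
    qed
    moreover have "length l = n" "length l' = n" using l by (auto simp: Ws_def)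
    ultimately have "l = l'" by (intro nth_equalityI) auto
    then show False using l(3) by simp
  qed
  have union: "y \<in> (\<Union>l\<in>Ws. Cy l n) \<longleftrightarrow> (\<forall>k\<in>{a..n}. y k = z k)" if y: "admissible_path W y" for y
  proof
    assume "y \<in> (\<Union>l\<in>Ws. Cy l n)"
    then show "\<forall>k\<in>{a..n}. y k = z k" by (auto simp: Ws_def Cy_def)
  next
    assume yz: "\<forall>k\<in>{a..n}. y k = z k"
    define l where "l = map (\<lambda>k. y (Suc k) - y k) [0..<n]"
    have p: "k \<le> n \<Longrightarrow> position (ext l) k = y k" for k
      by (induction k) (use y in \<open>simp_all add: position_Suc ext_def l_def admissible_path_def\<close>)
    have "l \<in> Ws" using y yz p by (auto simp: Ws_def l_def admissible_path_def)
    moreover have "y \<in> Cy l n" using p by (auto simp: Cy_def)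
    ultimately show "y \<in> (\<Union>l\<in>Ws. Cy l n)" by blast
  qed
  have extend: "y \<in> Cy l (Suc n) \<longleftrightarrow> y \<in> Cy l n \<and> y (Suc n) = z (Suc n)" if "l \<in> Ws" for y l
  proof -
    have "position (ext l) n = z n" using that ab by (auto simp: Ws_def)
    then have "position (ext l) (Suc n) = z (Suc n)" by (simp add: position_Suc ext_def w_def)
    then show ?thesis by (auto simp: Cy_def le_Suc_eq)
  qed
  have fin_sets: "{y :: nat \<Rightarrow> int ^ 'd. \<forall>k\<in>I. y k = z k} \<in> sets \<mu>" if "finite I" for I
    unfolding \<mu>(2) using that by (rule path_cylinder_sets)
  have sp: "space \<mu> = UNIV" using sets_eq_imp_space_eq[OF \<mu>(2)] by (simp add: space_path_space)
  have den: "prob {y \<in> space \<mu>. \<forall>k\<in>{a..n}. y k = z k} = (\<Sum>l\<in>Ws. word_prob f G h \<omega> n (ext l))"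
  proof -
    have "prob {y \<in> space \<mu>. \<forall>k\<in>{a..n}. y k = z k} = prob (\<Union>l\<in>Ws. Cy l n)"
    proof (rule measure_eq_AE)
      show "AE y in \<mu>. y \<in> {y \<in> space \<mu>. \<forall>k\<in>{a..n}. y k = z k} \<longleftrightarrow> y \<in> (\<Union>l\<in>Ws. Cy l n)"
        using \<mu>(3) by eventually_elim (use union in \<open>simp add: sp\<close>)
    qed (use fin Cy_sets fin_sets[of "{a..n}"] in \<open>auto simp: sp\<close>)
    also have "\<dots> = (\<Sum>l\<in>Ws. prob (Cy l n))"
      using fin Cy_sets disj[OF order_refl] by (intro finite_measure_finite_Union) auto
    also have "\<dots> = (\<Sum>l\<in>Ws. word_prob f G h \<omega> n (ext l))"
      unfolding Cy_def using cyl ext by (intro sum.cong) auto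
    finally show ?thesis .
  qed
  have num: "prob {y \<in> space \<mu>. y (n + 1) = z (n + 1) \<and> (\<forall>k\<in>{a..n}. y k = z k)} = (\<Sum>l\<in>Ws. word_prob f G h \<omega> (Suc n) (ext l))"
  proof -
    have "prob {y \<in> space \<mu>. y (n + 1) = z (n + 1) \<and> (\<forall>k\<in>{a..n}. y k = z k)} = prob (\<Union>l\<in>Ws. Cy l (Suc n))"
    proof (rule measure_eq_AE)
      show "AE y in \<mu>. y \<in> {y \<in> space \<mu>. y (n + 1) = z (n + 1) \<and> (\<forall>k\<in>{a..n}. y k = z k)} \<longleftrightarrow> y \<in> (\<Union>l\<in>Ws. Cy l (Suc n))"
        using \<mu>(3)
      proof eventually_elim
        case (elim y)
        have "y \<in> (\<Union>l\<in>Ws. Cy l (Suc n)) \<longleftrightarrow> y \<in> (\<Union>l\<in>Ws. Cy l n) \<and> y (Suc n) = z (Suc n)"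
          using extend by blast
        then show ?case using union[OF elim] by (auto simp: sp)
      qed
      have "{y \<in> space \<mu>. y (n + 1) = z (n + 1) \<and> (\<forall>k\<in>{a..n}. y k = z k)} = {y. \<forall>k\<in>insert (Suc n) {a..n}. y k = z k}"
        by (auto simp: sp)
      then show "{y \<in> space \<mu>. y (n + 1) = z (n + 1) \<and> (\<forall>k\<in>{a..n}. y k = z k)} \<in> sets \<mu>"
        using fin_sets[of "insert (Suc n) {a..n}"] by simp
    qed (use fin Cy_sets in auto)
    also have "\<dots> = (\<Sum>l\<in>Ws. prob (Cy l (Suc n)))"
      using fin Cy_sets disj[of "Suc n"] by (intro finite_measure_finite_Union) auto
    also have "\<dots> = (\<Sum>l\<in>Ws. word_prob f G h \<omega> (Suc n) (ext l))"
      unfolding Cy_def using cyl ext by (intro sum.cong) auto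
    finally show ?thesis .
  qed
  have each: "\<bar>word_prob f G h \<omega> (Suc n) (ext l) - q * word_prob f G h \<omega> n (ext l)\<bar> \<le> e * word_prob f G h \<omega> n (ext l)"
    if l: "l \<in> Ws" for l
  proof -
    let ?p = "word_prob f G h \<omega> n (ext l)"
    have p: "0 < ?p" using ext[OF l] by (rule word_prob_pos)
    have pz: "position (ext l) k = z k" if "a \<le> k" "k \<le> n" for k using l that by (auto simp: Ws_def)
    have "next_prob f G h (translate (position (ext l) b) \<omega>) (n - b) (\<lambda>k. ext l (b + k)) = q"
      unfolding q_def pz[OF ab]
    proof (rule next_prob_cong)
      fix k assume k: "k \<le> n - b"
      show "ext l (b + k) = w (b + k)"
      proof (cases "b + k < n")
        case True
        have "position (ext l) (Suc (b + k)) - position (ext l) (b + k) = ext l (b + k)" by (simp add: position_Suc)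
        moreover have "position (ext l) (Suc (b + k)) = z (Suc (b + k))" "position (ext l) (b + k) = z (b + k)"
          using True ab by (auto intro!: pz)
        ultimately show ?thesis by (simp add: w_def)
      qed (simp add: ext_def)
    qed
    then have "\<bar>next_prob f G h \<omega> n (ext l) - q\<bar> \<le> e" using near[OF ext[OF l] ab(2)] by (simp add: e_def)
    moreover have "word_prob f G h \<omega> (Suc n) (ext l) - q * ?p = (next_prob f G h \<omega> n (ext l) - q) * ?p"
      using p by (simp add: next_prob_def left_diff_distrib)
    ultimately show ?thesis using p by (simp add: abs_mult mult_right_mono)
  qed
  let ?S = "\<Sum>l\<in>Ws. word_prob f G h \<omega> n (ext l)" and ?S' = "\<Sum>l\<in>Ws. word_prob f G h \<omega> (Suc n) (ext l)"
  have S: "0 < ?S" using fin ne word_prob_pos ext by (intro sum_pos) auto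
  have "\<bar>?S' - q * ?S\<bar> = \<bar>\<Sum>l\<in>Ws. word_prob f G h \<omega> (Suc n) (ext l) - q * word_prob f G h \<omega> n (ext l)\<bar>"
    by (simp add: sum_subtractf sum_distrib_left)
  also have "\<dots> \<le> (\<Sum>l\<in>Ws. e * word_prob f G h \<omega> n (ext l))"
    by (rule order_trans[OF sum_abs sum_mono]) (rule each)
  also have "\<dots> = e * ?S" by (simp add: sum_distrib_left)
  finally have "\<bar>?S' - q * ?S\<bar> / ?S \<le> e" using S by (simp add: pos_divide_le_eq)
  moreover have "\<bar>?S' - q * ?S\<bar> / ?S = \<bar>?S' / ?S - q\<bar>"
  proof -
    have "?S' / ?S - q = (?S' - q * ?S) / ?S" using S by (simp add: diff_divide_distrib)
    then show ?thesis using S by (simp add: abs_divide)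
  qed
  ultimately have "\<bar>?S' / ?S - q\<bar> \<le> e" by simp
  then show ?thesis unfolding cond_prob_def num den q_def e_def w_def by simp
qed

text \<open>Both conditional probabilities are compared with the same reference value at b = n - m +
  1, for the windows starting at b and at 1. As n - b = m - 1, one factor \<nu> is lost, whence the
  constant 2 c / \<nu>.\<close>

theorem cond_law_close:
  assumes c: "0 < c" and \<nu>: "0 < \<nu>"
    and near: "\<And>\<omega> n m w. w \<in> UNIV \<rightarrow> W \<Longrightarrow> m \<le> n \<Longrightarrow>
       \<bar>next_prob f G h \<omega> n w
         - next_prob f G h (translate (position w m) \<omega>) (n - m) (\<lambda>k. w (m + k))\<bar> \<le> c * \<nu> ^ (n - m)"
    and \<kappa>: "cond_law (joint_law f G W h P) P \<kappa>"
  shows "AE \<omega> in P. \<forall>m n z. 1 \<le> m \<and> m \<le> n \<and> admissible_path W z \<longrightarrow>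
    \<bar>\<P>(y in \<kappa> \<omega>. y (n + 1) = z (n + 1) \<bar> \<forall>k\<in>{n - m + 1..n}. y k = z k)
      - \<P>(y in \<kappa> \<omega>. y (n + 1) = z (n + 1) \<bar> \<forall>k\<in>{1..n}. y k = z k)\<bar> \<le> 2 * c / \<nu> * \<nu> ^ m"
  using AE_kernel[OF \<kappa>]
proof eventually_elim
  case (elim \<omega>)
  show ?case
  proof (intro allI impI)
    fix m n :: nat and z assume z: "1 \<le> m \<and> m \<le> n \<and> admissible_path W z"
    let ?b = "n - m + 1"
    let ?q = "next_prob f G h (translate (z ?b) \<omega>) (n - ?b) (\<lambda>k. z (Suc (?b + k)) - z (?b + k))"
    have *: "\<bar>\<P>(y in \<kappa> \<omega>. y (n + 1) = z (n + 1) \<bar> \<forall>k\<in>{a..n}. y k = z k) - ?q\<bar> \<le> c * \<nu> ^ (n - ?b)"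
      if "a \<le> ?b" for a
      by (rule cond_prob_near[where \<mu> = "\<kappa> \<omega>"]) (use elim near z that in auto)
    have "n - ?b = m - 1" using z by simp
    then have "\<nu> ^ (n - ?b) = \<nu> ^ m / \<nu>" using z \<nu> by (cases m) auto
    then have "2 * (c * \<nu> ^ (n - ?b)) = 2 * c / \<nu> * \<nu> ^ m" by simp
    then show "\<bar>\<P>(y in \<kappa> \<omega>. y (n + 1) = z (n + 1) \<bar> \<forall>k\<in>{?b..n}. y k = z k)
      - \<P>(y in \<kappa> \<omega>. y (n + 1) = z (n + 1) \<bar> \<forall>k\<in>{1..n}. y k = z k)\<bar> \<le> 2 * c / \<nu> * \<nu> ^ m"
      using *[of ?b] *[of 1] by linarith
  qed
qed

theorem loss_of_memory_walk:
  "n2 \<ge> 1 \<and> (\<forall>n\<^sub>3 \<ge> n2. cond_C3 (range f) (holes G W) n2 n\<^sub>3 \<longrightarrow>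
    (\<exists>c \<nu>. c > 0 \<and> 0 < \<nu> \<and> \<nu> < 1 \<and> cond_Exp f G W h P c \<nu> \<and>
      (\<exists>c'>0. \<forall>\<kappa>. cond_law (joint_law f G W h P) P \<kappa> \<longrightarrow>
        (AE \<omega> in P. \<forall>m n z. 1 \<le> m \<and> m \<le> n \<and> admissible_path W z \<longrightarrow>
          \<bar>\<P>(y in \<kappa> \<omega>. y (n + 1) = z (n + 1) \<bar> \<forall>k\<in>{n - m + 1..n}. y k = z k)
            - \<P>(y in \<kappa> \<omega>. y (n + 1) = z (n + 1) \<bar> \<forall>k\<in>{1..n}. y k = z k)\<bar> \<le> c' * \<nu> ^ m))))"
proof (rule conjI[OF n_two_ge_1], intro allI impI)
  fix n\<^sub>3 assume C3: "n2 \<le> n\<^sub>3" "cond_C3 (range f) (holes G W) n2 n\<^sub>3"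
  obtain c \<nu> where c: "0 < c \<and> 0 < \<nu> \<and> \<nu> < 1 \<and> (\<forall>\<omega> n m. \<forall>w\<in>UNIV \<rightarrow> W. m \<le> n \<longrightarrow>
       \<bar>next_prob f G h \<omega> n w
         - next_prob f G h (translate (position w m) \<omega>) (n - m) (\<lambda>k. w (m + k))\<bar> \<le> c * \<nu> ^ (n - m))"
    using cond_Exp_of_C3[OF C3] by (elim exE)
  have near: "\<bar>next_prob f G h \<omega> n w
      - next_prob f G h (translate (position w m) \<omega>) (n - m) (\<lambda>k. w (m + k))\<bar> \<le> c * \<nu> ^ (n - m)"
    if "w \<in> UNIV \<rightarrow> W" "m \<le> n" for \<omega> n m w
    using c that by blast
  have E: "cond_Exp f G W h P c \<nu>"
    unfolding cond_Exp_def by (intro AE_I2 allI ballI impI near) auto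
  have pos: "0 < 2 * c / \<nu>" using c by simp
  show "\<exists>c \<nu>. c > 0 \<and> 0 < \<nu> \<and> \<nu> < 1 \<and> cond_Exp f G W h P c \<nu> \<and>
      (\<exists>c'>0. \<forall>\<kappa>. cond_law (joint_law f G W h P) P \<kappa> \<longrightarrow>
        (AE \<omega> in P. \<forall>m n z. 1 \<le> m \<and> m \<le> n \<and> admissible_path W z \<longrightarrow>
          \<bar>\<P>(y in \<kappa> \<omega>. y (n + 1) = z (n + 1) \<bar> \<forall>k\<in>{n - m + 1..n}. y k = z k)
            - \<P>(y in \<kappa> \<omega>. y (n + 1) = z (n + 1) \<bar> \<forall>k\<in>{1..n}. y k = z k)\<bar> \<le> c' * \<nu> ^ m))"
  proof (rule exI[of _ c], rule exI[of _ \<nu>], intro conjI)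
    show "0 < c" "0 < \<nu>" "\<nu> < 1" using c by auto
    show "cond_Exp f G W h P c \<nu>" by (rule E)
    show "\<exists>c'>0. \<forall>\<kappa>. cond_law (joint_law f G W h P) P \<kappa> \<longrightarrow>
        (AE \<omega> in P. \<forall>m n z. 1 \<le> m \<and> m \<le> n \<and> admissible_path W z \<longrightarrow>
          \<bar>\<P>(y in \<kappa> \<omega>. y (n + 1) = z (n + 1) \<bar> \<forall>k\<in>{n - m + 1..n}. y k = z k)
            - \<P>(y in \<kappa> \<omega>. y (n + 1) = z (n + 1) \<bar> \<forall>k\<in>{1..n}. y k = z k)\<bar> \<le> c' * \<nu> ^ m)"
    proof (rule exI[of _ "2 * c / \<nu>"], rule conjI[OF pos], rule allI, rule impI)
      fix \<kappa> assume \<kappa>: "cond_law (joint_law f G W h P) P \<kappa>"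
      show "AE \<omega> in P. \<forall>m n z. 1 \<le> m \<and> m \<le> n \<and> admissible_path W z \<longrightarrow>
          \<bar>\<P>(y in \<kappa> \<omega>. y (n + 1) = z (n + 1) \<bar> \<forall>k\<in>{n - m + 1..n}. y k = z k)
            - \<P>(y in \<kappa> \<omega>. y (n + 1) = z (n + 1) \<bar> \<forall>k\<in>{1..n}. y k = z k)\<bar> \<le> 2 * c / \<nu> * \<nu> ^ m"
        by (rule cond_law_close[OF _ _ near \<kappa>]) (use c in auto)
    qed
  qed
qed

end

theorem theorem6p1:
  fixes f :: "'a::finite \<Rightarrow> real \<Rightarrow> real"
    and G :: "'a \<Rightarrow> int ^ 'd \<Rightarrow> real set"
    and W :: "(int ^ 'd) set"
    and P :: "(int ^ 'd \<Rightarrow> 'a) measure"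
    and h\<^sub>0 :: "real \<Rightarrow> real"
    and lam C K \<xi> :: real
  assumes "finite W"
    and "prob_space P" and "sets P = sets env_space"
    and "\<And>z. distr P P (translate z) = P"
    and "\<And>\<alpha>. f \<alpha> \<in> {0..1} \<rightarrow> {0..1}"
    and "\<And>\<alpha>. piecewise_C2 (f \<alpha>)"
    and "lam > 1" and "\<And>\<alpha> x. x \<in> smooth_set (f \<alpha>) \<Longrightarrow> \<bar>deriv (f \<alpha>) x\<bar> \<ge> lam"
    and "\<And>\<alpha> w. w \<in> W \<Longrightarrow> is_interval (G \<alpha> w)"
    and "\<And>\<alpha>. disjoint_family_on (G \<alpha>) W" and "\<And>\<alpha>. (\<Union>w\<in>W. G \<alpha> w) = {0..1}"
    and "total_variation h\<^sub>0 {0..1} < \<infinity>" and "ess_inf h\<^sub>0 > 0"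
    and "(\<integral>x. h\<^sub>0 x \<partial>unit_leb) = 1"
    and "distortion_bound (range f) (holes G W) C"
    and "cond_C1 (range f) (holes G W)"
    and "cond_C2 (range f) (holes G W) K \<xi>"
  shows "n_two (range f) (holes G W) C K \<xi> \<ge> 1 \<and>
    (\<forall>n\<^sub>3 \<ge> n_two (range f) (holes G W) C K \<xi>. cond_C3 (range f) (holes G W) (n_two (range f) (holes G W) C K \<xi>) n\<^sub>3 \<longrightarrow>
      (\<exists>c \<nu>. c > 0 \<and> 0 < \<nu> \<and> \<nu> < 1 \<and> cond_Exp f G W h\<^sub>0 P c \<nu> \<and>
        (\<exists>c'>0. \<forall>\<kappa>. cond_law (joint_law f G W h\<^sub>0 P) P \<kappa> \<longrightarrow>
          (AE \<omega> in P. \<forall>m n z. 1 \<le> m \<and> m \<le> n \<and> admissible_path W z \<longrightarrow>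
            \<bar>\<P>(y in \<kappa> \<omega>. y (n + 1) = z (n + 1) \<bar> \<forall>k\<in>{n - m + 1..n}. y k = z k)
              - \<P>(y in \<kappa> \<omega>. y (n + 1) = z (n + 1) \<bar> \<forall>k\<in>{1..n}. y k = z k)\<bar> \<le> c' * \<nu> ^ m))))"
proof -
  have "open_system (range f) (holes G W) lam C K \<xi>"
  proof (rule open_system.intro)
    show "finite (range f)" "range f \<noteq> {}" by auto
    have "W \<noteq> {}" using assms(11) by fastforce
    then show "holes G W \<noteq> {}" by (auto simp: holes_def)
    show "expanding_map T lam" if "T \<in> range f" for T
      using that assms(5-8) by (auto simp: expanding_map_def)
    show "is_interval H" if "H \<in> holes G W" for H using that assms(9) by (auto simp: holes_def)
    show "H \<subseteq> {0..1}" if "H \<in> holes G W" for H using that assms(11) by (fastforce simp: holes_def)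
  qed (fact assms)+
  then have "walk_system f G W lam C K \<xi> h\<^sub>0 P"
    using assms(1-3,10-14) by (intro walk_system.intro walk_system_axioms.intro)
  then show ?thesis by (rule walk_system.loss_of_memory_walk)
qed

end
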